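(* Let $\mathbf{k}$ be a field of characteristic zero, let $S=\mathbb{Z}_{\ge 0}^n$ be the first octant with standard basis $e_1,\dots,e_n$, and let $I\subset\mathbf{k}[S]$ be a full monomial ideal with cofinite support. The connected component $\operatorname{Aut}^0_{\mathbf{k}}(\mathbf{k}[S]/I)$ is solvable if and only if there is no pair $i\neq j$ such that both $e_i-e_j$ and $e_j-e_i$ belong to $\mathcal{R}(S,I)$. Equivalently, this is the condition for the reductive part of $\operatorname{Aut}^0_{\mathbf{k}}(\mathbf{k}[S]/I)$ to be exactly the torus $T$.
   Context: $\mathbf{k}[S]=\mathbf{k}[x_1,\dots,x_n]$, with $\mathbf{x}^m=x_1^{m_1}\cdots x_n^{m_n}$. A monomial ideal is one generated by finitely many monomials; $\operatorname{supp}(I)=\{m\in S\mid\mathbf{x}^m\in I\}$. $I$ has cofinite support if $S\setminus\operatorname{supp}(I)$ is finite. $I$ is full if no $e_i$ lies in $\operatorname{supp}(I)$. $\operatorname{Aut}_{\mathbf{k}}(\mathbf{k}[S]/I)$ is the group of $\mathbf{k}$-algebra automorphisms, a linear algebraic group, and $\operatorname{Aut}^0_{\mathbf{k}}$ is its identity component. $T=\operatorname{Spec}\mathbf{k}[\mathbb{Z}^n]$ is the torus acting on $\mathbf{k}[S]/I$ by $t\cdot\overline{\mathbf{x}}^m=t(m)\overline{\mathbf{x}}^m$ for $t\in\operatorname{Hom}(\mathbb{Z}^n,\mathbf{k}^* )$, identified with its image in $\operatorname{Aut}_{\mathbf{k}}(\mathbf{k}[S]/I)$; it is a maximal torus. The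 reductive part is the Levi factor $L$, containing $T$, in a Levi decomposition $\operatorname{Aut}^0_{\mathbf{k}}(\mathbf{k}[S]/I)=L\ltimes R$, where $R$ is the unipotent radical. $\mathcal{R}(S,I)\subset\mathbb{Z}^n$ is the set of those $\alpha$ for which there is a non-zero nilpotent $\mathbf{k}$-derivation of $\mathbf{k}[S]/I$ that is homogeneous of degree $\alpha$ for the $\mathbb{Z}^n$-grading (where $\overline{\mathbf{x}}^m$ has degree $m$) and liftable, that is, induced by a derivation $\partial$ of $\mathbf{k}[S]$ with $\partial(I)\subset I$. Such a derivation has the form $\overline{\mathbf{x}}^m\mapsto p(m)\overline{\mathbf{x}}^{m+\alpha}$ for some $p\in\operatorname{Hom}(\mathbb{Z}^n,\mathbf{k})$. *)

theory Defs
  imports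
    "HOL-Analysis.Analysis"
    "HOL-Algebra.Algebra"
    "HOL-Library.Poly_Mapping"
begin

section \<open>The automorphism group of a finite-dimensional algebra\<close>

text \<open>
  An algebra over the field \<open>'k\<close> is a record of type \<open>('k, 'a) module\<close>. Linear algebraic groups
  are treated through their groups of rational points with the Zariski topology. In
  characteristic zero the rational points of a connected linear algebraic group are dense
  in it, so identity components, solvability and unipotent radicals can be read off from the
  rational points, even if the field is not algebraically closed.
\<close>

definition alg_auts :: "('k::field, 'a) module \<Rightarrow> ('a \<Rightarrow> 'a) set" where
  "alg_auts A = {g \<in> Bij (carrier A). g \<in> ring_hom A A \<and>
     (\<forall>c. \<forall>x \<in> carrier A. g (c \<odot>\<^bsub>A\<^esub> x) = c \<odot>\<^bsub>A\<^esub> g x)}"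

definition aut_group :: "('k::field, 'a) module \<Rightarrow> ('a \<Rightarrow> 'a) monoid" where
  "aut_group A = (BijGroup (carrier A))\<lparr>carrier := alg_auts A\<rparr>"

definition linear_functionals :: "('k::field, 'a) module \<Rightarrow> ('a \<Rightarrow> 'k) set" where
  "linear_functionals A = {\<phi>.
     (\<forall>x \<in> carrier A. \<forall>y \<in> carrier A. \<phi> (x \<oplus>\<^bsub>A\<^esub> y) = \<phi> x + \<phi> y) \<and>
     (\<forall>c. \<forall>x \<in> carrier A. \<phi> (c \<odot>\<^bsub>A\<^esub> x) = c * \<phi> x)}"

text \<open>
  Polynomial functions in the matrix entries of an endomorphism: the functions
  \<open>g \<mapsto> \<phi> (g x)\<close> span the same space as the matrix entries with respect to any basis.
\<close>

inductive_set polynomial_functions :: "('k::field, 'a) module \<Rightarrow> (('a \<Rightarrow> 'a) \<Rightarrow> 'k) set"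
  for A :: "('k::field, 'a) module" where
  const: "(\<lambda>g. c) \<in> polynomial_functions A"
| entry: "\<phi> \<in> linear_functionals A \<Longrightarrow> x \<in> carrier A \<Longrightarrow> (\<lambda>g. \<phi> (g x)) \<in> polynomial_functions A"
| add: "p \<in> polynomial_functions A \<Longrightarrow> q \<in> polynomial_functions A \<Longrightarrow>
    (\<lambda>g. p g + q g) \<in> polynomial_functions A"
| mult: "p \<in> polynomial_functions A \<Longrightarrow> q \<in> polynomial_functions A \<Longrightarrow>
    (\<lambda>g. p g * q g) \<in> polynomial_functions A"

text \<open>
  Allowing the inverse of the determinant as a further regular function would not change
  this topology.
\<close>

definition zariski :: "('k::field, 'a) module \<Rightarrow> ('a \<Rightarrow> 'a) topology" where
  "zariski A = topology_generated_by
     {{g \<in> alg_auts A. p g \<noteq> 0} | p. p \<in> polynomial_functions A}"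

definition identity_component :: "('k::field, 'a) module \<Rightarrow> ('a \<Rightarrow> 'a) set" where
  "identity_component A = connected_component_of_set (zariski A) \<one>\<^bsub>aut_group A\<^esub>"

definition unipotent :: "('k::field, 'a) module \<Rightarrow> ('a \<Rightarrow> 'a) \<Rightarrow> bool" where
  "unipotent A g \<longleftrightarrow>
     (\<exists>N. \<forall>x \<in> carrier A. ((\<lambda>y. g y \<ominus>\<^bsub>A\<^esub> y) ^^ N) x = \<zero>\<^bsub>A\<^esub>)"

definition normal_unipotent :: "('k::field, 'a) module \<Rightarrow> ('a \<Rightarrow> 'a) set \<Rightarrow> ('a \<Rightarrow> 'a) set \<Rightarrow> bool" where
  "normal_unipotent A H N \<longleftrightarrow>
     N \<lhd> (aut_group A)\<lparr>carrier := H\<rparr> \<and> closedin (zariski A) N \<and> connectedin (zariski A) N \<and>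
     (\<forall>g \<in> N. unipotent A g)"

definition is_unipotent_radical :: "('k::field, 'a) module \<Rightarrow> ('a \<Rightarrow> 'a) set \<Rightarrow> ('a \<Rightarrow> 'a) set \<Rightarrow> bool" where
  "is_unipotent_radical A H R \<longleftrightarrow>
     normal_unipotent A H R \<and> (\<forall>N. normal_unipotent A H N \<longrightarrow> N \<subseteq> R)"

definition reductive :: "('k::field, 'a) module \<Rightarrow> ('a \<Rightarrow> 'a) set \<Rightarrow> bool" where
  "reductive A L \<longleftrightarrow>
     subgroup L (aut_group A) \<and> closedin (zariski A) L \<and> connectedin (zariski A) L \<and>
     is_unipotent_radical A L {\<one>\<^bsub>aut_group A\<^esub>}"

definition levi_decomposition ::
    "('k::field, 'a) module \<Rightarrow> ('a \<Rightarrow> 'a) set \<Rightarrow> ('a \<Rightarrow> 'a) set \<Rightarrow> ('a \<Rightarrow> 'a) set \<Rightarrow> bool" where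
  "levi_decomposition A H L R \<longleftrightarrow>
     is_unipotent_radical A H R \<and> reductive A L \<and>
     L \<inter> R = {\<one>\<^bsub>aut_group A\<^esub>} \<and> L <#>\<^bsub>aut_group A\<^esub> R = H"


section \<open>Derivations and quotients of algebras\<close>

definition derivation :: "('k::field, 'a) module \<Rightarrow> ('a \<Rightarrow> 'a) \<Rightarrow> bool" where
  "derivation A D \<longleftrightarrow>
     D \<in> carrier A \<rightarrow> carrier A \<and>
     (\<forall>x \<in> carrier A. \<forall>y \<in> carrier A. D (x \<oplus>\<^bsub>A\<^esub> y) = D x \<oplus>\<^bsub>A\<^esub> D y) \<and>
     (\<forall>c. \<forall>x \<in> carrier A. D (c \<odot>\<^bsub>A\<^esub> x) = c \<odot>\<^bsub>A\<^esub> D x) \<and>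
     (\<forall>x \<in> carrier A. \<forall>y \<in> carrier A.
        D (x \<otimes>\<^bsub>A\<^esub> y) = (D x \<otimes>\<^bsub>A\<^esub> y) \<oplus>\<^bsub>A\<^esub> (x \<otimes>\<^bsub>A\<^esub> D y))"

definition nilpotent_on :: "('k::field, 'a) module \<Rightarrow> ('a \<Rightarrow> 'a) \<Rightarrow> bool" where
  "nilpotent_on A D \<longleftrightarrow> (\<exists>N. \<forall>x \<in> carrier A. (D ^^ N) x = \<zero>\<^bsub>A\<^esub>)"

definition quotient_algebra :: "('k::field, 'a) module \<Rightarrow> 'a set \<Rightarrow> ('k, 'a set) module" where
  "quotient_algebra B I =
     ring.extend (B Quot I) (module.fields (\<lambda>c Q. \<Union>f\<in>Q. I +>\<^bsub>B\<^esub> (c \<odot>\<^bsub>B\<^esub> f)))"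


section \<open>Monomial ideals in polynomial rings\<close>

text \<open>
  Exponent vectors are of type \<open>'n \<Rightarrow>\<^sub>0 nat\<close> with \<open>'n\<close> finite; multiplication on
  \<open>('n \<Rightarrow>\<^sub>0 nat) \<Rightarrow>\<^sub>0 'k\<close> is convolution, so this type is the semigroup algebra of the first octant.
\<close>

type_synonym ('n, 'k) mpoly = "('n \<Rightarrow>\<^sub>0 nat) \<Rightarrow>\<^sub>0 'k"

definition polynomial_algebra :: "('k::field, ('n::finite, 'k) mpoly) module" where
  "polynomial_algebra =
     \<lparr>carrier = UNIV, monoid.mult = (*), one = 1, ring.zero = 0, add = (+),
      smult = (\<lambda>c f. Poly_Mapping.single 0 c * f)\<rparr>"

definition monomial :: "('n::finite \<Rightarrow>\<^sub>0 nat) \<Rightarrow> ('n, 'k::field) mpoly" where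
  "monomial m = Poly_Mapping.single m 1"

definition monomial_ideal :: "('n::finite, 'k::field) mpoly set \<Rightarrow> bool" where
  "monomial_ideal I \<longleftrightarrow> (\<exists>M. finite M \<and> I = Idl\<^bsub>polynomial_algebra\<^esub> (monomial ` M))"

definition supp :: "('n::finite, 'k::field) mpoly set \<Rightarrow> ('n \<Rightarrow>\<^sub>0 nat) set" where
  "supp I = {m. monomial m \<in> I}"

definition cofinite_support :: "('n::finite, 'k::field) mpoly set \<Rightarrow> bool" where
  "cofinite_support I \<longleftrightarrow> finite (UNIV - supp I)"

definition full :: "('n::finite, 'k::field) mpoly set \<Rightarrow> bool" where
  "full I \<longleftrightarrow> (\<forall>i. Poly_Mapping.single i 1 \<notin> supp I)"

definition factor_algebra ::
    "('n::finite, 'k::field) mpoly set \<Rightarrow> ('k, ('n, 'k) mpoly set) module" where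
  "factor_algebra I = quotient_algebra polynomial_algebra I"

definition residue_class ::
    "('n::finite, 'k::field) mpoly set \<Rightarrow> ('n, 'k) mpoly \<Rightarrow> ('n, 'k) mpoly set" where
  "residue_class I f = I +>\<^bsub>polynomial_algebra\<^esub> f"

text \<open>The homogeneous component is zero for degrees outside the first octant.\<close>

definition graded_piece ::
    "('n::finite, 'k::field) mpoly set \<Rightarrow> ('n \<Rightarrow>\<^sub>0 int) \<Rightarrow> ('n, 'k) mpoly set set" where
  "graded_piece I \<beta> = {\<zero>\<^bsub>factor_algebra I\<^esub>} \<union>
     {c \<odot>\<^bsub>factor_algebra I\<^esub> residue_class I (monomial m) | c m. Poly_Mapping.map int m = \<beta>}"

definition homogeneous ::
    "('n::finite, 'k::field) mpoly set \<Rightarrow> ('n \<Rightarrow>\<^sub>0 int) \<Rightarrow>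
     (('n, 'k) mpoly set \<Rightarrow> ('n, 'k) mpoly set) \<Rightarrow> bool" where
  "homogeneous I \<alpha> D \<longleftrightarrow> (\<forall>\<beta>. D ` graded_piece I \<beta> \<subseteq> graded_piece I (\<beta> + \<alpha>))"

definition liftable ::
    "('n::finite, 'k::field) mpoly set \<Rightarrow>
     (('n, 'k) mpoly set \<Rightarrow> ('n, 'k) mpoly set) \<Rightarrow> bool" where
  "liftable I D \<longleftrightarrow>
     (\<exists>E. derivation polynomial_algebra E \<and> E ` I \<subseteq> I \<and>
          (\<forall>f. D (residue_class I f) = residue_class I (E f)))"

definition roots :: "('n::finite, 'k::field) mpoly set \<Rightarrow> ('n \<Rightarrow>\<^sub>0 int) set" where
  "roots I = {\<alpha>. \<exists>D. derivation (factor_algebra I) D \<and>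
      (\<exists>x \<in> carrier (factor_algebra I). D x \<noteq> \<zero>\<^bsub>factor_algebra I\<^esub>) \<and>
      nilpotent_on (factor_algebra I) D \<and> homogeneous I \<alpha> D \<and> liftable I D}"

definition torus ::
    "('n::finite, 'k::field) mpoly set \<Rightarrow> (('n, 'k) mpoly set \<Rightarrow> ('n, 'k) mpoly set) set" where
  "torus I = {g \<in> alg_auts (factor_algebra I).
     \<exists>t :: ('n \<Rightarrow>\<^sub>0 int) \<Rightarrow> 'k. (\<forall>a. t a \<noteq> 0) \<and> (\<forall>a b. t (a + b) = t a * t b) \<and>
       (\<forall>m. g (residue_class I (monomial m)) =
            t (Poly_Mapping.map int m) \<odot>\<^bsub>factor_algebra I\<^esub> residue_class I (monomial m))}"

definition is_reductive_part ::
    "('n::finite, 'k::field) mpoly set \<Rightarrow>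
     (('n, 'k) mpoly set \<Rightarrow> ('n, 'k) mpoly set) set \<Rightarrow> bool" where
  "is_reductive_part I L \<longleftrightarrow> torus I \<subseteq> L \<and>
     (\<exists>R. levi_decomposition (factor_algebra I) (identity_component (factor_algebra I)) L R)"

end

theory Submission
  imports Defs "HOL-Computational_Algebra.Polynomial"
begin

text \<open>
  Identify an automorphism with its matrix in the basis of monomials outside \<open>I\<close>.

  For \<open>i \<noteq> j\<close>, the difference \<open>e\<^sub>i - e\<^sub>j\<close> is a root iff replacing one factor \<open>x\<^sub>j\<close> by \<open>x\<^sub>i\<close> preserves \<open>I\<close>. This is
  a preorder on the variables. If there are no opposite roots, it is a partial order; refine it to a
  total order and give the variables positive weights, increasing along this order and
  so close together that monomials of higher degree are heavier than all variables. Conjugating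
  \<open>x\<^sub>i \<partial>/\<partial>x\<^sub>i\<close> by an automorphism \<open>g\<close> yields a derivation, and the components of a derivation are again
  constrained by the roots; hence \<open>g\<close> maps the flag of the total order in the cotangent space to one of
  the finitely many coordinate flags. So the automorphisms that are triangular for the
  weights form a closed subgroup of finite index. It is the product of the torus and of the unitriangular
  automorphisms, which are contracted to the identity by a one-parameter subgroup of the torus.
  Therefore it is connected, and it is the identity component; it is solvable, with
  the unitriangular part as its unipotent radical.

  If \<open>e\<^sub>i - e\<^sub>j\<close> and \<open>e\<^sub>j - e\<^sub>i\<close> are both roots, then the substitutions \<open>x\<^sub>j \<mapsto> x\<^sub>j + s x\<^sub>i\<close> and \<open>x\<^sub>i \<mapsto> x\<^sub>i + s x\<^sub>j\<close>
  generate a perfect subgroup isomorphic to SL(2) in the identity component. It obstructs solvability, and a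
  unipotent normal complement of the torus would contain it, although it is not unipotent.
\<close>

section \<open>Linear extension of maps on monomials\<close>

text \<open>The identity component has to be pinned down from both sides, over a field that need not
  be algebraically closed. Lower bound: an infinite set of parameters on the affine line is
  irreducible, because a nonzero polynomial has only finitely many roots, so polynomial curves
  through the identity stay in the component. Upper bound: an invariant with finitely many values
  that separates the cosets of a closed subgroup.

  The invariant works because \<open>x_i d/dx_i\<close> has rank one on the cotangent space. Hence
  the \<open>(l, j)\<close> entry of its conjugate by \<open>g\<close> is the single product of the
  entry \<open>(l, i)\<close> of \<open>g^-1\<close> and the entry \<open>(i, j)\<close> of
  \<open>g\<close>, so no cancellation can hide a nonzero factor. If it is nonzero and
  \<open>l \<noteq> j\<close>, then \<open>e_l - e_j\<close> is a root. The zero pattern of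
  \<open>g^-1\<close> thus bounds that of \<open>g\<close>, and automorphisms with equal patterns
  differ by a triangular one.

  Characteristic zero also supplies nonzero integer factors: the exponents brought down by a
  derivation, and the differences between 1 and the factors 4 and 1/4 by which conjugation with
  \<open>diag(2, 1/2)\<close> scales shears.\<close>

abbreviation lookup :: "('a \<Rightarrow>\<^sub>0 'b::zero) \<Rightarrow> 'a \<Rightarrow> 'b" where
  "lookup \<equiv> Poly_Mapping.lookup"

abbreviation keys :: "('a \<Rightarrow>\<^sub>0 'b::zero) \<Rightarrow> 'a set" where
  "keys \<equiv> Poly_Mapping.keys"

abbreviation scalar :: "'k::field \<Rightarrow> ('n::finite, 'k) mpoly" where
  "scalar c \<equiv> Poly_Mapping.single 0 c"

abbreviation unit_exp :: "'n \<Rightarrow> ('n::finite \<Rightarrow>\<^sub>0 nat)" where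
  "unit_exp i \<equiv> Poly_Mapping.single i 1"

lemma lookup_scalar_mult [simp]:
  fixes f :: "('n::finite, 'k::field) mpoly"
  shows "lookup (scalar c * f) m = c * lookup f m"
proof -
  have "scalar c * f = Poly_Mapping.map ((*) c) f"
    by (simp add: mult_map_scale_conv_mult)
  then show ?thesis
    by (simp add: Poly_Mapping.map.rep_eq when_def)
qed

lemma scalar_mult: "scalar (a * b) = (scalar a * scalar b :: ('n::finite, 'k::field) mpoly)"
  by (simp add: mult_single)

lemma lookup_monomial: "lookup (monomial m :: ('n::finite, 'k::field) mpoly) p = (if p = m then 1 else 0)"
  by (auto simp: monomial_def lookup_single when_def)

lemma keys_monomial [simp]: "keys (monomial m :: ('n::finite, 'k::field) mpoly) = {m}"
  by (simp add: monomial_def)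

lemma monomial_add: "monomial (a + b) = (monomial a * monomial b :: ('n::finite, 'k::field) mpoly)"
  by (simp add: monomial_def mult_single)

lemma monomial_zero [simp]: "(monomial 0 :: ('n::finite, 'k::field) mpoly) = 1"
  by (simp add: monomial_def)

lemma mpoly_sum_monomials:
  fixes f :: "('n::finite, 'k::field) mpoly"
  assumes "finite S" "keys f \<subseteq> S"
  shows "f = (\<Sum>m\<in>S. scalar (lookup f m) * monomial m)"
proof (rule poly_mapping_eqI)
  fix k
  show "lookup f k = lookup (\<Sum>m\<in>S. scalar (lookup f m) * monomial m) k"
  proof (cases "k \<in> S")
    case True
    then show ?thesis
      using assms(1) by (simp add: lookup_sum lookup_monomial sum.delta if_distrib cong: if_cong)
  next
    case False
    then show ?thesis
      using assms by (subst lookup_sum, subst sum.neutral) (auto simp: lookup_monomial in_keys_iff)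
  qed
qed

lemma mpoly_induct [case_names monomial scale add]:
  fixes f :: "('n::finite, 'k::field) mpoly"
  assumes mono: "\<And>m. P (monomial m)"
    and scale: "\<And>c f. P f \<Longrightarrow> P (scalar c * f)"
    and add: "\<And>f g. P f \<Longrightarrow> P g \<Longrightarrow> P (f + g)"
  shows "P f"
proof -
  have "P 0"
    using scale[OF mono, of 0 0] by simp
  have *: "P (\<Sum>m\<in>S. scalar (lookup f m) * monomial m)" if "finite S" for S
    using that by (induction S) (simp_all add: mono scale add \<open>P 0\<close>)
  from mpoly_sum_monomials[OF finite_keys order_refl] show ?thesis
    by (rule ssubst[where P=P]) (rule *[OF finite_keys])
qed

text \<open>Torus elements, shears and derivations are all built as such extensions, which reduces
  multiplicativity and the Leibniz rule to identities between monomials.\<close>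

definition lin_ext :: "(('n::finite \<Rightarrow>\<^sub>0 nat) \<Rightarrow> ('n, 'k::field) mpoly) \<Rightarrow> ('n, 'k) mpoly \<Rightarrow> ('n, 'k) mpoly" where
  "lin_ext \<phi> f = (\<Sum>m\<in>keys f. scalar (lookup f m) * \<phi> m)"

lemma lin_ext_superset:
  assumes "finite S" "keys f \<subseteq> S"
  shows "lin_ext \<phi> f = (\<Sum>m\<in>S. scalar (lookup f m) * \<phi> m)"
  unfolding lin_ext_def
  by (rule sum.mono_neutral_left) (use assms in \<open>auto simp: in_keys_iff\<close>)

lemma lin_ext_monomial [simp]: "lin_ext \<phi> (monomial m) = \<phi> m"
  by (simp add: lin_ext_def lookup_monomial)

lemma lin_ext_add: "lin_ext \<phi> (f + g) = lin_ext \<phi> f + lin_ext \<phi> g"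
proof -
  define S where "S = keys f \<union> keys g"
  have S: "finite S" "keys f \<subseteq> S" "keys g \<subseteq> S" "keys (f + g) \<subseteq> S"
    using keys_add[of f g] by (auto simp: S_def)
  show ?thesis
    unfolding lin_ext_superset[OF S(1,2)] lin_ext_superset[OF S(1,3)] lin_ext_superset[OF S(1,4)]
    by (simp only: lookup_add single_add distrib_right sum.distrib)
qed

lemma lin_ext_scale: "lin_ext \<phi> (scalar c * f) = scalar c * lin_ext \<phi> f"
proof -
  have "keys (scalar c * f) \<subseteq> keys f"
    by (auto simp: in_keys_iff)
  from lin_ext_superset[OF finite_keys this] show ?thesis
    by (simp only: lin_ext_def sum_distrib_left lookup_scalar_mult scalar_mult mult.assoc)
qed

lemma lin_ext_mult:
  assumes "\<And>a b. \<phi> (a + b) = \<phi> a * \<phi> b"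
  shows "lin_ext \<phi> (f * g) = lin_ext \<phi> f * lin_ext \<phi> g"
proof (induction f rule: mpoly_induct)
  case (monomial m)
  show ?case
  proof (induction g rule: mpoly_induct)
    case (monomial p)
    then show ?case
      by (simp add: assms flip: monomial_add)
  next
    case (scale c g)
    have "monomial m * (scalar c * g) = scalar c * (monomial m * g)"
      by (rule mult.left_commute)
    then show ?case
      by (simp only: lin_ext_scale scale) (rule mult.left_commute)
  qed (simp add: lin_ext_add distrib_left distrib_right)
next
  case (scale c f)
  then show ?case
    by (simp only: lin_ext_scale mult.assoc)
qed (simp add: lin_ext_add distrib_left distrib_right)

lemma lin_ext_Leibniz:
  assumes "\<And>a b. \<phi> (a + b) = \<phi> a * monomial b + monomial a * \<phi> b"
  shows "lin_ext \<phi> (f * g) = lin_ext \<phi> f * g + f * lin_ext \<phi> g"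
proof (induction f rule: mpoly_induct)
  case (monomial m)
  show ?case
  proof (induction g rule: mpoly_induct)
    case (monomial p)
    then show ?case
      by (simp add: assms flip: monomial_add)
  next
    case (scale c g)
    have "monomial m * (scalar c * g) = scalar c * (monomial m * g)"
      by (rule mult.left_commute)
    then have "lin_ext \<phi> (monomial m * (scalar c * g)) = scalar c * lin_ext \<phi> (monomial m * g)"
      by (simp only: lin_ext_scale)
    also have "\<dots> = scalar c * (\<phi> m * g + monomial m * lin_ext \<phi> g)"
      by (simp only: scale lin_ext_monomial)
    finally show ?case
      by (simp only: lin_ext_scale[of \<phi> c g] lin_ext_monomial distrib_left)
        (simp only: ac_simps)
  qed (simp add: lin_ext_add distrib_left distrib_right)
next
  case (scale c f)
  have "lin_ext \<phi> (scalar c * f * g) = scalar c * lin_ext \<phi> (f * g)"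
    by (simp only: lin_ext_scale mult.assoc)
  then show ?case
    by (simp only: scale lin_ext_scale distrib_left) (simp only: ac_simps)
qed (simp add: lin_ext_add distrib_left distrib_right)

lemma lin_ext_compose:
  assumes "\<And>m. lin_ext \<phi> (\<psi> m) = \<theta> m"
  shows "lin_ext \<phi> (lin_ext \<psi> f) = lin_ext \<theta> f"
  by (induction f rule: mpoly_induct) (simp_all add: assms lin_ext_scale lin_ext_add)

lemma lin_ext_eq_self:
  assumes "\<And>m. \<phi> m = monomial m"
  shows "lin_ext \<phi> f = f"
  by (induction f rule: mpoly_induct) (simp_all add: assms lin_ext_scale lin_ext_add)

lemma exponent_induct [case_names zero add]:
  fixes m :: "'n::finite \<Rightarrow>\<^sub>0 nat"
  assumes "P 0" "\<And>m i. P m \<Longrightarrow> P (m + unit_exp i)"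
  shows "P m"
proof (induction "\<Sum>i\<in>UNIV. lookup m i" arbitrary: m)
  case 0
  then have "m = 0"
    by (intro poly_mapping_eqI) simp
  then show ?case
    using assms(1) by simp
next
  case (Suc n)
  then obtain i where i: "lookup m i > 0"
    by (metis (no_types, lifting) finite_UNIV gr0I old.nat.distinct(2) sum.neutral)
  define p where "p = m - unit_exp i"
  have m: "m = p + unit_exp i"
    using i by (intro poly_mapping_eqI) (auto simp: p_def lookup_add lookup_minus lookup_single when_def)
  have "(\<Sum>a\<in>UNIV. lookup m a) = (\<Sum>a\<in>UNIV. lookup p a) + (\<Sum>a\<in>UNIV. lookup (unit_exp i) a)"
    by (simp add: m lookup_add sum.distrib)
  moreover have "(\<Sum>a\<in>UNIV. lookup (unit_exp i) a) = (1::nat)"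
    by (simp add: lookup_single when_def)
  ultimately have "n = (\<Sum>a\<in>UNIV. lookup p a)"
    using Suc(2) by simp
  then show ?case
    unfolding m using Suc(1) assms(2) by blast
qed

section \<open>Exponent vectors and weights\<close>

lemma exponent_add_eq_0_iff: "a + b = 0 \<longleftrightarrow> a = 0 \<and> b = (0 :: 'n::finite \<Rightarrow>\<^sub>0 nat)"
proof
  assume "a + b = 0"
  then have "lookup a i + lookup b i = 0" for i
    by (metis lookup_add lookup_zero)
  then show "a = 0 \<and> b = 0"
    by (auto intro!: poly_mapping_eqI)
qed simp

text \<open>The cases are degree 0, degree 1 and degree at least 2: constants, a basis of the
  cotangent space, and the monomials in the square of the maximal ideal.\<close>

lemma exponent_cases [case_names zero unit decomposable]:
  fixes m :: "'n::finite \<Rightarrow>\<^sub>0 nat"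
  assumes "m = 0 \<Longrightarrow> P" "\<And>i. m = unit_exp i \<Longrightarrow> P"
    "\<And>a b. m = a + b \<Longrightarrow> a \<noteq> 0 \<Longrightarrow> b \<noteq> 0 \<Longrightarrow> P"
  shows P
proof (cases "m = 0")
  case False
  then obtain a i where m: "m = a + unit_exp i"
    by (induction m rule: exponent_induct) auto
  show ?thesis
  proof (cases "a = 0")
    case True
    then show ?thesis
      using m assms(2)[of i] by simp
  next
    case False
    have "unit_exp i \<noteq> (0 :: 'n \<Rightarrow>\<^sub>0 nat)"
      by (metis lookup_single_eq lookup_zero one_neq_zero)
    then show ?thesis
      using assms(3)[OF m] False by blast
  qed
qed (rule assms(1))

lemma lookup_mult_0:
  fixes f h :: "('n::finite, 'k::field) mpoly"
  shows "lookup (f * h) 0 = lookup f 0 * lookup h 0"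
proof (induction f rule: mpoly_induct)
  case (monomial m)
  show ?case
  proof (induction h rule: mpoly_induct)
    case (monomial p)
    then show ?case
      using exponent_add_eq_0_iff[of m p] by (auto simp: lookup_monomial simp flip: monomial_add)
  next
    case (scale c h)
    have "monomial m * (scalar c * h) = scalar c * (monomial m * h)"
      by (rule mult.left_commute)
    with scale show ?case
      by (simp only: lookup_scalar_mult) simp
  qed (simp add: lookup_add distrib_left)
next
  case (scale c f)
  then show ?case
    by (simp only: mult.assoc lookup_scalar_mult)
qed (simp add: lookup_add distrib_right)

definition wt :: "('n::finite \<Rightarrow> nat) \<Rightarrow> ('n \<Rightarrow>\<^sub>0 nat) \<Rightarrow> nat" where
  "wt w m = (\<Sum>i\<in>UNIV. w i * lookup m i)"

lemma wt_add [simp]: "wt w (a + b) = wt w a + wt w b"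
  by (simp add: wt_def lookup_add distrib_left sum.distrib)

lemma wt_zero [simp]: "wt w 0 = 0"
  by (simp add: wt_def)

lemma wt_unit_exp [simp]: "wt w (unit_exp i) = w i"
  by (simp add: wt_def lookup_single when_def if_distrib cong: if_cong)

text \<open>The character \<open>m\<close> of the torus at the point \<open>a\<close>.\<close>

definition mon_val :: "('n::finite \<Rightarrow> 'k::field) \<Rightarrow> ('n \<Rightarrow>\<^sub>0 nat) \<Rightarrow> 'k" where
  "mon_val a m = (\<Prod>i\<in>UNIV. a i ^ lookup m i)"

lemma mon_val_add [simp]: "mon_val a (p + q) = mon_val a p * mon_val a q"
  by (simp add: mon_val_def lookup_add power_add prod.distrib)

lemma mon_val_zero [simp]: "mon_val a 0 = 1"
  by (simp add: mon_val_def)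

lemma mon_val_unit_exp [simp]: "mon_val a (unit_exp i) = a i"
  by (simp add: mon_val_def lookup_single when_def if_distrib[of "power _"] cong: if_cong)

lemma mon_val_mult: "mon_val (\<lambda>i. a i * b i) m = mon_val a m * mon_val b m"
  by (simp add: mon_val_def power_mult_distrib prod.distrib)

lemma mon_val_one [simp]: "mon_val (\<lambda>i. 1) m = 1"
  by (simp add: mon_val_def)

text \<open>This is how the one-parameter subgroup with weights \<open>w\<close> acts on
  \<open>x^m\<close>.\<close>

lemma mon_val_power: "mon_val (\<lambda>i. s ^ w i) m = s ^ wt w m"
  by (simp add: mon_val_def wt_def power_mult power_sum)

section \<open>Normality and solvability relative to a subgroup\<close>

lemma (in group) normal_in_subgroup_iff:
  assumes H: "subgroup H G"
  shows "N \<lhd> (G\<lparr>carrier := H\<rparr>) \<longleftrightarrow>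
    subgroup N G \<and> N \<subseteq> H \<and> (\<forall>x\<in>H. \<forall>n\<in>N. x \<otimes> n \<otimes> inv x \<in> N)"
proof -
  interpret K: group "G\<lparr>carrier := H\<rparr>"
    by (rule subgroup.subgroup_is_group[OF H is_group])
  have "subgroup N (G\<lparr>carrier := H\<rparr>) \<longleftrightarrow> subgroup N G \<and> N \<subseteq> H"
    using incl_subgroup[OF H] subgroup_incl[OF _ H] subgroup.subset[of N "G\<lparr>carrier := H\<rparr>"] by auto
  then show ?thesis
    unfolding K.normal_inv_iff using m_inv_consistent[OF H] by auto
qed

text \<open>Derived subgroups computed in the subgroup and in \<open>G\<close> agree, so the whole
  derived series can be followed inside \<open>G\<close>.\<close>

lemma (in group) solvable_subgroup_iff:
  assumes H: "subgroup H G"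
  shows "solvable (G\<lparr>carrier := H\<rparr>) \<longleftrightarrow> (\<exists>n. (derived G ^^ n) H = {\<one>})"
proof -
  interpret K: group "G\<lparr>carrier := H\<rparr>"
    by (rule subgroup.subgroup_is_group[OF H is_group])
  have sub: "(derived G ^^ n) H \<subseteq> H" for n
  proof (induction n)
    case (Suc n)
    then show ?case
      using derived_incl[OF _ H] by simp
  qed simp
  have "(derived (G\<lparr>carrier := H\<rparr>) ^^ n) H = (derived G ^^ n) H" for n
    by (induction n) (simp_all add: derived_consistent[OF sub H])
  then show ?thesis
    by (simp add: K.solvable_iff_trivial_derived_seq)
qed

section \<open>The coordinate ring modulo a monomial ideal\<close>

lemma polynomial_algebra_cring: "cring (polynomial_algebra :: ('k::field, ('n::finite, 'k) mpoly) module)"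
proof (rule cringI)
  show "abelian_group (polynomial_algebra :: ('k::field, ('n::finite, 'k) mpoly) module)"
    by (rule abelian_groupI) (auto simp: polynomial_algebra_def algebra_simps
        intro: exI[of _ "- x" for x])
  show "Group.comm_monoid (polynomial_algebra :: ('k::field, ('n::finite, 'k) mpoly) module)"
    by unfold_locales (auto simp: polynomial_algebra_def algebra_simps)
qed (auto simp: polynomial_algebra_def algebra_simps)

lemma polynomial_algebra_simps [simp]:
  "carrier polynomial_algebra = UNIV"
  "x \<oplus>\<^bsub>polynomial_algebra\<^esub> y = x + y"
  "x \<otimes>\<^bsub>polynomial_algebra\<^esub> y = x * y"
  "\<one>\<^bsub>polynomial_algebra\<^esub> = 1"
  "\<zero>\<^bsub>polynomial_algebra\<^esub> = 0"
  "c \<odot>\<^bsub>polynomial_algebra\<^esub> x = scalar c * x"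
  by (simp_all add: polynomial_algebra_def)

lemma ideal_polynomial_algebraI:
  fixes J :: "('n::finite, 'k::field) mpoly set"
  assumes "0 \<in> J" "\<And>x y. x \<in> J \<Longrightarrow> y \<in> J \<Longrightarrow> x + y \<in> J" "\<And>x y. x \<in> J \<Longrightarrow> y * x \<in> J"
  shows "ideal J polynomial_algebra"
proof -
  interpret cring "polynomial_algebra :: ('k, ('n, 'k) mpoly) module"
    by (rule polynomial_algebra_cring)
  have inv: "inv\<^bsub>add_monoid (polynomial_algebra :: ('k, ('n, 'k) mpoly) module)\<^esub> x = - x" for x
  proof -
    have "\<ominus>\<^bsub>polynomial_algebra\<^esub> x = - x"
      using minus_equality[of "-x" x] by simp
    then show ?thesis
      by (simp add: a_inv_def)
  qed
  have neg: "- x \<in> J" if "x \<in> J" for x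
    using assms(3)[OF that, of "-1"] by simp
  show ?thesis
  proof (rule idealI)
    show "ring (polynomial_algebra :: ('k, ('n, 'k) mpoly) module)"
      by (rule ring_axioms)
    show "subgroup J (add_monoid (polynomial_algebra :: ('k, ('n, 'k) mpoly) module))"
      by (rule subgroup.intro) (simp_all only: inv neg, simp_all add: assms(1,2))
  next
    fix a x :: "('n, 'k) mpoly"
    assume "a \<in> J"
    then show "x \<otimes>\<^bsub>polynomial_algebra\<^esub> a \<in> J" "a \<otimes>\<^bsub>polynomial_algebra\<^esub> x \<in> J"
      using assms(3)[of a x] by (simp_all add: mult.commute)
  qed
qed

text \<open>\<open>J\<close>, the polynomials all of whose monomials are multiples of generators, is
  an ideal and so bounds \<open>I\<close> from above. Membership in \<open>I\<close> thereby becomes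
  a condition on each monomial separately.\<close>

lemma monomial_ideal_eq:
  fixes I :: "('n::finite, 'k::field) mpoly set"
  assumes "monomial_ideal I"
  shows "I = {f. keys f \<subseteq> supp I}" "m \<in> supp I \<Longrightarrow> m + p \<in> supp I"
proof -
  interpret cring "polynomial_algebra :: ('k, ('n, 'k) mpoly) module"
    by (rule polynomial_algebra_cring)
  obtain G where I: "I = Idl\<^bsub>polynomial_algebra\<^esub> (monomial ` G)"
    using assms by (auto simp: monomial_ideal_def)
  define J :: "('n, 'k) mpoly set" where "J = {f. \<forall>m\<in>keys f. \<exists>g\<in>G. \<exists>p. m = g + p}"
  interpret I: ideal I polynomial_algebra
    unfolding I by (rule genideal_ideal) simp
  have "ideal J polynomial_algebra"
  proof (rule ideal_polynomial_algebraI)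
    show "0 \<in> J"
      by (simp add: J_def)
  next
    fix x y assume "x \<in> J" "y \<in> J"
    then show "x + y \<in> J"
      using keys_add[of x y] by (auto simp: J_def)
  next
    fix x y assume x: "x \<in> J"
    show "y * x \<in> J"
      unfolding J_def
    proof safe
      fix m assume "m \<in> keys (y * x)"
      then obtain a b where "m = a + b" "b \<in> keys x"
        using keys_mult[of y x] by auto
      with x obtain g p where "g \<in> G" "b = g + p"
        by (auto simp: J_def)
      with \<open>m = a + b\<close> have "g \<in> G" "m = g + (a + p)"
        by (simp_all add: add.left_commute)
      then show "\<exists>g\<in>G. \<exists>p. m = g + p"
        by blast
    qed
  qed
  moreover have "monomial ` G \<subseteq> J"
    by (auto simp: J_def) (metis add.right_neutral)
  ultimately have IJ: "I \<subseteq> J"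
    unfolding I by (rule genideal_minimal)
  have add: "x + y \<in> I" if "x \<in> I" "y \<in> I" for x y
    using I.a_closed[OF that] by simp
  have mult: "y * x \<in> I" if "x \<in> I" for x y
    using I.I_l_closed[OF that, of y] by simp
  have zero: "0 \<in> I"
    using I.zero_closed by simp
  have G: "monomial g \<in> I" if "g \<in> G" for g
    using genideal_self[of "monomial ` G"] that by (auto simp: I)
  have up: "m + p \<in> supp I" if "m \<in> supp I" for m p
    using mult[of "monomial m" "monomial p"] that by (simp add: supp_def monomial_add mult.commute)
  then show "m \<in> supp I \<Longrightarrow> m + p \<in> supp I" .
  have "keys f \<subseteq> supp I" if "f \<in> I" for f
    using that IJ G up by (fastforce simp: J_def supp_def)
  moreover have "f \<in> I" if "keys f \<subseteq> supp I" for f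
  proof -
    have "(\<Sum>m\<in>S. scalar (lookup f m) * monomial m) \<in> I" if "finite S" "S \<subseteq> supp I" for S
      using that by (induction S) (auto simp: zero supp_def intro!: add mult)
    from this[of "keys f"] that show ?thesis
      using mpoly_sum_monomials[of "keys f" f] by simp
  qed
  ultimately show "I = {f. keys f \<subseteq> supp I}"
    by blast
qed

text \<open>Otherwise \<open>simp\<close> rewrites \<open>unit_exp i\<close> to a form with \<open>Suc 0\<close>.\<close>

declare One_nat_def [simp del]

locale full_cofinite_ideal =
  fixes I :: "('n::finite, 'k::field_char_0) mpoly set"
  assumes monomial_ideal: "monomial_ideal I"
    and full: "full I"
    and cofinite: "cofinite_support I"
begin

abbreviation A :: "('k, ('n, 'k) mpoly set) module" where
  "A \<equiv> factor_algebra I"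

abbreviation res :: "('n, 'k) mpoly \<Rightarrow> ('n, 'k) mpoly set" where
  "res \<equiv> residue_class I"

definition M :: "('n \<Rightarrow>\<^sub>0 nat) set" where
  "M = UNIV - supp I"

abbreviation gen :: "'n \<Rightarrow> ('n, 'k) mpoly set" where
  "gen i \<equiv> res (monomial (unit_exp i))"

lemma supp_add: "m \<in> supp I \<Longrightarrow> m + p \<in> supp I"
  using monomial_ideal by (rule monomial_ideal_eq(2))

lemma mem_I_iff: "f \<in> I \<longleftrightarrow> (\<forall>m\<in>M. lookup f m = 0)"
  by (subst monomial_ideal_eq(1)[OF monomial_ideal]) (auto simp: M_def in_keys_iff)

lemma finite_M [simp]: "finite M"
  using cofinite by (simp add: M_def cofinite_support_def)

lemma unit_exp_in_M [simp]: "unit_exp i \<in> M"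
  using full by (simp add: M_def full_def)

lemma in_M_addD: "a + b \<in> M \<Longrightarrow> a \<in> M \<and> b \<in> M"
  using supp_add[of a b] supp_add[of b a] by (auto simp: M_def add.commute)

text \<open>\<open>I\<close> is proper because there is at least one variable:
  \<open>undefined\<close> names an element of the nonempty type \<open>'n\<close>, and a divisor of
  a monomial outside \<open>I\<close> is outside \<open>I\<close>.\<close>

lemma zero_in_M [simp]: "0 \<in> M"
  using in_M_addD[of 0 "unit_exp undefined"] unit_exp_in_M[of undefined] by simp

lemma ideal_I: "ideal I polynomial_algebra"
proof (rule ideal_polynomial_algebraI)
  fix x y assume x: "x \<in> I"
  have "lookup (y * x) m = 0" if "m \<in> M" for m
  proof (rule ccontr)
    assume "lookup (y * x) m \<noteq> 0"
    then obtain a b where "m = a + b" "b \<in> keys x"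
      using keys_mult[of y x] by (auto simp: in_keys_iff)
    then show False
      using that in_M_addD[of a b] x by (auto simp: mem_I_iff in_keys_iff)
  qed
  then show "y * x \<in> I"
    by (simp add: mem_I_iff)
qed (auto simp: mem_I_iff lookup_add)

interpretation I: ideal I polynomial_algebra
  by (rule ideal_I)

lemma mult_I: "x \<in> I \<Longrightarrow> y * x \<in> I"
  using I.I_l_closed[of x y] by simp

lemma residue_class_eq: "res h = (\<lambda>x. x + h) ` I"
  by (auto simp: residue_class_def a_r_coset_def')

lemma self_in_res: "f \<in> res f"
  by (force simp: residue_class_eq mem_I_iff)

lemma res_eq_iff: "res f = res g \<longleftrightarrow> (\<forall>m\<in>M. lookup f m = lookup g m)"
proof -
  have "res f = res g \<longleftrightarrow> f - g \<in> I"
  proof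
    assume "res f = res g"
    then show "f - g \<in> I"
      using self_in_res[of f] by (auto simp: residue_class_eq)
  next
    assume *: "f - g \<in> I"
    have "x + f \<in> res g" if "x \<in> I" for x
      using that * by (auto simp: residue_class_eq image_iff mem_I_iff lookup_add lookup_minus
          intro!: bexI[of _ "x + (f - g)"])
    moreover have "x + g \<in> res f" if "x \<in> I" for x
      using that * by (auto simp: residue_class_eq image_iff mem_I_iff lookup_add lookup_minus
          intro!: bexI[of _ "x - (f - g)"])
    ultimately show "res f = res g"
      by (auto simp: residue_class_eq[of f] residue_class_eq[of g])
  qed
  then show ?thesis
    by (simp add: mem_I_iff lookup_minus)
qed

lemmas factor_algebra_unfold = factor_algebra_def quotient_algebra_def ring.extend_def
  module.fields_def FactRing_def

lemma carrier_A: "carrier A = range res"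
  by (auto simp: factor_algebra_unfold A_RCOSETS_def' residue_class_def)

lemma res_in_carrier [simp, intro]: "res f \<in> carrier A"
  by (simp add: carrier_A)

lemma carrierE:
  assumes "x \<in> carrier A"
  obtains f where "x = res f"
  using assms by (auto simp: carrier_A)

lemma zero_A: "\<zero>\<^bsub>A\<^esub> = res 0"
  by (simp add: factor_algebra_unfold residue_class_eq)

lemma one_A: "\<one>\<^bsub>A\<^esub> = res 1"
  by (simp add: factor_algebra_unfold residue_class_def)

lemma add_A [simp]: "res f \<oplus>\<^bsub>A\<^esub> res g = res (f + g)"
  using I.a_rcos_sum[of f g]
  by (simp add: factor_algebra_unfold residue_class_def)

lemma mult_A [simp]: "res f \<otimes>\<^bsub>A\<^esub> res g = res (f * g)"
  using I.rcoset_mult_add[of f g]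
  by (simp add: factor_algebra_unfold residue_class_def)

lemma smult_A [simp]: "c \<odot>\<^bsub>A\<^esub> res f = res (scalar c * f)"
proof -
  have "c \<odot>\<^bsub>A\<^esub> res f = (\<Union>h\<in>res f. res (scalar c * h))"
    by (simp add: factor_algebra_unfold residue_class_def)
  also have "\<dots> = (\<Union>h\<in>res f. res (scalar c * f))"
    by (rule SUP_cong) (auto simp: res_eq_iff residue_class_eq[of f] mem_I_iff lookup_add)
  also have "\<dots> = res (scalar c * f)"
    using self_in_res[of f] by auto
  finally show ?thesis .
qed

lemma abelian_group_A: "abelian_group A"
proof (rule abelian_groupI)
  fix x assume "x \<in> carrier A"
  then obtain f where "x = res f"
    by (rule carrierE)
  then show "\<exists>y\<in>carrier A. y \<oplus>\<^bsub>A\<^esub> x = \<zero>\<^bsub>A\<^esub>"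
    by (intro bexI[of _ "res (- f)"]) (auto simp: zero_A)
qed ((elim carrierE)?, simp add: zero_A ac_simps)+

lemma minus_A [simp]: "res f \<ominus>\<^bsub>A\<^esub> res g = res (f - g)"
proof -
  interpret A: abelian_group A
    by (rule abelian_group_A)
  have "\<ominus>\<^bsub>A\<^esub> res g = res (- g)"
    by (rule A.minus_equality) (auto simp: zero_A)
  then show ?thesis
    by (simp add: a_minus_def)
qed

text \<open>The representative is arbitrary, so the value is meaningful only for \<open>m\<close> in
  \<open>M\<close>.\<close>

definition coord :: "('n \<Rightarrow>\<^sub>0 nat) \<Rightarrow> ('n, 'k) mpoly set \<Rightarrow> 'k" where
  "coord m x = lookup (SOME f. x = res f) m"

lemma coord_res [simp]:
  assumes "m \<in> M"
  shows "coord m (res f) = lookup f m"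
proof -
  define h where "h = (SOME h. res f = res h)"
  have "res f = res h"
    unfolding h_def by (rule someI[of _ f]) simp
  with assms have "lookup h m = lookup f m"
    by (simp add: res_eq_iff)
  then show ?thesis
    by (simp add: coord_def h_def)
qed

lemma coord_eqI:
  assumes "x \<in> carrier A" "y \<in> carrier A" "\<And>m. m \<in> M \<Longrightarrow> coord m x = coord m y"
  shows "x = y"
  using assms by (elim carrierE) (simp add: res_eq_iff)

lemma coord_linear: "m \<in> M \<Longrightarrow> coord m \<in> linear_functionals A"
  by (auto simp: linear_functionals_def carrier_A lookup_add)

lemma res_monomial_notin_M: "m \<notin> M \<Longrightarrow> res (monomial m) = res 0"
  by (auto simp: res_eq_iff lookup_monomial)

lemma linear_functional_expand:
  assumes "\<phi> \<in> linear_functionals A"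
  shows "\<phi> (res f) = (\<Sum>m\<in>M. lookup f m * \<phi> (res (monomial m)))"
proof -
  have add: "\<phi> (res (f + g)) = \<phi> (res f) + \<phi> (res g)" for f g
    using assms unfolding linear_functionals_def add_A[symmetric] by blast
  have scale: "\<phi> (res (scalar c * f)) = c * \<phi> (res f)" for c f
    using assms unfolding linear_functionals_def smult_A[symmetric] by blast
  show ?thesis
  proof (induction f rule: mpoly_induct)
    case (monomial m)
    show ?case
    proof (cases "m \<in> M")
      case False
      have "\<phi> (res (monomial m)) = 0"
        using scale[of 0 0] res_monomial_notin_M[OF False] by simp
      moreover have "(\<Sum>p\<in>M. lookup (monomial m) p * \<phi> (res (monomial p))) = 0"
        using False by (intro sum.neutral) (auto simp: lookup_monomial)
      ultimately show ?thesis
        by simp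
    next
      case True
      have "(\<Sum>p\<in>M. lookup (monomial m) p * \<phi> (res (monomial p)))
          = (\<Sum>p\<in>M. if p = m then \<phi> (res (monomial p)) else 0)"
        by (rule sum.cong) (auto simp: lookup_monomial)
      with True show ?thesis
        by simp
    qed
  next
    case (scale c f)
    then show ?case
      by (simp add: \<open>\<And>c f. \<phi> (res (scalar c * f)) = c * \<phi> (res f)\<close> sum_distrib_left mult.assoc)
  next
    case (add f g)
    then show ?case
      by (simp add: \<open>\<And>f g. \<phi> (res (f + g)) = \<phi> (res f) + \<phi> (res g)\<close> lookup_add distrib_right sum.distrib)
  qed
qed

subsection \<open>Induced endomorphisms\<close>

text \<open>The restriction to the carrier makes the map extensional, as members of
  \<open>Bij\<close> have to be.\<close>

definition induced :: "(('n, 'k) mpoly \<Rightarrow> ('n, 'k) mpoly) \<Rightarrow> ('n, 'k) mpoly set \<Rightarrow> ('n, 'k) mpoly set" where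
  "induced F = (\<lambda>x\<in>carrier A. res (F (SOME f. x = res f)))"

lemma induced_res:
  assumes "\<And>f g. f - g \<in> I \<Longrightarrow> F f - F g \<in> I"
  shows "induced F (res f) = res (F f)"
proof -
  define h where "h = (SOME h. res f = res h)"
  have "res f = res h"
    unfolding h_def by (rule someI[of _ f]) simp
  then have "h - f \<in> I"
    by (simp add: res_eq_iff mem_I_iff lookup_minus)
  from assms[OF this] have "res (F h) = res (F f)"
    by (simp add: res_eq_iff mem_I_iff lookup_minus)
  then show ?thesis
    by (simp add: induced_def h_def)
qed

lemma sum_in_I: "(\<And>x. x \<in> S \<Longrightarrow> F x \<in> I) \<Longrightarrow> sum F S \<in> I"
  by (induction S rule: infinite_finite_induct) (auto simp: mem_I_iff lookup_add)

lemma lin_ext_in_I: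
  assumes "\<And>m. m \<notin> M \<Longrightarrow> \<phi> m \<in> I" "h \<in> I"
  shows "lin_ext \<phi> h \<in> I"
proof -
  have "scalar (lookup h m) * \<phi> m \<in> I" if "m \<in> keys h" for m
    using \<open>h \<in> I\<close> that assms(1)[of m] by (intro mult_I) (auto simp: mem_I_iff in_keys_iff)
  then show ?thesis
    by (simp add: lin_ext_def sum_in_I)
qed

lemma induced_lin_ext:
  assumes "\<And>m. m \<notin> M \<Longrightarrow> \<phi> m \<in> I"
  shows "induced (lin_ext \<phi>) (res f) = res (lin_ext \<phi> f)"
proof (rule induced_res)
  fix f g assume "f - g \<in> I"
  then have "lin_ext \<phi> (f - g) \<in> I"
    using lin_ext_in_I assms by blast
  moreover have "lin_ext \<phi> f = lin_ext \<phi> (f - g) + lin_ext \<phi> g"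
    by (simp flip: lin_ext_add)
  ultimately show "lin_ext \<phi> f - lin_ext \<phi> g \<in> I"
    by simp
qed

lemma induced_in_alg_auts:
  assumes mult: "\<And>a b. \<phi> (a + b) = \<phi> a * \<phi> b" "\<phi> 0 = 1"
    and I: "\<And>m. m \<notin> M \<Longrightarrow> \<phi> m \<in> I" "\<And>m. m \<notin> M \<Longrightarrow> \<psi> m \<in> I"
    and inv: "\<And>m. lin_ext \<phi> (\<psi> m) = monomial m" "\<And>m. lin_ext \<psi> (\<phi> m) = monomial m"
  shows "induced (lin_ext \<phi>) \<in> alg_auts A"
proof -
  let ?F = "induced (lin_ext \<phi>)" and ?G = "induced (lin_ext \<psi>)"
  have F: "?F (res f) = res (lin_ext \<phi> f)" for f
    by (rule induced_lin_ext) (rule I(1))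
  have G: "?G (res f) = res (lin_ext \<psi> f)" for f
    by (rule induced_lin_ext) (rule I(2))
  have inverse: "lin_ext \<phi> (lin_ext \<psi> f) = f" "lin_ext \<psi> (lin_ext \<phi> f) = f" for f
    using lin_ext_compose[where \<phi>=\<phi> and \<psi>=\<psi> and \<theta>=monomial and f=f, OF inv(1)]
      lin_ext_compose[where \<phi>=\<psi> and \<psi>=\<phi> and \<theta>=monomial and f=f, OF inv(2)]
    by (simp_all add: lin_ext_eq_self)
  have FG: "?F (?G x) = x" "?G (?F x) = x" if "x \<in> carrier A" for x
    using that by (auto simp: carrier_A F G inverse)
  have "bij_betw ?F (carrier A) (carrier A)"
    by (rule bij_betw_byWitness[where f'="?G"]) (use FG in \<open>auto simp: carrier_A F G\<close>)
  moreover have "?F \<in> extensional (carrier A)"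
    by (simp add: induced_def)
  moreover have "?F \<in> ring_hom A A"
  proof (rule ring_hom_memI)
    have "lin_ext \<phi> 1 = 1"
      using lin_ext_monomial[of \<phi> 0] mult(2) by simp
    then show "?F \<one>\<^bsub>A\<^esub> = \<one>\<^bsub>A\<^esub>"
      by (simp add: one_A F)
  qed (auto simp: carrier_A F lin_ext_add lin_ext_mult[of \<phi>, OF mult(1)])
  ultimately show ?thesis
    by (auto simp: alg_auts_def Bij_def carrier_A F lin_ext_scale)
qed

section \<open>The automorphism group in matrix coordinates\<close>

abbreviation Aut :: "(('n, 'k) mpoly set \<Rightarrow> ('n, 'k) mpoly set) set" where
  "Aut \<equiv> alg_auts A"

abbreviation G :: "(('n, 'k) mpoly set \<Rightarrow> ('n, 'k) mpoly set) monoid" where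
  "G \<equiv> aut_group A"

lemma closed_A:
  assumes "x \<in> carrier A" "y \<in> carrier A"
  shows "x \<oplus>\<^bsub>A\<^esub> y \<in> carrier A" "x \<otimes>\<^bsub>A\<^esub> y \<in> carrier A" "c \<odot>\<^bsub>A\<^esub> x \<in> carrier A"
  using assms by (elim carrierE, simp)+

lemma aut_carrier: "g \<in> Aut \<Longrightarrow> x \<in> carrier A \<Longrightarrow> g x \<in> carrier A"
  by (auto simp: alg_auts_def ring_hom_def)

lemma aut_lift:
  assumes "g \<in> Aut"
  obtains h where "g (res f) = res h"
  using aut_carrier[OF assms, of "res f"] by (auto elim: carrierE)

lemma aut_add: "g \<in> Aut \<Longrightarrow> g (res (f + h)) = g (res f) \<oplus>\<^bsub>A\<^esub> g (res h)"
  using ring_hom_add[of g A A "res f" "res h"] by (simp add: alg_auts_def)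

lemma aut_mult: "g \<in> Aut \<Longrightarrow> g (res (f * h)) = g (res f) \<otimes>\<^bsub>A\<^esub> g (res h)"
  using ring_hom_mult[of g A A "res f" "res h"] by (simp add: alg_auts_def)

lemma aut_scale:
  assumes "g \<in> Aut"
  shows "g (res (scalar c * f)) = c \<odot>\<^bsub>A\<^esub> g (res f)"
proof -
  have "g (c \<odot>\<^bsub>A\<^esub> res f) = c \<odot>\<^bsub>A\<^esub> g (res f)"
    using assms unfolding alg_auts_def by blast
  then show ?thesis
    by simp
qed

lemma aut_one: "g \<in> Aut \<Longrightarrow> g (res 1) = res 1"
  using ring_hom_one[of g A A] by (simp add: alg_auts_def one_A)

lemma aut_zero: "g \<in> Aut \<Longrightarrow> g (res 0) = res 0"
  using aut_scale[of g 0 0] by (auto elim!: aut_lift[of g 0])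

lemma linear_functional_aut:
  assumes "g \<in> Aut" "\<phi> \<in> linear_functionals A"
  shows "(\<lambda>x. \<phi> (g x)) \<in> linear_functionals A"
proof -
  have "g (x \<oplus>\<^bsub>A\<^esub> y) = g x \<oplus>\<^bsub>A\<^esub> g y" if "x \<in> carrier A" "y \<in> carrier A" for x y
    using assms(1) that by (simp add: alg_auts_def ring_hom_add)
  moreover have "g (c \<odot>\<^bsub>A\<^esub> x) = c \<odot>\<^bsub>A\<^esub> g x" if "x \<in> carrier A" for c x
    using assms(1) that by (simp add: alg_auts_def)
  ultimately show ?thesis
    using assms by (simp add: linear_functionals_def aut_carrier)
qed

definition mat :: "(('n, 'k) mpoly set \<Rightarrow> ('n, 'k) mpoly set) \<Rightarrow> ('n \<Rightarrow>\<^sub>0 nat) \<Rightarrow> ('n \<Rightarrow>\<^sub>0 nat) \<Rightarrow> 'k" where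
  "mat g p m = coord p (g (res (monomial m)))"

lemma coord_expand:
  assumes "x \<in> carrier A" "\<phi> \<in> linear_functionals A"
  shows "\<phi> x = (\<Sum>m\<in>M. coord m x * \<phi> (res (monomial m)))"
proof -
  obtain f where f: "x = res f"
    using assms(1) by (rule carrierE)
  have "(\<Sum>m\<in>M. coord m x * \<phi> (res (monomial m))) = (\<Sum>m\<in>M. lookup f m * \<phi> (res (monomial m)))"
    by (rule sum.cong) (simp_all add: f)
  then show ?thesis
    unfolding f by (simp only: linear_functional_expand[OF assms(2), of f])
qed

lemma coord_aut:
  assumes "g \<in> Aut" "p \<in> M" "x \<in> carrier A"
  shows "coord p (g x) = (\<Sum>m\<in>M. coord m x * mat g p m)"
  unfolding mat_def
  using coord_expand[OF assms(3) linear_functional_aut[OF assms(1) coord_linear[OF assms(2)]]] .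

subsection \<open>Group structure\<close>

lemma subgroup_Aut: "subgroup Aut (BijGroup (carrier A))"
proof (rule subgroup.intro)
  show "Aut \<subseteq> carrier (BijGroup (carrier A))"
    by (auto simp: alg_auts_def BijGroup_def)
next
  fix g h assume g: "g \<in> Aut" and h: "h \<in> Aut"
  have B: "g \<in> Bij (carrier A)" "h \<in> Bij (carrier A)"
    using g h by (simp_all add: alg_auts_def)
  have "compose (carrier A) g h \<in> Aut"
    unfolding alg_auts_def
  proof (intro CollectI conjI)
    show "compose (carrier A) g h \<in> Bij (carrier A)"
      using B by (rule compose_Bij)
    show "compose (carrier A) g h \<in> ring_hom A A"
    proof -
      have "g \<in> ring_hom A A" "h \<in> ring_hom A A"
        using g h by (simp_all add: alg_auts_def)
      then show ?thesis
        by (intro ring_hom_memI)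
          (simp_all add: compose_def ring_hom_add ring_hom_mult aut_carrier[OF g] aut_carrier[OF h]
            closed_A aut_one[OF g] aut_one[OF h] one_A)
    qed
    show "\<forall>c. \<forall>x\<in>carrier A. compose (carrier A) g h (c \<odot>\<^bsub>A\<^esub> x) = c \<odot>\<^bsub>A\<^esub> compose (carrier A) g h x"
    proof (intro allI ballI)
      fix c x assume x: "x \<in> carrier A"
      then have "c \<odot>\<^bsub>A\<^esub> x \<in> carrier A"
        using closed_A(3) by blast
      with x g h show "compose (carrier A) g h (c \<odot>\<^bsub>A\<^esub> x) = c \<odot>\<^bsub>A\<^esub> compose (carrier A) g h x"
        using aut_carrier[OF h x] by (simp add: compose_def alg_auts_def)
    qed
  qed
  then show "g \<otimes>\<^bsub>BijGroup (carrier A)\<^esub> h \<in> Aut"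
    using B by (simp add: BijGroup_def)
next
  show "\<one>\<^bsub>BijGroup (carrier A)\<^esub> \<in> Aut"
    unfolding BijGroup_def alg_auts_def
    by (simp add: id_Bij closed_A, intro ring_hom_memI) (simp_all add: one_A closed_A)
next
  fix g assume g: "g \<in> Aut"
  then have B: "g \<in> Bij (carrier A)"
    by (simp add: alg_auts_def)
  define h where "h = (\<lambda>x\<in>carrier A. inv_into (carrier A) g x)"
  have hB: "h \<in> Bij (carrier A)"
    unfolding h_def by (rule restrict_inv_into_Bij[OF B])
  have hc: "h x \<in> carrier A" and gh: "g (h x) = x" if "x \<in> carrier A" for x
    using B that by (auto simp: h_def Bij_def bij_betw_def f_inv_into_f inv_into_into)
  have hg: "h (g x) = x" if "x \<in> carrier A" for x
    using B that by (auto simp: h_def Bij_def bij_betw_def aut_carrier[OF g])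
  have eqI: "h x = y" if "g y = x" "y \<in> carrier A" for x y
    using hg that by auto
  have "h \<in> Aut"
    unfolding alg_auts_def
  proof (intro CollectI conjI allI ballI)
    show "h \<in> Bij (carrier A)"
      by (rule hB)
    show "h \<in> ring_hom A A"
    proof (rule ring_hom_memI)
      fix x y assume xy: "x \<in> carrier A" "y \<in> carrier A"
      obtain a b where ab: "h x = res a" "h y = res b"
        using hc xy by (meson carrierE)
      show "h (x \<otimes>\<^bsub>A\<^esub> y) = h x \<otimes>\<^bsub>A\<^esub> h y"
        using ab gh[OF xy(1)] gh[OF xy(2)] aut_mult[OF g, of a b] by (intro eqI) simp_all
      show "h (x \<oplus>\<^bsub>A\<^esub> y) = h x \<oplus>\<^bsub>A\<^esub> h y"
        using ab gh[OF xy(1)] gh[OF xy(2)] aut_add[OF g, of a b] by (intro eqI) simp_all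
    qed (use hc in \<open>simp_all add: one_A eqI aut_one[OF g]\<close>)
    fix c x assume x: "x \<in> carrier A"
    obtain a where a: "h x = res a"
      using hc x by (meson carrierE)
    show "h (c \<odot>\<^bsub>A\<^esub> x) = c \<odot>\<^bsub>A\<^esub> h x"
      using a gh[OF x] aut_scale[OF g, of c a] by (intro eqI) simp_all
  qed
  then show "inv\<^bsub>BijGroup (carrier A)\<^esub> g \<in> Aut"
    using B by (simp add: inv_BijGroup h_def)
qed

lemma group_G: "group G"
  unfolding aut_group_def
  by (rule subgroup.subgroup_is_group[OF subgroup_Aut group_BijGroup])

sublocale G: group G
  by (rule group_G)

lemma carrier_G [simp]: "carrier G = Aut"
  by (simp add: aut_group_def)

lemma inv_in_Aut [simp]: "g \<in> Aut \<Longrightarrow> inv\<^bsub>G\<^esub> g \<in> Aut"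
  using G.inv_closed[of g] by simp

lemma mult_in_Aut [simp]: "g \<in> Aut \<Longrightarrow> h \<in> Aut \<Longrightarrow> g \<otimes>\<^bsub>G\<^esub> h \<in> Aut"
  using G.m_closed[of g h] by simp

lemma one_in_Aut [simp]: "\<one>\<^bsub>G\<^esub> \<in> Aut"
  using G.one_closed by simp

lemma mult_G_apply: "g \<in> Aut \<Longrightarrow> h \<in> Aut \<Longrightarrow> x \<in> carrier A \<Longrightarrow> (g \<otimes>\<^bsub>G\<^esub> h) x = g (h x)"
  by (simp add: aut_group_def BijGroup_def alg_auts_def compose_def)

lemma one_G_apply: "x \<in> carrier A \<Longrightarrow> \<one>\<^bsub>G\<^esub> x = x"
  by (simp add: aut_group_def BijGroup_def)

lemma inv_G_apply:
  assumes "g \<in> Aut" "x \<in> carrier A"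
  shows "(inv\<^bsub>G\<^esub> g) (g x) = x" "g ((inv\<^bsub>G\<^esub> g) x) = x"
  using mult_G_apply[of "inv\<^bsub>G\<^esub> g" g x] mult_G_apply[of g "inv\<^bsub>G\<^esub> g" x] assms
    G.inv_closed[of g] G.l_inv[of g] G.r_inv[of g] one_G_apply[of x] by simp_all

lemma aut_eqI:
  assumes "g \<in> Aut" "h \<in> Aut" "\<And>x. x \<in> carrier A \<Longrightarrow> g x = h x"
  shows "g = h"
  using assms by (intro extensionalityI[of _ "carrier A"]) (auto simp: alg_auts_def Bij_def)

lemma aut_eqI_mat:
  assumes "g \<in> Aut" "h \<in> Aut" "\<And>m p. m \<in> M \<Longrightarrow> p \<in> M \<Longrightarrow> mat g p m = mat h p m"
  shows "g = h"
proof (rule aut_eqI[OF assms(1,2)])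
  fix x assume x: "x \<in> carrier A"
  show "g x = h x"
    by (rule coord_eqI) (use assms x in \<open>simp_all add: aut_carrier coord_aut\<close>)
qed

lemma aut_eqI_gen:
  assumes "g \<in> Aut" "h \<in> Aut" "\<And>i. g (gen i) = h (gen i)"
  shows "g = h"
proof (rule aut_eqI_mat[OF assms(1,2)])
  fix m p
  have "g (res (monomial m)) = h (res (monomial m))"
    by (induction m rule: exponent_induct)
      (simp_all add: assms aut_one monomial_add aut_mult)
  then show "mat g p m = mat h p m"
    by (simp add: mat_def)
qed

lemma mat_mult:
  assumes "g \<in> Aut" "h \<in> Aut" "p \<in> M"
  shows "mat (g \<otimes>\<^bsub>G\<^esub> h) p m = (\<Sum>l\<in>M. mat g p l * mat h l m)"
  using coord_aut[of g p "h (res (monomial m))"] assms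
  by (simp add: mat_def mult_G_apply aut_carrier mult.commute)

lemma mat_one:
  assumes "p \<in> M"
  shows "mat \<one>\<^bsub>G\<^esub> p m = (if p = m then 1 else 0)"
  using assms by (simp add: mat_def one_G_apply lookup_monomial)

subsection \<open>The Zariski topology\<close>

abbreviation PF :: "((('n, 'k) mpoly set \<Rightarrow> ('n, 'k) mpoly set) \<Rightarrow> 'k) set" where
  "PF \<equiv> polynomial_functions A"

lemma topspace_zariski [simp]: "topspace (zariski A) = Aut"
proof -
  have "Aut \<in> {{g \<in> Aut. p g \<noteq> 0} | p. p \<in> PF}"
    by (intro CollectI exI[of _ "\<lambda>g. 1"]) (simp add: polynomial_functions.const)
  then have "Aut \<subseteq> \<Union>{{g \<in> Aut. p g \<noteq> 0} | p. p \<in> PF}"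
    by (rule Union_upper)
  moreover have "\<Union>{{g \<in> Aut. p g \<noteq> 0} | p. p \<in> PF} \<subseteq> Aut"
    by (rule Union_least) auto
  ultimately show ?thesis
    unfolding zariski_def topology_generated_by_topspace by (rule equalityI[rotated])
qed

lemma openin_nonzero: "p \<in> PF \<Longrightarrow> openin (zariski A) {g \<in> Aut. p g \<noteq> 0}"
  unfolding zariski_def by (intro topology_generated_by_Basis CollectI exI[of _ p]) simp

lemma closedin_zeros:
  assumes "P \<subseteq> PF"
  shows "closedin (zariski A) {g \<in> Aut. \<forall>p\<in>P. p g = 0}"
proof -
  have "Aut - {g \<in> Aut. \<forall>p\<in>P. p g = 0} = (\<Union>p\<in>P. {g \<in> Aut. p g \<noteq> 0})"
    by blast
  moreover have "openin (zariski A) (\<Union>p\<in>P. {g \<in> Aut. p g \<noteq> 0})"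
    by (rule openin_Union) (use assms openin_nonzero in blast)
  ultimately show ?thesis
    by (auto simp: closedin_def)
qed

lemma mat_PF: "p \<in> M \<Longrightarrow> (\<lambda>g. mat g p m) \<in> PF"
  unfolding mat_def by (rule polynomial_functions.entry) (auto simp: coord_linear)

lemma mat_diff_PF: "p \<in> M \<Longrightarrow> (\<lambda>g. mat g p m - c) \<in> PF"
  using polynomial_functions.add[OF mat_PF polynomial_functions.const, of p m "-c"] by simp

text \<open>The sets \<open>p \<noteq> 0\<close> are closed under intersection, as a product in a
  field is nonzero exactly when both factors are; so they form a basis and not just a
  subbasis.\<close>

lemma openin_zariskiE:
  assumes "openin (zariski A) U" "g \<in> U"
  obtains p where "p \<in> PF" "g \<in> Aut" "p g \<noteq> 0" "{h \<in> Aut. p h \<noteq> 0} \<subseteq> U"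
proof -
  have "generate_topology_on {{g \<in> Aut. p g \<noteq> 0} | p. p \<in> PF} U"
    using assms(1) unfolding zariski_def by (rule openin_topology_generated_by)
  then have "\<exists>p\<in>PF. g \<in> Aut \<and> p g \<noteq> 0 \<and> {h \<in> Aut. p h \<noteq> 0} \<subseteq> U"
    using \<open>g \<in> U\<close>
  proof (induction rule: generate_topology_on.induct)
    case (Int U V)
    then obtain p q where "p \<in> PF" "q \<in> PF" "g \<in> Aut" "p g \<noteq> 0" "q g \<noteq> 0"
      "{h \<in> Aut. p h \<noteq> 0} \<subseteq> U" "{h \<in> Aut. q h \<noteq> 0} \<subseteq> V"
      by blast
    then show ?case
      by (intro bexI[of _ "\<lambda>g. p g * q g"]) (auto intro: polynomial_functions.mult)
  next
    case (UN K)
    then show ?case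
      by (meson UnionE Union_upper order_trans)
  qed auto
  then show ?thesis
    using that by blast
qed

text \<open>Moving \<open>a\<close> into the functional turns \<open>\<phi> (a (g x))\<close> into
  an entry function of \<open>g\<close>. Equality is claimed on \<open>Aut\<close> only, where
  multiplication is composition.\<close>

lemma PF_left_mult:
  assumes "p \<in> PF" "a \<in> Aut"
  shows "\<exists>q\<in>PF. \<forall>g\<in>Aut. p (a \<otimes>\<^bsub>G\<^esub> g) = q g"
  using assms(1)
proof induction
  case (const c)
  show ?case
    by (rule bexI[OF _ polynomial_functions.const[of c]]) simp
next
  case (entry \<phi> x)
  then show ?case
    by (intro bexI[OF _ polynomial_functions.entry[of "\<lambda>y. \<phi> (a y)" A x]])
      (simp_all add: mult_G_apply assms(2) linear_functional_aut)
next
  case (add p q)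
  then obtain p' q' where "p' \<in> PF" "q' \<in> PF" "\<forall>g\<in>Aut. p (a \<otimes>\<^bsub>G\<^esub> g) = p' g"
    "\<forall>g\<in>Aut. q (a \<otimes>\<^bsub>G\<^esub> g) = q' g"
    by blast
  then show ?case
    by (intro bexI[OF _ polynomial_functions.add[of p' A q']]) simp_all
next
  case (mult p q)
  then obtain p' q' where "p' \<in> PF" "q' \<in> PF" "\<forall>g\<in>Aut. p (a \<otimes>\<^bsub>G\<^esub> g) = p' g"
    "\<forall>g\<in>Aut. q (a \<otimes>\<^bsub>G\<^esub> g) = q' g"
    by blast
  then show ?case
    by (intro bexI[OF _ polynomial_functions.mult[of p' A q']]) simp_all
qed

lemma continuous_left_mult:
  assumes a: "a \<in> Aut"
  shows "continuous_map (zariski A) (zariski A) (\<lambda>g. a \<otimes>\<^bsub>G\<^esub> g)"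
proof -
  have closed: "a \<otimes>\<^bsub>G\<^esub> g \<in> Aut" if "g \<in> Aut" for g
    using G.m_closed[of a g] a that by simp
  show ?thesis
    unfolding continuous_map_def
  proof (intro conjI allI impI)
    show "(\<lambda>g. a \<otimes>\<^bsub>G\<^esub> g) \<in> topspace (zariski A) \<rightarrow> topspace (zariski A)"
      using closed by simp
    fix U assume U: "openin (zariski A) U"
    have "\<exists>V. openin (zariski A) V \<and> g \<in> V \<and> V \<subseteq> {g \<in> Aut. a \<otimes>\<^bsub>G\<^esub> g \<in> U}"
      if g: "g \<in> Aut" "a \<otimes>\<^bsub>G\<^esub> g \<in> U" for g
    proof -
      obtain p where p: "p \<in> PF" "p (a \<otimes>\<^bsub>G\<^esub> g) \<noteq> 0" "{h \<in> Aut. p h \<noteq> 0} \<subseteq> U"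
        by (rule openin_zariskiE[OF U g(2)])
      obtain q where q: "q \<in> PF" "\<And>h. h \<in> Aut \<Longrightarrow> p (a \<otimes>\<^bsub>G\<^esub> h) = q h"
        using PF_left_mult[OF p(1) a] by blast
      show ?thesis
      proof (intro exI conjI)
        show "openin (zariski A) {h \<in> Aut. q h \<noteq> 0}"
          by (rule openin_nonzero[OF q(1)])
        show "g \<in> {h \<in> Aut. q h \<noteq> 0}"
          using g(1) p(2) q(2)[OF g(1)] by simp
        show "{h \<in> Aut. q h \<noteq> 0} \<subseteq> {g \<in> Aut. a \<otimes>\<^bsub>G\<^esub> g \<in> U}"
        proof
          fix h assume "h \<in> {h \<in> Aut. q h \<noteq> 0}"
          then have h: "h \<in> Aut" "p (a \<otimes>\<^bsub>G\<^esub> h) \<noteq> 0"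
            using q(2)[of h] by simp_all
          then show "h \<in> {g \<in> Aut. a \<otimes>\<^bsub>G\<^esub> g \<in> U}"
            using p(3) closed by blast
        qed
      qed
    qed
    then show "openin (zariski A) {g \<in> topspace (zariski A). a \<otimes>\<^bsub>G\<^esub> g \<in> U}"
      by (subst openin_subopen) auto
  qed
qed

lemma PF_curve:
  assumes "p \<in> PF"
    and aut: "\<And>s. s \<in> S \<Longrightarrow> \<gamma> s \<in> Aut"
    and mat: "\<And>m p. m \<in> M \<Longrightarrow> p \<in> M \<Longrightarrow> \<exists>P. \<forall>s\<in>S. mat (\<gamma> s) p m = poly P s"
  shows "\<exists>P. \<forall>s\<in>S. p (\<gamma> s) = poly P s"
  using assms(1)
proof induction
  case (const c)
  show ?case
    by (rule exI[of _ "[:c:]"]) simp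
next
  case (entry \<phi> x)
  obtain P where P: "\<And>m p s. m \<in> M \<Longrightarrow> p \<in> M \<Longrightarrow> s \<in> S \<Longrightarrow> mat (\<gamma> s) p m = poly (P m p) s"
    using mat by metis
  define Q where "Q = (\<Sum>p\<in>M. (\<Sum>m\<in>M. Polynomial.smult (coord m x * \<phi> (res (monomial p))) (P m p)))"
  have "\<phi> (\<gamma> s x) = poly Q s" if s: "s \<in> S" for s
  proof -
    have "\<phi> (\<gamma> s x) = (\<Sum>p\<in>M. coord p (\<gamma> s x) * \<phi> (res (monomial p)))"
      by (rule coord_expand) (use entry s in \<open>auto simp: aut aut_carrier\<close>)
    also have "\<dots> = (\<Sum>p\<in>M. \<Sum>m\<in>M. coord m x * \<phi> (res (monomial p)) * poly (P m p) s)"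
      by (rule sum.cong) (use entry s in \<open>simp_all add: coord_aut aut P sum_distrib_right mult.assoc mult.commute[of "\<phi> _"]\<close>)
    finally show ?thesis
      by (simp add: Q_def poly_sum)
  qed
  then show ?case
    by blast
next
  case (add p q)
  then obtain P Q where "\<forall>s\<in>S. p (\<gamma> s) = poly P s" "\<forall>s\<in>S. q (\<gamma> s) = poly Q s"
    by blast
  then show ?case
    by (intro exI[of _ "P + Q"]) simp
next
  case (mult p q)
  then obtain P Q where "\<forall>s\<in>S. p (\<gamma> s) = poly P s" "\<forall>s\<in>S. q (\<gamma> s) = poly Q s"
    by blast
  then show ?case
    by (intro exI[of _ "P * Q"]) simp
qed

text \<open>An infinite subset of the affine line is irreducible, and so is its image under a polynomial curve.\<close>

lemma connectedin_curve:
  assumes S: "infinite S"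
    and aut: "\<And>s. s \<in> S \<Longrightarrow> \<gamma> s \<in> Aut"
    and mat: "\<And>m p. m \<in> M \<Longrightarrow> p \<in> M \<Longrightarrow> \<exists>P. \<forall>s\<in>S. mat (\<gamma> s) p m = poly P s"
  shows "connectedin (zariski A) (\<gamma> ` S)"
proof -
  have False if U: "openin (zariski A) U" "openin (zariski A) V"
    and cap: "U \<inter> V \<inter> \<gamma> ` S = {}" and ne: "U \<inter> \<gamma> ` S \<noteq> {}" "V \<inter> \<gamma> ` S \<noteq> {}" for U V
  proof -
    obtain a b where ab: "a \<in> S" "\<gamma> a \<in> U" "b \<in> S" "\<gamma> b \<in> V"
      using ne by blast
    obtain p where p: "p \<in> PF" "p (\<gamma> a) \<noteq> 0" "{h \<in> Aut. p h \<noteq> 0} \<subseteq> U"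
      by (rule openin_zariskiE[OF U(1) ab(2)])
    obtain q where q: "q \<in> PF" "q (\<gamma> b) \<noteq> 0" "{h \<in> Aut. q h \<noteq> 0} \<subseteq> V"
      by (rule openin_zariskiE[OF U(2) ab(4)])
    have "\<exists>P. \<forall>s\<in>S. p (\<gamma> s) = poly P s"
      by (rule PF_curve[OF p(1)]) (rule aut mat, assumption+)+
    then obtain P where P: "\<And>s. s \<in> S \<Longrightarrow> p (\<gamma> s) = poly P s"
      by blast
    have "\<exists>P. \<forall>s\<in>S. q (\<gamma> s) = poly P s"
      by (rule PF_curve[OF q(1)]) (rule aut mat, assumption+)+
    then obtain Q where Q: "\<And>s. s \<in> S \<Longrightarrow> q (\<gamma> s) = poly Q s"
      by blast
    have "P \<noteq> 0" "Q \<noteq> 0"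
      using P[OF ab(1)] Q[OF ab(3)] p(2) q(2) by auto
    then have "finite ({s. poly P s = 0} \<union> {s. poly Q s = 0})"
      by (simp add: poly_roots_finite)
    then obtain s where s: "s \<in> S" "poly P s \<noteq> 0" "poly Q s \<noteq> 0"
      using S finite_subset[of S "{s. poly P s = 0} \<union> {s. poly Q s = 0}"] by blast
    then have "p (\<gamma> s) \<noteq> 0" "q (\<gamma> s) \<noteq> 0" "\<gamma> s \<in> Aut"
      using P Q aut by simp_all
    then have "\<gamma> s \<in> U \<inter> V"
      using p(3) q(3) by blast
    with cap s(1) show False
      by blast
  qed
  moreover have "\<gamma> ` S \<subseteq> topspace (zariski A)"
    using aut by auto
  ultimately show ?thesis
    unfolding connectedin by (intro conjI notI) (simp, elim exE conjE)
qed

section \<open>The identity component\<close>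

abbreviation IC :: "(('n, 'k) mpoly set \<Rightarrow> ('n, 'k) mpoly set) set" where
  "IC \<equiv> identity_component A"

lemma connectedin_subset_IC: "connectedin (zariski A) S \<Longrightarrow> \<one>\<^bsub>G\<^esub> \<in> S \<Longrightarrow> S \<subseteq> IC"
  unfolding identity_component_def by (rule connected_component_of_maximal)

lemma connectedin_IC: "connectedin (zariski A) IC"
  unfolding identity_component_def by (rule connectedin_connected_component_of)

lemma one_in_IC: "\<one>\<^bsub>G\<^esub> \<in> IC"
  unfolding identity_component_def by (simp add: connected_component_of_refl one_in_Aut)

lemma IC_subset_Aut: "IC \<subseteq> Aut"
  using connectedin_subset_topspace[OF connectedin_IC] by simp

text \<open>The translate of \<open>IC\<close> by \<open>g^-1\<close> is connected and contains the
  identity, because \<open>g\<close> lies in \<open>IC\<close>. Continuity of left translations thus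
  suffices to make \<open>IC\<close> a subgroup.\<close>

lemma left_translate_IC:
  assumes "g \<in> IC" "h \<in> IC"
  shows "inv\<^bsub>G\<^esub> g \<otimes>\<^bsub>G\<^esub> h \<in> IC"
proof -
  have g: "g \<in> Aut" "inv\<^bsub>G\<^esub> g \<in> Aut"
    using assms IC_subset_Aut G.inv_closed[of g] by auto
  have "(\<lambda>x. inv\<^bsub>G\<^esub> g \<otimes>\<^bsub>G\<^esub> x) ` IC \<subseteq> IC"
  proof (rule connectedin_subset_IC)
    show "connectedin (zariski A) ((\<lambda>x. inv\<^bsub>G\<^esub> g \<otimes>\<^bsub>G\<^esub> x) ` IC)"
      by (rule connectedin_continuous_map_image[OF continuous_left_mult[OF g(2)] connectedin_IC])
    show "\<one>\<^bsub>G\<^esub> \<in> (\<lambda>x. inv\<^bsub>G\<^esub> g \<otimes>\<^bsub>G\<^esub> x) ` IC"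
      using assms(1) g(1) G.l_inv[of g] by (auto simp: image_iff intro!: bexI[of _ g])
  qed
  then show ?thesis
    using assms(2) by blast
qed

lemma subgroup_IC: "subgroup IC G"
proof (rule G.subgroupI)
  have inv: "inv\<^bsub>G\<^esub> g \<in> IC" if "g \<in> IC" for g
  proof -
    have "inv\<^bsub>G\<^esub> g \<in> carrier G"
      using that IC_subset_Aut by (intro G.inv_closed) auto
    then show ?thesis
      using left_translate_IC[OF that one_in_IC] by simp
  qed
  then show "inv\<^bsub>G\<^esub> g \<in> IC" if "g \<in> IC" for g
    using that .
  show "g \<otimes>\<^bsub>G\<^esub> h \<in> IC" if "g \<in> IC" "h \<in> IC" for g h
    using left_translate_IC[OF inv[OF that(1)] that(2)] that(1) IC_subset_Aut G.inv_inv[of g] by auto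
qed (use IC_subset_Aut one_in_IC in auto)

text \<open>A closed subgroup of finite index is open. Finiteness of the index is expressed by a
  finite-valued function that separates the left cosets.\<close>

lemma IC_subset_finite_index:
  assumes H: "subgroup H G" "closedin (zariski A) H"
    and fin: "finite (\<sigma> ` Aut)"
    and sep: "\<And>g h. g \<in> Aut \<Longrightarrow> h \<in> Aut \<Longrightarrow> \<sigma> g = \<sigma> h \<Longrightarrow> inv\<^bsub>G\<^esub> h \<otimes>\<^bsub>G\<^esub> g \<in> H"
  shows "IC \<subseteq> H"
proof -
  interpret H: subgroup H G
    by (rule H(1))
  define coset where "coset h = {g \<in> Aut. inv\<^bsub>G\<^esub> h \<otimes>\<^bsub>G\<^esub> g \<in> H}" for h
  \<comment> \<open>One representative for each value of \<open>\<sigma>\<close> outside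
    \<open>H\<close>: the complement of \<open>H\<close> becomes a finite union of closed left
    cosets, hence \<open>H\<close> is open.\<close>
  define r where "r c = (SOME h. h \<in> Aut - H \<and> \<sigma> h = c)" for c
  have r: "r (\<sigma> g) \<in> Aut - H" "\<sigma> (r (\<sigma> g)) = \<sigma> g" if "g \<in> Aut - H" for g
    using someI[of "\<lambda>h. h \<in> Aut - H \<and> \<sigma> h = \<sigma> g" g] that by (auto simp: r_def)
  have "Aut - H = (\<Union>h\<in>r ` \<sigma> ` (Aut - H). coset h)"
  proof (intro equalityI subsetI)
    fix g assume g: "g \<in> Aut - H"
    then have "g \<in> coset (r (\<sigma> g))"
      using r[OF g] sep[of g "r (\<sigma> g)"] by (auto simp: coset_def)
    then show "g \<in> (\<Union>h\<in>r ` \<sigma> ` (Aut - H). coset h)"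
      using g by blast
  next
    fix g assume "g \<in> (\<Union>h\<in>r ` \<sigma> ` (Aut - H). coset h)"
    then obtain h where h: "h \<in> Aut" "h \<notin> H" "g \<in> Aut" "inv\<^bsub>G\<^esub> h \<otimes>\<^bsub>G\<^esub> g \<in> H"
      using r by (auto simp: coset_def)
    have "g \<notin> H"
    proof
      assume "g \<in> H"
      then have "g \<otimes>\<^bsub>G\<^esub> inv\<^bsub>G\<^esub> (inv\<^bsub>G\<^esub> h \<otimes>\<^bsub>G\<^esub> g) \<in> H"
        using h(4) by blast
      moreover have "g \<otimes>\<^bsub>G\<^esub> inv\<^bsub>G\<^esub> (inv\<^bsub>G\<^esub> h \<otimes>\<^bsub>G\<^esub> g) = h"
        using h(1,3) by (simp add: G.inv_mult_group flip: G.m_assoc)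
      ultimately show False
        using h(2) by simp
    qed
    then show "g \<in> Aut - H"
      using h(3) by blast
  qed
  moreover have "closedin (zariski A) (\<Union>h\<in>r ` \<sigma> ` (Aut - H). coset h)"
  proof (rule closedin_Union)
    show "finite (coset ` r ` \<sigma> ` (Aut - H))"
      by (intro finite_imageI finite_subset[OF _ fin]) blast
    fix T assume "T \<in> coset ` r ` \<sigma> ` (Aut - H)"
    then obtain h where h: "h \<in> Aut" "T = coset h"
      using r by blast
    have "inv\<^bsub>G\<^esub> h \<in> Aut"
      using h(1) G.inv_closed[of h] by simp
    from closedin_continuous_map_preimage[OF continuous_left_mult[OF this] H(2)]
    show "closedin (zariski A) T"
      by (simp add: h(2) coset_def)
  qed
  ultimately have "closedin (zariski A) (Aut - H)"
    by simp
  then have "openin (zariski A) H"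
    using closedin_subset[OF H(2)] by (simp add: openin_closedin_eq)
  then have "IC \<subseteq> H \<or> disjnt IC H"
    using connectedin_clopen_cases[OF connectedin_IC H(2)] by blast
  then show ?thesis
    using one_in_IC H.one_closed by (auto simp: disjnt_iff)
qed

section \<open>Triangular automorphisms\<close>

text \<open>\<open>raises w d a g\<close>: modulo terms whose weight is larger by at least \<open>d\<close>, the map \<open>g\<close> multiplies
  the monomial with exponent \<open>m\<close> by \<open>a m\<close>.\<close>

definition raises :: "('n \<Rightarrow> nat) \<Rightarrow> nat \<Rightarrow> (('n \<Rightarrow>\<^sub>0 nat) \<Rightarrow> 'k) \<Rightarrow> (('n, 'k) mpoly set \<Rightarrow> ('n, 'k) mpoly set) \<Rightarrow> bool" where
  "raises w d a g \<longleftrightarrow> (\<forall>m\<in>M. \<forall>p\<in>M. mat g p m \<noteq> (if p = m then a m else 0) \<longrightarrow> wt w m + d \<le> wt w p)"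

definition triangular :: "('n \<Rightarrow> nat) \<Rightarrow> (('n, 'k) mpoly set \<Rightarrow> ('n, 'k) mpoly set) set" where
  "triangular w = {g \<in> Aut. \<exists>a. raises w 1 a g}"

text \<open>As \<open>d\<close> grows these groups descend to the trivial one; the gap
  \<open>d\<close> is what the proof of solvability increases.\<close>

definition unitriangular :: "('n \<Rightarrow> nat) \<Rightarrow> nat \<Rightarrow> (('n, 'k) mpoly set \<Rightarrow> ('n, 'k) mpoly set) set" where
  "unitriangular w d = {g \<in> Aut. raises w d (\<lambda>_. 1) g}"

lemma raisesD:
  assumes "raises w d a g" "m \<in> M" "p \<in> M" "wt w p < wt w m + d"
  shows "mat g p m = (if p = m then a m else 0)"
proof (rule ccontr)
  assume "mat g p m \<noteq> (if p = m then a m else 0)"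
  with assms(1-3) have "wt w m + d \<le> wt w p"
    unfolding raises_def by blast
  with assms(4) show False
    by simp
qed

lemma raisesI:
  assumes "\<And>m p. m \<in> M \<Longrightarrow> p \<in> M \<Longrightarrow> wt w p < wt w m + d \<Longrightarrow> mat g p m = (if p = m then a m else 0)"
  shows "raises w d a g"
  unfolding raises_def by (intro ballI impI leI notI) (use assms in blast)

lemma raises_mono: "raises w d a g \<Longrightarrow> e \<le> d \<Longrightarrow> raises w e a g"
  by (rule raisesI) (rule raisesD, assumption+, simp)

lemma unitriangular_mono: "e \<le> d \<Longrightarrow> unitriangular w d \<subseteq> unitriangular w e"
  by (auto simp: unitriangular_def intro: raises_mono)

lemma unitriangular_subset_triangular: "unitriangular w 1 \<subseteq> triangular w"
  by (auto simp: unitriangular_def triangular_def)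

text \<open>Below the weight bound only \<open>l = m\<close> contributes to the matrix product:
  \<open>h\<close> leads from \<open>m\<close> only to \<open>m\<close> itself or to some
  \<open>l\<close> heavier by \<open>d\<close>, and \<open>g\<close> does not lead from there back
  to the lighter \<open>p\<close>.\<close>

lemma raises_mult:
  assumes g: "g \<in> Aut" "raises w d a g" and h: "h \<in> Aut" "raises w d b h" and d: "d > 0"
  shows "raises w d (\<lambda>m. a m * b m) (g \<otimes>\<^bsub>G\<^esub> h)"
proof (rule raisesI)
  fix m p assume mp: "m \<in> M" "p \<in> M" "wt w p < wt w m + d"
  have "mat g p l * mat h l m = (if l = m then (if p = m then a m * b m else 0) else 0)" if l: "l \<in> M" for l
  proof (cases "l = m")
    case True
    have "mat h m m = b m"
      using raisesD[OF h(2), of m m] mp d by simp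
    then show ?thesis
      using True raisesD[OF g(2), of m p] mp by simp
  next
    case False
    show ?thesis
    proof (cases "wt w l < wt w m + d")
      case True
      then show ?thesis
        using raisesD[OF h(2), of m l] mp l False by simp
    next
      case l2: False
      then have "p \<noteq> l" "wt w p < wt w l + d"
        using mp(3) by auto
      then show ?thesis
        using raisesD[OF g(2), of l p] mp l False by simp
    qed
  qed
  then have "(\<Sum>l\<in>M. mat g p l * mat h l m) = (\<Sum>l\<in>M. if l = m then (if p = m then a m * b m else 0) else 0)"
    by (rule sum.cong[OF refl])
  then show "mat (g \<otimes>\<^bsub>G\<^esub> h) p m = (if p = m then a m * b m else 0)"
    using mp by (simp add: mat_mult g h)
qed

text \<open>The identity \<open>g^-1 g = 1\<close> is solved column by column, starting with the
  heaviest monomials. For \<open>l\<close> heavier by \<open>d\<close> the entries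
  \<open>N p l\<close> are already known to vanish, so column \<open>m\<close> reduces to
  \<open>N p m * a m\<close>; its diagonal entry gives \<open>a m \<noteq> 0\<close>.\<close>

lemma raises_inv:
  assumes g: "g \<in> Aut" "raises w d a g" and d: "d > 0"
  shows "raises w d (\<lambda>m. inverse (a m)) (inv\<^bsub>G\<^esub> g)" "m \<in> M \<Longrightarrow> a m \<noteq> 0"
proof -
  define B where "B = Max (wt w ` M)"
  have B: "wt w m \<le> B" if "m \<in> M" for m
    using that by (simp add: B_def)
  define N where "N = mat (inv\<^bsub>G\<^esub> g)"
  have NG: "(\<Sum>l\<in>M. N p l * mat g l m) = (if p = m then 1 else 0)" if "p \<in> M" for p m
    using that mat_mult[of "inv\<^bsub>G\<^esub> g" g p m] g(1) mat_one[of p m] by (simp add: N_def)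
  have main: "a m \<noteq> 0 \<and> (\<forall>p\<in>M. wt w p < wt w m + d \<longrightarrow> N p m = (if p = m then inverse (a m) else 0))"
    if "m \<in> M" for m
    using that
  proof (induction "B - wt w m" arbitrary: m rule: less_induct)
    case less
    have eq: "N p m * a m = (if p = m then 1 else 0)" if p: "p \<in> M" "wt w p < wt w m + d" for p
    proof -
      have "N p l * mat g l m = (if l = m then N p m * a m else 0)" if l: "l \<in> M" for l
      proof (cases "l = m")
        case True
        then show ?thesis
          using raisesD[OF g(2), of m m] less.prems d by simp
      next
        case False
        show ?thesis
        proof (cases "wt w l < wt w m + d")
          case True
          then show ?thesis
            using raisesD[OF g(2), of m l] less.prems l False by simp
        next
          case l2: False
          then have "B - wt w l < B - wt w m"
            using B[OF l] d by auto
          moreover have "p \<noteq> l" "wt w p < wt w l + d"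
            using l2 p(2) by auto
          ultimately show ?thesis
            using less.hyps[of l] l p(1) False by auto
        qed
      qed
      then have "(\<Sum>l\<in>M. N p l * mat g l m) = (\<Sum>l\<in>M. if l = m then N p m * a m else 0)"
        by (rule sum.cong[OF refl])
      then show ?thesis
        using NG[OF p(1), of m] less.prems by simp
    qed
    have am: "N m m * a m = 1"
      using eq[of m] less.prems d by simp
    then have "a m \<noteq> 0"
      by auto
    moreover have "N p m = (if p = m then inverse (a m) else 0)" if "p \<in> M" "wt w p < wt w m + d" for p
      using eq[OF that] \<open>a m \<noteq> 0\<close> by (auto simp: field_simps split: if_splits)
    ultimately show ?case
      by blast
  qed
  show "raises w d (\<lambda>m. inverse (a m)) (inv\<^bsub>G\<^esub> g)"
    by (rule raisesI) (use main in \<open>simp add: N_def\<close>)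
  show "m \<in> M \<Longrightarrow> a m \<noteq> 0"
    using main by blast
qed

lemma subgroup_triangular: "subgroup (triangular w) G"
proof (rule G.subgroupI)
  have "raises w 1 (\<lambda>_. 1) \<one>\<^bsub>G\<^esub>"
    by (rule raisesI) (simp add: mat_one)
  then show "triangular w \<noteq> {}"
    unfolding triangular_def using one_in_Aut by blast
  show "inv\<^bsub>G\<^esub> g \<in> triangular w" if "g \<in> triangular w" for g
    using that raises_inv(1)[of g w 1] by (auto simp: triangular_def)
  show "g \<otimes>\<^bsub>G\<^esub> h \<in> triangular w" if "g \<in> triangular w" "h \<in> triangular w" for g h
    using that raises_mult[of g w 1 _ h] by (auto simp: triangular_def)
qed (auto simp: triangular_def)

lemma subgroup_unitriangular:
  assumes "d > 0"
  shows "subgroup (unitriangular w d) G"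
proof (rule G.subgroupI)
  have "raises w d (\<lambda>_. 1) \<one>\<^bsub>G\<^esub>"
    by (rule raisesI) (simp add: mat_one)
  then show "unitriangular w d \<noteq> {}"
    unfolding unitriangular_def using one_in_Aut by blast
  show "inv\<^bsub>G\<^esub> g \<in> unitriangular w d" if "g \<in> unitriangular w d" for g
    using that raises_inv(1)[of g w d "\<lambda>_. 1"] assms by (auto simp: unitriangular_def)
  show "g \<otimes>\<^bsub>G\<^esub> h \<in> unitriangular w d" if "g \<in> unitriangular w d" "h \<in> unitriangular w d" for g h
    using that raises_mult[of g w d "\<lambda>_. 1" h "\<lambda>_. 1"] assms by (auto simp: unitriangular_def)
qed (auto simp: unitriangular_def)

lemma closedin_raises: "closedin (zariski A) {g \<in> Aut. raises w d a g}"
proof -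
  define P where "P = (\<lambda>(m, p). (\<lambda>g. mat g p m - (if p = m then a m else 0))) ` {(m, p) \<in> M \<times> M. wt w p < wt w m + d}"
  have "P \<subseteq> PF"
    by (auto simp only: P_def mat_diff_PF)
  moreover have "{g \<in> Aut. raises w d a g} = {g \<in> Aut. \<forall>p\<in>P. p g = 0}"
    by (auto simp: P_def raises_def not_less[symmetric])
  ultimately show ?thesis
    using closedin_zeros by simp
qed

lemma closedin_unitriangular: "closedin (zariski A) (unitriangular w d)"
  using closedin_raises by (simp add: unitriangular_def)

text \<open>The diagonal is read off from the matrix, so quantifying over \<open>a\<close> imposes
  nothing beyond the vanishing of off-diagonal entries.\<close>

lemma closedin_triangular: "closedin (zariski A) (triangular w)"
proof -
  define P where "P = (\<lambda>(m, p). (\<lambda>g. mat g p m - 0)) ` {(m, p) \<in> M \<times> M. wt w p \<le> wt w m \<and> p \<noteq> m}"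
  have "P \<subseteq> PF"
    by (auto simp only: P_def mat_diff_PF)
  moreover have "triangular w = {g \<in> Aut. \<forall>p\<in>P. p g = 0}"
  proof (intro equalityI subsetI)
    fix g assume "g \<in> triangular w"
    then obtain a where a: "g \<in> Aut" "raises w 1 a g"
      by (auto simp: triangular_def)
    have "mat g p m = 0" if "m \<in> M" "p \<in> M" "wt w p \<le> wt w m" "p \<noteq> m" for m p
      using raisesD[OF a(2), of m p] that by simp
    with a show "g \<in> {g \<in> Aut. \<forall>p\<in>P. p g = 0}"
      by (auto simp: P_def)
  next
    fix g assume g: "g \<in> {g \<in> Aut. \<forall>p\<in>P. p g = 0}"
    have "raises w 1 (\<lambda>m. mat g m m) g"
    proof (rule raisesI)
      fix m p assume "m \<in> M" "p \<in> M" "wt w p < wt w m + 1"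
      then show "mat g p m = (if p = m then mat g m m else 0)"
        using g by (force simp: P_def)
    qed
    with g show "g \<in> triangular w"
      by (auto simp: triangular_def)
  qed
  ultimately show ?thesis
    using closedin_zeros by simp
qed

subsection \<open>Triangularity is detected on the generators\<close>

definition higher :: "('n \<Rightarrow> nat) \<Rightarrow> nat \<Rightarrow> ('n, 'k) mpoly \<Rightarrow> bool" where
  "higher w d f \<longleftrightarrow> (\<forall>p\<in>M. lookup f p \<noteq> 0 \<longrightarrow> d \<le> wt w p)"

lemma higher_add: "higher w d f \<Longrightarrow> higher w d h \<Longrightarrow> higher w d (f + h)"
  unfolding higher_def lookup_add by (metis add.right_neutral)

lemma higher_mult:
  assumes "higher w d f" "higher w e h"
  shows "higher w (d + e) (f * h)"
  unfolding higher_def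
proof (intro ballI impI)
  fix p assume p: "p \<in> M" "lookup (f * h) p \<noteq> 0"
  then obtain x y where xy: "p = x + y" "x \<in> keys f" "y \<in> keys h"
    using keys_mult[of f h] by (auto simp: in_keys_iff)
  with p in_M_addD[of x y] assms show "d + e \<le> wt w p"
    by (auto simp: higher_def in_keys_iff add_mono)
qed

lemma higher_mono: "higher w d f \<Longrightarrow> e \<le> d \<Longrightarrow> higher w e f"
  by (auto simp: higher_def)

text \<open>Terms of lowest weight multiply: the error of a product is
  \<open>(h - h0) k + h0 (k - k0)\<close>, where \<open>h0\<close> and \<open>k0\<close> are the
  leading terms, and each summand has one factor of raised weight.\<close>

lemma raises_from_gens:
  assumes g: "g \<in> Aut"
    and gens: "\<And>i p. p \<in> M \<Longrightarrow> mat g p (unit_exp i) \<noteq> (if p = unit_exp i then a i else 0) \<Longrightarrow> w i < wt w p"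
  shows "raises w 1 (mon_val a) g"
proof -
  have lead: "\<exists>h. g (res (monomial m)) = res h \<and>
      higher w (wt w m + 1) (h - scalar (mon_val a m) * monomial m)" for m
  proof (induction m rule: exponent_induct)
    case zero
    show ?case
      by (rule exI[of _ 1]) (simp add: aut_one[OF g] higher_def)
  next
    case (add m i)
    then obtain h where h: "g (res (monomial m)) = res h"
      "higher w (wt w m + 1) (h - scalar (mon_val a m) * monomial m)"
      by blast
    obtain k where k: "g (gen i) = res k"
      by (rule aut_lift[OF g])
    have k2: "higher w (w i + 1) (k - scalar (a i) * monomial (unit_exp i))"
      unfolding higher_def
    proof (intro ballI impI)
      fix p assume p: "p \<in> M" "lookup (k - scalar (a i) * monomial (unit_exp i)) p \<noteq> 0"
      then have "mat g p (unit_exp i) \<noteq> (if p = unit_exp i then a i else 0)"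
        by (auto simp: mat_def k lookup_minus lookup_monomial)
      then show "w i + 1 \<le> wt w p"
        using gens[OF p(1)] by (simp add: Suc_le_eq flip: Suc_eq_plus1)
    qed
    have mono: "higher w (wt w m) (scalar c * monomial m)" for c m
      by (simp add: higher_def lookup_monomial)
    have k3: "higher w (w i) k"
      using higher_add[OF higher_mono[OF k2, of "w i"] mono[of "unit_exp i" "a i", simplified]] by simp
    have "g (res (monomial (m + unit_exp i))) = res (h * k)"
      by (simp add: monomial_add aut_mult[OF g] h k)
    moreover have "higher w (wt w (m + unit_exp i) + 1)
      (h * k - scalar (mon_val a (m + unit_exp i)) * monomial (m + unit_exp i))"
    proof -
      have "h * k - scalar (mon_val a (m + unit_exp i)) * monomial (m + unit_exp i)
        = (h - scalar (mon_val a m) * monomial m) * k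
          + scalar (mon_val a m) * monomial m * (k - scalar (a i) * monomial (unit_exp i))"
        by (simp add: scalar_mult monomial_add algebra_simps)
      moreover have "higher w (wt w (m + unit_exp i) + 1) ((h - scalar (mon_val a m) * monomial m) * k)"
        using higher_mult[OF h(2) k3] by (simp add: ac_simps)
      moreover have "higher w (wt w (m + unit_exp i) + 1)
          (scalar (mon_val a m) * monomial m * (k - scalar (a i) * monomial (unit_exp i)))"
        using higher_mult[OF mono k2] by (simp add: ac_simps)
      ultimately show ?thesis
        by (metis higher_add)
    qed
    ultimately show ?case
      by blast
  qed
  show ?thesis
  proof (rule raisesI)
    fix m p assume mp: "m \<in> M" "p \<in> M" "wt w p < wt w m + 1"
    obtain h where h: "g (res (monomial m)) = res h"
      "higher w (wt w m + 1) (h - scalar (mon_val a m) * monomial m)"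
      using lead by blast
    have "lookup (h - scalar (mon_val a m) * monomial m) p = 0"
      using h(2) mp unfolding higher_def by (meson leD)
    then show "mat g p m = (if p = m then mon_val a m else 0)"
      using mp by (simp add: mat_def h(1) lookup_minus lookup_monomial)
  qed
qed

subsection \<open>Commutators and unipotence\<close>

text \<open>If \<open>k\<close> is the commutator of \<open>g\<close> and \<open>h\<close>, then \<open>k - 1 = (gh - hg) (hg)\<^sup>-\<^sup>1\<close>.\<close>

lemma commutator_raises:
  assumes g: "g \<in> triangular w" and h: "h \<in> triangular w"
    and comm: "\<And>m p. m \<in> M \<Longrightarrow> p \<in> M \<Longrightarrow> mat (g \<otimes>\<^bsub>G\<^esub> h) p m \<noteq> mat (h \<otimes>\<^bsub>G\<^esub> g) p m \<Longrightarrow> wt w m + d \<le> wt w p"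
  shows "g \<otimes>\<^bsub>G\<^esub> h \<otimes>\<^bsub>G\<^esub> inv\<^bsub>G\<^esub> g \<otimes>\<^bsub>G\<^esub> inv\<^bsub>G\<^esub> h \<in> unitriangular w d"
proof -
  interpret T: subgroup "triangular w" G
    by (rule subgroup_triangular)
  have gh: "g \<in> Aut" "h \<in> Aut"
    using g h by (auto simp: triangular_def)
  define b where "b = inv\<^bsub>G\<^esub> (h \<otimes>\<^bsub>G\<^esub> g)"
  have "b \<in> triangular w"
    unfolding b_def using g h by blast
  then obtain c where b: "b \<in> Aut" "raises w 1 c b"
    by (auto simp: triangular_def)
  define k where "k = g \<otimes>\<^bsub>G\<^esub> h \<otimes>\<^bsub>G\<^esub> b"
  have k: "g \<otimes>\<^bsub>G\<^esub> h \<otimes>\<^bsub>G\<^esub> inv\<^bsub>G\<^esub> g \<otimes>\<^bsub>G\<^esub> inv\<^bsub>G\<^esub> h = k"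
    using gh by (simp add: k_def b_def G.inv_mult_group G.m_assoc)
  have "raises w d (\<lambda>_. 1) k"
    unfolding raises_def
  proof (intro ballI impI)
    fix m p assume mp: "m \<in> M" "p \<in> M" "mat k p m \<noteq> (if p = m then 1 else 0)"
    have "(if p = m then 1 else 0) = mat ((h \<otimes>\<^bsub>G\<^esub> g) \<otimes>\<^bsub>G\<^esub> b) p m"
      using gh mp G.r_inv[of "h \<otimes>\<^bsub>G\<^esub> g"] by (simp add: b_def mat_one)
    also have "\<dots> = (\<Sum>l\<in>M. mat (h \<otimes>\<^bsub>G\<^esub> g) p l * mat b l m)"
      using gh b mp by (intro mat_mult) auto
    finally have "(\<Sum>l\<in>M. mat (g \<otimes>\<^bsub>G\<^esub> h) p l * mat b l m) \<noteq> (\<Sum>l\<in>M. mat (h \<otimes>\<^bsub>G\<^esub> g) p l * mat b l m)"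
      using mp(3) mat_mult[of "g \<otimes>\<^bsub>G\<^esub> h" b p m] gh b mp(2) by (simp add: k_def)
    then obtain l where l: "l \<in> M" "mat (g \<otimes>\<^bsub>G\<^esub> h) p l * mat b l m \<noteq> mat (h \<otimes>\<^bsub>G\<^esub> g) p l * mat b l m"
      by (meson sum.cong)
    then have "wt w l + d \<le> wt w p"
      using comm[of l p] mp by auto
    moreover have "wt w m \<le> wt w l"
      using raisesD[OF b(2) mp(1) l(1)] l(2) by (cases "l = m") (auto simp: not_less[symmetric])
    ultimately show "wt w m + d \<le> wt w p"
      by simp
  qed
  then show ?thesis
    unfolding k unitriangular_def using gh b by (simp add: k_def)
qed

text \<open>Diagonal entries commute in the field, so \<open>g h\<close> and \<open>h g\<close>
  differ only in entries that raise the weight.\<close>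

lemma commutator_triangular:
  assumes "g \<in> triangular w" "h \<in> triangular w"
  shows "g \<otimes>\<^bsub>G\<^esub> h \<otimes>\<^bsub>G\<^esub> inv\<^bsub>G\<^esub> g \<otimes>\<^bsub>G\<^esub> inv\<^bsub>G\<^esub> h \<in> unitriangular w 1"
proof (rule commutator_raises[OF assms])
  obtain a b where a: "g \<in> Aut" "raises w 1 a g" and b: "h \<in> Aut" "raises w 1 b h"
    using assms by (auto simp: triangular_def)
  fix m p assume mp: "m \<in> M" "p \<in> M" "mat (g \<otimes>\<^bsub>G\<^esub> h) p m \<noteq> mat (h \<otimes>\<^bsub>G\<^esub> g) p m"
  show "wt w m + 1 \<le> wt w p"
    using raisesD[OF raises_mult[OF a b], of m p] raisesD[OF raises_mult[OF b a], of m p] mp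
    by (auto simp: not_less[symmetric] mult.commute split: if_splits)
qed

text \<open>Write \<open>g = 1 + x\<close> and \<open>h = 1 + y\<close>; then
  \<open>g h - h g = x y - y x\<close>, and each of these products raises the weight by
  \<open>d + d\<close>.\<close>

lemma commutator_unitriangular:
  assumes d: "d > 0" and gh: "g \<in> unitriangular w d" "h \<in> unitriangular w d"
  shows "g \<otimes>\<^bsub>G\<^esub> h \<otimes>\<^bsub>G\<^esub> inv\<^bsub>G\<^esub> g \<otimes>\<^bsub>G\<^esub> inv\<^bsub>G\<^esub> h \<in> unitriangular w (d + d)"
proof (rule commutator_raises)
  show "g \<in> triangular w" "h \<in> triangular w"
    using gh d unitriangular_mono[of 1 d w] unitriangular_subset_triangular[of w]
    by (auto simp: Suc_le_eq One_nat_def)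
  have g: "g \<in> Aut" "raises w d (\<lambda>_. 1) g" and h: "h \<in> Aut" "raises w d (\<lambda>_. 1) h"
    using gh by (auto simp: unitriangular_def)
  define \<delta> :: "('n \<Rightarrow>\<^sub>0 nat) \<Rightarrow> ('n \<Rightarrow>\<^sub>0 nat) \<Rightarrow> 'k" where "\<delta> p m = (if p = m then 1 else 0)" for p m
  have expand: "mat (x \<otimes>\<^bsub>G\<^esub> y) p m
      = (\<Sum>l\<in>M. (mat x p l - \<delta> p l) * (mat y l m - \<delta> l m)) + mat x p m + mat y p m - \<delta> p m"
    if "x \<in> Aut" "y \<in> Aut" "p \<in> M" "m \<in> M" for x y p m
  proof -
    have 1: "(\<Sum>l\<in>M. mat x p l * \<delta> l m) = mat x p m" "(\<Sum>l\<in>M. \<delta> p l * mat y l m) = mat y p m"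
      "(\<Sum>l\<in>M. \<delta> p l * \<delta> l m) = \<delta> p m"
      using that(3,4) by (simp_all add: \<delta>_def if_distrib[of "(*) _"] if_distrib[of "\<lambda>x. x * _"] cong: if_cong)
    have "(\<Sum>l\<in>M. (mat x p l - \<delta> p l) * (mat y l m - \<delta> l m))
        = (\<Sum>l\<in>M. mat x p l * mat y l m) - (\<Sum>l\<in>M. mat x p l * \<delta> l m) - (\<Sum>l\<in>M. \<delta> p l * mat y l m)
          + (\<Sum>l\<in>M. \<delta> p l * \<delta> l m)"
      by (simp add: algebra_simps sum.distrib sum_subtractf)
    then show ?thesis
      unfolding 1 by (simp add: mat_mult[OF that(1,2,3)])
  qed
  have zero: "(\<Sum>l\<in>M. (mat x p l - \<delta> p l) * (mat y l m - \<delta> l m)) = 0"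
    if x: "raises w d (\<lambda>_. 1) x" and y: "raises w d (\<lambda>_. 1) y"
      and mp: "p \<in> M" "m \<in> M" "wt w p < wt w m + (d + d)" for x y p m
  proof (rule sum.neutral, rule ballI)
    fix l assume l: "l \<in> M"
    show "(mat x p l - \<delta> p l) * (mat y l m - \<delta> l m) = 0"
      using raisesD[OF x l mp(1)] raisesD[OF y mp(2) l] mp(3)
      by (cases "wt w l < wt w m + d") (auto simp: \<delta>_def)
  qed
  fix m p assume mp: "m \<in> M" "p \<in> M" "mat (g \<otimes>\<^bsub>G\<^esub> h) p m \<noteq> mat (h \<otimes>\<^bsub>G\<^esub> g) p m"
  show "wt w m + (d + d) \<le> wt w p"
  proof (rule ccontr)
    assume "\<not> wt w m + (d + d) \<le> wt w p"
    then have *: "wt w p < wt w m + (d + d)"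
      by simp
    show False
      using mp(3) unfolding expand[OF g(1) h(1) mp(2,1)] expand[OF h(1) g(1) mp(2,1)]
        zero[OF g(2) h(2) mp(2,1) *] zero[OF h(2) g(2) mp(2,1) *] by simp
  qed
qed

lemma unitriangular_trivial:
  assumes "\<And>m. m \<in> M \<Longrightarrow> wt w m < d"
  shows "unitriangular w d \<subseteq> {\<one>\<^bsub>G\<^esub>}"
proof
  fix g assume "g \<in> unitriangular w d"
  then have g: "g \<in> Aut" "raises w d (\<lambda>_. 1) g"
    by (auto simp: unitriangular_def)
  have "g = \<one>\<^bsub>G\<^esub>"
  proof (rule aut_eqI_mat[OF g(1) one_in_Aut])
    fix m p assume "m \<in> M" "p \<in> M"
    then show "mat g p m = mat \<one>\<^bsub>G\<^esub> p m"
      using raisesD[OF g(2), of m p] assms[of p] by (simp add: mat_one trans_less_add2)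
  qed
  then show "g \<in> {\<one>\<^bsub>G\<^esub>}"
    by simp
qed

lemma coord_minus: "x \<in> carrier A \<Longrightarrow> y \<in> carrier A \<Longrightarrow> p \<in> M \<Longrightarrow> coord p (x \<ominus>\<^bsub>A\<^esub> y) = coord p x - coord p y"
  by (elim carrierE) (simp add: lookup_minus)

lemma closed_minus: "x \<in> carrier A \<Longrightarrow> y \<in> carrier A \<Longrightarrow> x \<ominus>\<^bsub>A\<^esub> y \<in> carrier A"
  by (elim carrierE) simp

text \<open>Each application of \<open>g - 1\<close> raises the weight by at least 1, and weights on
  \<open>M\<close> are bounded by \<open>N - 1\<close>.\<close>

lemma unipotent_unitriangular:
  assumes "g \<in> unitriangular w 1"
  shows "unipotent A g"
proof -
  have g: "g \<in> Aut" "raises w 1 (\<lambda>_. 1) g"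
    using assms by (auto simp: unitriangular_def)
  define F where "F = (\<lambda>y. g y \<ominus>\<^bsub>A\<^esub> y)"
  define N where "N = Max (wt w ` M) + 1"
  have N: "wt w m < N" if "m \<in> M" for m
    using that by (simp add: N_def less_Suc_eq_le flip: Suc_eq_plus1)
  have closed: "(F ^^ n) x \<in> carrier A" if "x \<in> carrier A" for n x
    using that by (induction n) (simp_all add: F_def closed_minus aut_carrier[OF g(1)])
  have "n \<le> wt w p" if "x \<in> carrier A" "p \<in> M" "coord p ((F ^^ n) x) \<noteq> 0" for n p x
    using that
  proof (induction n arbitrary: p)
    case (Suc n)
    define y where "y = (F ^^ n) x"
    have y: "y \<in> carrier A"
      using closed Suc.prems by (simp add: y_def)
    have "coord p (F y) = (\<Sum>m\<in>M. coord m y * mat g p m) - coord p y"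
      by (simp add: F_def coord_minus aut_carrier g y Suc.prems coord_aut)
    also have "coord p y = (\<Sum>m\<in>M. coord m y * (if p = m then 1 else 0))"
      using Suc.prems by (simp add: if_distrib[of "(*) _"] cong: if_cong)
    finally have "(\<Sum>m\<in>M. coord m y * (mat g p m - (if p = m then 1 else 0))) \<noteq> 0"
      using Suc.prems(3) by (simp add: y_def right_diff_distrib sum_subtractf)
    then obtain m where m: "m \<in> M" "coord m y * (mat g p m - (if p = m then 1 else 0)) \<noteq> 0"
      by (meson sum.neutral)
    then have "n \<le> wt w m"
      using Suc.IH[of m] Suc.prems by (auto simp: y_def)
    moreover have "wt w m + 1 \<le> wt w p"
      using raisesD[OF g(2) m(1) Suc.prems(2)] m(2) by (auto simp: not_less[symmetric])
    ultimately show ?case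
      by simp
  qed simp
  then have "coord p ((F ^^ N) x) = 0" if "x \<in> carrier A" "p \<in> M" for p x
    using that N[of p] by (meson leD)
  then have "(F ^^ N) x = \<zero>\<^bsub>A\<^esub>" if "x \<in> carrier A" for x
    using that closed by (intro coord_eqI) (simp_all add: zero_A)
  then show ?thesis
    unfolding unipotent_def F_def by blast
qed

text \<open>In the lowest weight, \<open>(g - 1)^n\<close> multiplies \<open>x^m\<close> by
  \<open>(a m - 1)^n\<close>. Nilpotency therefore forces \<open>a m = 1\<close>.\<close>

lemma unipotent_triangular:
  assumes g: "g \<in> triangular w" and uni: "unipotent A g"
  shows "g \<in> unitriangular w 1"
proof -
  obtain a where a: "g \<in> Aut" "raises w 1 a g"
    using g by (auto simp: triangular_def)
  define F where "F = (\<lambda>y. g y \<ominus>\<^bsub>A\<^esub> y)"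
  have closed: "(F ^^ n) x \<in> carrier A" if "x \<in> carrier A" for n x
    using that by (induction n) (simp_all add: F_def closed_minus aut_carrier[OF a(1)])
  have lead: "coord p ((F ^^ n) (res (monomial m))) = (if p = m then (a m - 1) ^ n else 0)"
    if "m \<in> M" "p \<in> M" "wt w p < wt w m + 1" for m n p
    using that
  proof (induction n arbitrary: p)
    case 0
    then show ?case
      by (simp add: lookup_monomial)
  next
    case (Suc n)
    define y where "y = (F ^^ n) (res (monomial m))"
    have y: "y \<in> carrier A"
      using closed by (simp add: y_def)
    have "coord l y * mat g p l = (if l = m then (if p = m then (a m - 1) ^ n * a m else 0) else 0)"
      if l: "l \<in> M" for l
    proof (cases "wt w l < wt w m + 1")
      case True
      then show ?thesis
        using Suc.IH[of l] raisesD[OF a(2) _ Suc.prems(2), of m] Suc.prems l by (auto simp: y_def)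
    next
      case False
      then have "p \<noteq> l" "wt w p < wt w l + 1" "l \<noteq> m"
        using Suc.prems by auto
      then show ?thesis
        using raisesD[OF a(2) l Suc.prems(2)] by simp
    qed
    then have "(\<Sum>l\<in>M. coord l y * mat g p l)
        = (\<Sum>l\<in>M. if l = m then (if p = m then (a m - 1) ^ n * a m else 0) else 0)"
      by (rule sum.cong[OF refl])
    moreover have "coord p (F y) = (\<Sum>m\<in>M. coord m y * mat g p m) - coord p y"
      by (simp add: F_def coord_minus aut_carrier a y Suc.prems coord_aut)
    moreover have "coord p y = (if p = m then (a m - 1) ^ n else 0)"
      using Suc by (simp add: y_def)
    ultimately have "coord p (F y) = (if p = m then (a m - 1) ^ n * a m - (a m - 1) ^ n else 0)"
      using Suc.prems by simp
    then show ?case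
      by (simp add: y_def left_diff_distrib mult.commute)
  qed
  obtain N where N: "(F ^^ N) x = \<zero>\<^bsub>A\<^esub>" if "x \<in> carrier A" for x
    using uni unfolding unipotent_def F_def by blast
  have "a m = 1" if "m \<in> M" for m
    using lead[of m m N] N[of "res (monomial m)"] that by (simp add: zero_A)
  then have "raises w 1 (\<lambda>_. 1) g"
    using raisesD[OF a(2)] by (intro raisesI) simp
  with a(1) show ?thesis
    by (simp add: unitriangular_def)
qed

section \<open>The torus and contractions\<close>

definition torus_aut :: "('n \<Rightarrow> 'k) \<Rightarrow> ('n, 'k) mpoly set \<Rightarrow> ('n, 'k) mpoly set" where
  "torus_aut a = induced (lin_ext (\<lambda>m. scalar (mon_val a m) * monomial m))"

lemma res_monomial_neq_0:
  assumes "m \<in> M"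
  shows "res (monomial m) \<noteq> res 0"
proof
  assume "res (monomial m) = res 0"
  then have "\<forall>p\<in>M. lookup (monomial m :: ('n, 'k) mpoly) p = lookup (0 :: ('n, 'k) mpoly) p"
    by (simp only: res_eq_iff)
  from bspec[OF this assms] show False
    by (simp add: lookup_monomial)
qed

lemma monomial_in_I: "m \<notin> M \<Longrightarrow> f * monomial m \<in> I"
  by (rule mult_I) (simp add: M_def supp_def)

lemma torus_aut_apply: "torus_aut a (res f) = res (lin_ext (\<lambda>m. scalar (mon_val a m) * monomial m) f)"
  unfolding torus_aut_def by (rule induced_lin_ext) (rule monomial_in_I)

lemma torus_aut_monomial [simp]:
  "torus_aut a (res (monomial m)) = res (scalar (mon_val a m) * monomial m)"
  by (simp add: torus_aut_apply)

lemma torus_aut_in_Aut: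
  assumes "\<And>i. a i \<noteq> 0"
  shows "torus_aut a \<in> Aut"
  unfolding torus_aut_def
proof (rule induced_in_alg_auts)
  have "mon_val a m * mon_val (\<lambda>i. inverse (a i)) m = 1" for m
    using mon_val_mult[of a "\<lambda>i. inverse (a i)" m] assms by simp
  then have inv: "scalar (mon_val a m) * (scalar (mon_val (\<lambda>i. inverse (a i)) m) * monomial m) = monomial m" for m
    by (simp add: mult.assoc[symmetric] scalar_mult[symmetric])
  show "lin_ext (\<lambda>m. scalar (mon_val a m) * monomial m) (scalar (mon_val (\<lambda>i. inverse (a i)) m) * monomial m) = monomial m" for m
    using inv by (simp only: lin_ext_scale lin_ext_monomial mult.left_commute)
  show "lin_ext (\<lambda>m. scalar (mon_val (\<lambda>i. inverse (a i)) m) * monomial m) (scalar (mon_val a m) * monomial m) = monomial m" for m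
    using inv by (simp only: lin_ext_scale lin_ext_monomial)
qed ((rule monomial_in_I, assumption) | simp add: scalar_mult monomial_add ac_simps)+

lemma mat_torus_aut:
  assumes "p \<in> M"
  shows "mat (torus_aut a) p m = (if p = m then mon_val a m else 0)"
  using assms by (simp add: mat_def lookup_monomial)

lemma raises_torus_aut: "raises w d (mon_val a) (torus_aut a)"
  by (rule raisesI) (simp add: mat_torus_aut)

lemma torus_aut_mult:
  assumes "\<And>i. a i \<noteq> 0" "\<And>i. b i \<noteq> 0"
  shows "torus_aut a \<otimes>\<^bsub>G\<^esub> torus_aut b = torus_aut (\<lambda>i. a i * b i)"
proof (rule aut_eqI_gen)
  show "torus_aut a \<otimes>\<^bsub>G\<^esub> torus_aut b \<in> Aut" "torus_aut (\<lambda>i. a i * b i) \<in> Aut"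
    using assms by (simp_all add: torus_aut_in_Aut)
  show "(torus_aut a \<otimes>\<^bsub>G\<^esub> torus_aut b) (gen i) = torus_aut (\<lambda>i. a i * b i) (gen i)" for i
    using assms by (simp add: mult_G_apply torus_aut_in_Aut aut_scale res_eq_iff mult.left_commute mult.assoc)
qed

lemma torus_aut_one: "torus_aut (\<lambda>i. 1) = \<one>\<^bsub>G\<^esub>"
  by (rule aut_eqI_gen) (simp_all add: torus_aut_in_Aut one_G_apply)

lemma torus_aut_inv:
  assumes "\<And>i. a i \<noteq> 0"
  shows "inv\<^bsub>G\<^esub> (torus_aut a) = torus_aut (\<lambda>i. inverse (a i))"
  using torus_aut_mult[of "\<lambda>i. inverse (a i)" a] assms
  by (intro G.inv_equality) (simp_all add: torus_aut_in_Aut torus_aut_one)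

text \<open>A character of the lattice acts on monomials through its values on the unit vectors;
  conversely \<open>powi\<close> extends any nonzero values to negative exponents.\<close>

lemma torus_eq: "torus I = {torus_aut a | a. \<forall>i. a i \<noteq> 0}"
proof (intro equalityI subsetI)
  fix g assume "g \<in> torus I"
  then obtain t :: "('n \<Rightarrow>\<^sub>0 int) \<Rightarrow> 'k" where g: "g \<in> Aut"
    and t: "\<And>a. t a \<noteq> 0" "\<And>m. g (res (monomial m)) = t (Poly_Mapping.map int m) \<odot>\<^bsub>A\<^esub> res (monomial m)"
    unfolding torus_def by blast
  define a where "a i = t (Poly_Mapping.map int (unit_exp i))" for i
  have "g = torus_aut a"
    by (rule aut_eqI_gen[OF g]) (simp_all add: torus_aut_in_Aut a_def t)
  then show "g \<in> {torus_aut a | a. \<forall>i. a i \<noteq> 0}"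
    using t(1) by (auto simp: a_def)
next
  fix g assume "g \<in> {torus_aut a | a. \<forall>i. a i \<noteq> 0}"
  then obtain a where a: "g = torus_aut a" "\<And>i. a i \<noteq> 0"
    by blast
  define t where "t v = (\<Prod>i\<in>UNIV. a i powi lookup v i)" for v :: "'n \<Rightarrow>\<^sub>0 int"
  have "t (Poly_Mapping.map int m) = mon_val a m" for m
    by (simp add: t_def mon_val_def Poly_Mapping.map.rep_eq when_def) (rule prod.cong, simp_all)
  then have "\<forall>m. g (res (monomial m)) = t (Poly_Mapping.map int m) \<odot>\<^bsub>A\<^esub> res (monomial m)"
    by (simp add: a(1))
  moreover have "\<forall>v. t v \<noteq> 0" "\<forall>u v. t (u + v) = t u * t v"
    using a(2) by (simp_all add: t_def lookup_add power_int_add prod.distrib)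
  moreover have "g \<in> Aut"
    using a by (simp add: torus_aut_in_Aut)
  ultimately show "g \<in> torus I"
    unfolding torus_def by blast
qed

lemma torusE:
  assumes "g \<in> torus I"
  obtains a where "g = torus_aut a" "\<And>i. a i \<noteq> 0"
  using assms unfolding torus_eq by blast

lemma torus_subset_triangular: "torus I \<subseteq> triangular w"
  using raises_torus_aut[of w 1] torus_aut_in_Aut by (auto simp: torus_eq triangular_def)

lemma torus_commute:
  assumes "s \<in> torus I" "t \<in> torus I"
  shows "s \<otimes>\<^bsub>G\<^esub> t = t \<otimes>\<^bsub>G\<^esub> s"
  using assms by (auto simp: torus_eq torus_aut_mult mult.commute)

lemma subgroup_torus: "subgroup (torus I) G"
proof (rule G.subgroupI)
  show "torus I \<subseteq> carrier G"
    using torus_aut_in_Aut by (auto simp: torus_eq)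
  show "torus I \<noteq> {}"
    by (auto simp: torus_eq intro: exI[of _ "\<lambda>i. 1"])
  show "inv\<^bsub>G\<^esub> g \<in> torus I" if g: "g \<in> torus I" for g
  proof -
    obtain a where a: "g = torus_aut a" "\<And>i. a i \<noteq> 0"
      using g by (rule torusE) blast
    then show ?thesis
      unfolding torus_eq by (intro CollectI exI[of _ "\<lambda>i. inverse (a i)"]) (simp add: torus_aut_inv)
  qed
  show "g \<otimes>\<^bsub>G\<^esub> h \<in> torus I" if g: "g \<in> torus I" and h: "h \<in> torus I" for g h
  proof -
    obtain a where a: "g = torus_aut a" "\<And>i. a i \<noteq> 0"
      using g by (rule torusE) blast
    obtain b where b: "h = torus_aut b" "\<And>i. b i \<noteq> 0"
      using h by (rule torusE) blast
    with a show ?thesis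
      unfolding torus_eq by (intro CollectI exI[of _ "\<lambda>i. a i * b i"]) (simp add: torus_aut_mult)
  qed
qed

text \<open>Being diagonal on the variables is enough, since the variables generate the algebra, and
  the scalars are nonzero by injectivity.\<close>

lemma closedin_torus: "closedin (zariski A) (torus I)"
proof -
  define P where "P = (\<lambda>(i, p). (\<lambda>g. mat g p (unit_exp i) - 0)) ` {(i, p). p \<in> M \<and> p \<noteq> unit_exp i}"
  have "P \<subseteq> PF"
    by (auto simp only: P_def mat_diff_PF)
  moreover have "torus I = {g \<in> Aut. \<forall>p\<in>P. p g = 0}"
  proof (intro equalityI subsetI)
    fix g assume "g \<in> torus I"
    then show "g \<in> {g \<in> Aut. \<forall>p\<in>P. p g = 0}"
      using torus_aut_in_Aut by (auto simp: torus_eq P_def mat_torus_aut)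
  next
    fix g assume g: "g \<in> {g \<in> Aut. \<forall>p\<in>P. p g = 0}"
    define a where "a i = mat g (unit_exp i) (unit_exp i)" for i
    have zero: "mat g p (unit_exp i) = 0" if "p \<in> M" "p \<noteq> unit_exp i" for p i
      using g that by (force simp: P_def)
    have ga: "g (gen i) = torus_aut a (gen i)" for i
    proof (rule coord_eqI)
      fix p assume "p \<in> M"
      then show "coord p (g (gen i)) = coord p (torus_aut a (gen i))"
        using zero[of p i] mat_torus_aut[of p a "unit_exp i"] by (auto simp: a_def mat_def)
    qed (use g in \<open>auto simp: aut_carrier\<close>)
    have gA: "g \<in> Aut"
      using g by blast
    have "a i \<noteq> 0" for i
    proof
      assume "a i = 0"
      then have eq: "g (gen i) = g (res 0)"
        by (simp add: ga aut_zero[OF gA])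
      have "gen i = (inv\<^bsub>G\<^esub> g) (g (gen i))"
        by (simp only: inv_G_apply(1)[OF gA] res_in_carrier)
      also have "\<dots> = res 0"
        unfolding eq by (simp only: inv_G_apply(1)[OF gA] res_in_carrier)
      finally show False
        using res_monomial_neq_0[OF unit_exp_in_M] by simp
    qed
    moreover from this have "g = torus_aut a"
      using g ga by (intro aut_eqI_gen) (simp_all add: torus_aut_in_Aut)
    ultimately show "g \<in> torus I"
      by (auto simp: torus_eq)
  qed
  ultimately show ?thesis
    using closedin_zeros by simp
qed

section \<open>Connectedness of the torus and of the unitriangular group\<close>

lemma connectedin_star:
  assumes "\<And>g. g \<in> S \<Longrightarrow> \<exists>C. C \<subseteq> S \<and> connectedin (zariski A) C \<and> x \<in> C \<and> g \<in> C"
  shows "connectedin (zariski A) S"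
proof (cases "S = {}")
  case False
  define \<C> where "\<C> = {C. C \<subseteq> S \<and> connectedin (zariski A) C \<and> x \<in> C}"
  have "connectedin (zariski A) (\<Union>\<C>)"
    by (rule connectedin_Union) (auto simp: \<C>_def)
  moreover have "\<Union>\<C> = S"
    using assms by (fastforce simp: \<C>_def)
  ultimately show ?thesis
    by simp
qed simp

lemma torus_aut_curve:
  assumes "\<And>i. a i \<noteq> 0"
  shows "\<exists>C. C \<subseteq> torus I \<and> connectedin (zariski A) C \<and> \<one>\<^bsub>G\<^esub> \<in> C \<and> torus_aut a \<in> C"
proof -
  \<comment> \<open>The line with value \<open>1\<close> at \<open>s = 0\<close> and
    \<open>a\<close> at \<open>s = 1\<close>; the finitely many parameters where a coordinate
    vanishes are removed from it.\<close>
  define b where "b s i = 1 + s * (a i - 1)" for s i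
  define S where "S = {s. \<forall>i. b s i \<noteq> 0}"
  define \<gamma> where "\<gamma> s = torus_aut (b s)" for s
  have "finite {s. b s i = 0}" for i
  proof -
    have "{s. b s i = 0} = {s. poly [:1, a i - 1:] s = 0}"
      by (simp add: b_def)
    then show ?thesis
      by (simp add: poly_roots_finite del: poly_pCons)
  qed
  then have "finite (\<Union>i\<in>UNIV. {s. b s i = 0})"
    by simp
  moreover have "- S = (\<Union>i\<in>UNIV. {s. b s i = 0})"
    by (auto simp: S_def)
  ultimately have S: "infinite S"
    by (metis finite_compl infinite_UNIV_char_0)
  have "connectedin (zariski A) (\<gamma> ` S)"
  proof (rule connectedin_curve[OF S])
    show "\<gamma> s \<in> Aut" if "s \<in> S" for s
      using that by (simp add: S_def \<gamma>_def torus_aut_in_Aut)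
    fix m p assume p: "p \<in> M"
    show "\<exists>P. \<forall>s\<in>S. mat (\<gamma> s) p m = poly P s"
      by (rule exI[of _ "if p = m then \<Prod>i\<in>UNIV. [:1, a i - 1:] ^ lookup m i else 0"])
        (simp add: \<gamma>_def mat_torus_aut[OF p] mon_val_def b_def poly_prod)
  qed
  moreover have "b 0 = (\<lambda>i. 1)" "b 1 = a"
    by (simp_all add: b_def fun_eq_iff)
  then have "\<one>\<^bsub>G\<^esub> = \<gamma> 0" "torus_aut a = \<gamma> 1" "0 \<in> S" "1 \<in> S"
    using assms by (simp_all add: \<gamma>_def S_def torus_aut_one)
  moreover have "\<gamma> ` S \<subseteq> torus I"
    by (auto simp: \<gamma>_def S_def torus_eq)
  ultimately show ?thesis
    by blast
qed

lemma connectedin_torus: "connectedin (zariski A) (torus I)"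
proof (rule connectedin_star)
  fix g assume "g \<in> torus I"
  then show "\<exists>C. C \<subseteq> torus I \<and> connectedin (zariski A) C \<and> \<one>\<^bsub>G\<^esub> \<in> C \<and> g \<in> C"
    using torus_aut_curve by (auto simp: torus_eq)
qed

lemma torus_subset_IC: "torus I \<subseteq> IC"
  by (rule connectedin_subset_IC[OF connectedin_torus]) (rule subgroup.one_closed[OF subgroup_torus])

text \<open>Conjugation with the one-parameter subgroup given by the weight contracts \<open>u\<close> to the identity.\<close>

lemma unitriangular_curve:
  assumes u: "u \<in> unitriangular w 1"
  shows "\<exists>C. C \<subseteq> unitriangular w 1 \<and> connectedin (zariski A) C \<and> \<one>\<^bsub>G\<^esub> \<in> C \<and> u \<in> C"
proof -
  have uA: "u \<in> Aut" "raises w 1 (\<lambda>_. 1) u"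
    using u by (auto simp: unitriangular_def)
  \<comment> \<open>Conjugation multiplies the entry \<open>(p, m)\<close> by
    \<open>s^(wt p - wt m)\<close>. The exponent is positive for each nonzero off-diagonal entry of
    \<open>u\<close>, so the entries are polynomials in \<open>s\<close> and the value filled in at
    \<open>s = 0\<close> is the identity.\<close>
  define \<gamma> where "\<gamma> s = (if s = 0 then \<one>\<^bsub>G\<^esub> else
      torus_aut (\<lambda>i. s ^ w i) \<otimes>\<^bsub>G\<^esub> u \<otimes>\<^bsub>G\<^esub> torus_aut (\<lambda>i. inverse s ^ w i))" for s :: 'k
  have \<gamma>: "\<gamma> s \<in> Aut" for s
    using uA by (simp add: \<gamma>_def torus_aut_in_Aut)
  have mat: "mat (\<gamma> s) p m = s ^ wt w p * mat u p m * inverse s ^ wt w m" if "p \<in> M" "m \<in> M" "s \<noteq> 0" for s p m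
  proof -
    have "mat (\<gamma> s) p m = (\<Sum>l\<in>M. mat (torus_aut (\<lambda>i. s ^ w i) \<otimes>\<^bsub>G\<^esub> u) p l * mat (torus_aut (\<lambda>i. inverse s ^ w i)) l m)"
      using that uA by (simp add: \<gamma>_def mat_mult torus_aut_in_Aut)
    also have "\<dots> = (\<Sum>l\<in>M. if l = m then mat (torus_aut (\<lambda>i. s ^ w i) \<otimes>\<^bsub>G\<^esub> u) p m * inverse s ^ wt w m else 0)"
      by (rule sum.cong) (simp_all add: mat_torus_aut mon_val_power)
    also have "\<dots> = mat (torus_aut (\<lambda>i. s ^ w i) \<otimes>\<^bsub>G\<^esub> u) p m * inverse s ^ wt w m"
      using that by simp
    also have "mat (torus_aut (\<lambda>i. s ^ w i) \<otimes>\<^bsub>G\<^esub> u) p m = (\<Sum>l\<in>M. mat (torus_aut (\<lambda>i. s ^ w i)) p l * mat u l m)"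
      using that uA by (simp add: mat_mult torus_aut_in_Aut)
    also have "\<dots> = (\<Sum>l\<in>M. if p = l then s ^ wt w p * mat u p m else 0)"
      by (rule sum.cong) (use that in \<open>simp_all add: mat_torus_aut mon_val_power\<close>)
    also have "\<dots> = s ^ wt w p * mat u p m"
      using that by simp
    finally show ?thesis .
  qed
  have mat0: "mat (\<gamma> 0) p m = (if p = m then 1 else 0)" if "p \<in> M" for p m
    using that by (simp add: \<gamma>_def mat_one)
  have raises: "raises w 1 (\<lambda>_. 1) (\<gamma> s)" for s
  proof (rule raisesI)
    fix m p assume mp: "m \<in> M" "p \<in> M" "wt w p < wt w m + 1"
    show "mat (\<gamma> s) p m = (if p = m then 1 else 0)"
      using raisesD[OF uA(2) mp] mat[OF mp(2,1), of s] mat0[OF mp(2), of m]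
      by (cases "s = 0") (auto simp flip: power_mult_distrib)
  qed
  have "connectedin (zariski A) (\<gamma> ` UNIV)"
  proof (rule connectedin_curve)
    show "infinite (UNIV :: 'k set)"
      by (rule infinite_UNIV_char_0)
    show "\<gamma> s \<in> Aut" for s
      by (rule \<gamma>)
    fix m p assume mp: "m \<in> M" "p \<in> M"
    show "\<exists>P. \<forall>s\<in>UNIV. mat (\<gamma> s) p m = poly P s"
    proof (cases "wt w p < wt w m + 1")
      case True
      then have "mat (\<gamma> s) p m = (if p = m then 1 else 0)" for s
        using raisesD[OF raises mp] by simp
      then show ?thesis
        by (intro exI[of _ "if p = m then 1 else 0"]) simp
    next
      case False
      then obtain k where k: "wt w p = wt w m + Suc k"
        by (metis One_nat_def add_Suc_right le_add_diff_inverse not_less_eq_eq not_le less_iff_Suc_add add.right_neutral)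
      have "mat (\<gamma> s) p m = poly (Polynomial.monom (mat u p m) (Suc k)) s" for s
      proof (cases "s = 0")
        case True
        have "p \<noteq> m"
          using k by auto
        then show ?thesis
          using mat0[OF mp(2), of m] True by (simp add: poly_monom)
      next
        case False
        then have "s ^ wt w m * inverse s ^ wt w m = 1"
          by (simp flip: power_mult_distrib)
        then show ?thesis
          using mat[OF mp(2,1) False] by (simp add: poly_monom k power_add ac_simps)
      qed
      then show ?thesis
        by blast
    qed
  qed
  moreover have "\<one>\<^bsub>G\<^esub> = \<gamma> 0" "u = \<gamma> 1"
    using uA by (simp_all add: \<gamma>_def torus_aut_one)
  moreover have "\<gamma> ` UNIV \<subseteq> unitriangular w 1"
    using \<gamma> raises by (auto simp: unitriangular_def)
  ultimately show ?thesis
    by blast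
qed

lemma connectedin_unitriangular: "connectedin (zariski A) (unitriangular w 1)"
  by (rule connectedin_star[of _ "\<one>\<^bsub>G\<^esub>"]) (rule unitriangular_curve)

lemma unitriangular_subset_IC: "unitriangular w 1 \<subseteq> IC"
proof (rule connectedin_subset_IC[OF connectedin_unitriangular])
  interpret U: subgroup "unitriangular w 1" G
    by (rule subgroup_unitriangular) simp
  show "\<one>\<^bsub>G\<^esub> \<in> unitriangular w 1"
    by (rule U.one_closed)
qed

subsection \<open>Semidirect product decomposition of the triangular group\<close>

text \<open>By multiplicativity the diagonal of \<open>g\<close> is determined by its entries on the
  variables, which makes it a torus element; dividing by it leaves a unitriangular factor.\<close>

lemma triangular_decompose:
  assumes g: "g \<in> triangular w"
  obtains t u where "t \<in> torus I" "u \<in> unitriangular w 1" "g = t \<otimes>\<^bsub>G\<^esub> u"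
proof -
  obtain a where a: "g \<in> Aut" "raises w 1 a g"
    using g by (auto simp: triangular_def)
  define b where "b i = a (unit_exp i)" for i
  have b: "b i \<noteq> 0" for i
    using raises_inv(2)[OF a, of "unit_exp i"] by (simp add: b_def)
  have "raises w 1 (mon_val b) g"
  proof (rule raises_from_gens[OF a(1)])
    fix i p assume p: "p \<in> M" "mat g p (unit_exp i) \<noteq> (if p = unit_exp i then b i else 0)"
    then show "w i < wt w p"
      using a(2) unit_exp_in_M[of i] unfolding raises_def b_def by (force simp: Suc_le_eq)
  qed
  then have "raises w 1 (\<lambda>m. mon_val (\<lambda>i. inverse (b i)) m * mon_val b m) (torus_aut (\<lambda>i. inverse (b i)) \<otimes>\<^bsub>G\<^esub> g)"
    using a(1) b by (intro raises_mult raises_torus_aut) (simp_all add: torus_aut_in_Aut)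
  moreover have "mon_val (\<lambda>i. inverse (b i)) m * mon_val b m = 1" for m
    using mon_val_mult[of "\<lambda>i. inverse (b i)" b m] b by simp
  ultimately have "inv\<^bsub>G\<^esub> (torus_aut b) \<otimes>\<^bsub>G\<^esub> g \<in> unitriangular w 1"
    using a(1) b by (simp add: unitriangular_def torus_aut_inv torus_aut_in_Aut)
  moreover have "g = torus_aut b \<otimes>\<^bsub>G\<^esub> (inv\<^bsub>G\<^esub> (torus_aut b) \<otimes>\<^bsub>G\<^esub> g)"
    using a(1) b by (simp add: torus_aut_in_Aut flip: G.m_assoc)
  moreover have "torus_aut b \<in> torus I"
    using b by (auto simp: torus_eq)
  ultimately show ?thesis
    using that by blast
qed

lemma triangular_subset_IC: "triangular w \<subseteq> IC"
proof
  fix g assume "g \<in> triangular w"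
  then obtain t u where "t \<in> torus I" "u \<in> unitriangular w 1" "g = t \<otimes>\<^bsub>G\<^esub> u"
    by (rule triangular_decompose)
  then show "g \<in> IC"
    using torus_subset_IC unitriangular_subset_IC subgroup.m_closed[OF subgroup_IC] by blast
qed

lemma torus_Int_unitriangular: "torus I \<inter> unitriangular w 1 \<subseteq> {\<one>\<^bsub>G\<^esub>}"
proof
  fix g assume g: "g \<in> torus I \<inter> unitriangular w 1"
  then obtain a where a: "g = torus_aut a" "\<And>i. a i \<noteq> 0"
    by (auto simp: torus_eq)
  have "raises w 1 (\<lambda>_. 1) g"
    using g by (simp add: unitriangular_def)
  then have "a i = 1" for i
    using raisesD[of w 1 "\<lambda>_. 1" g "unit_exp i" "unit_exp i"] by (simp add: a mat_torus_aut)
  then have "a = (\<lambda>_. 1)"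
    by auto
  then show "g \<in> {\<one>\<^bsub>G\<^esub>}"
    by (simp add: a torus_aut_one)
qed

section \<open>The action on the cotangent space\<close>

text \<open>On the finite set \<open>M\<close> the exponent of each variable is bounded, so powers
  of a nonconstant monomial eventually leave it.\<close>

lemma monomial_power_vanishes:
  assumes "a \<noteq> 0"
  shows "\<exists>N. res (monomial a ^ N) = res 0"
proof -
  obtain i where i: "lookup a i > 0"
    using assms by (metis gr0I lookup_zero poly_mapping_eqI)
  define N where "N = Suc (Max ((\<lambda>m. lookup m i) ` M))"
  have "\<exists>p. monomial a ^ n = (monomial p :: ('n, 'k) mpoly) \<and> n \<le> lookup p i" for n
  proof (induction n)
    case 0
    show ?case
      by (rule exI[of _ 0]) simp
  next
    case (Suc n)
    then obtain p where "monomial a ^ n = (monomial p :: ('n, 'k) mpoly)" "n \<le> lookup p i"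
      by blast
    then show ?case
      using i by (intro exI[of _ "a + p"]) (simp add: monomial_add lookup_add)
  qed
  then obtain p where p: "monomial a ^ N = (monomial p :: ('n, 'k) mpoly)" "N \<le> lookup p i"
    by blast
  have "lookup m i < N" if "m \<in> M" for m
    using that by (simp add: N_def less_Suc_eq_le)
  then have "p \<notin> M"
    using p(2) by (meson leD)
  then show ?thesis
    using p(1) res_monomial_notin_M[of p] by (intro exI[of _ N]) simp
qed

text \<open>The image of a nilpotent element is nilpotent, and the constant term is multiplicative
  with values in a field, so it vanishes: automorphisms preserve the maximal ideal.\<close>

lemma mat_constant_term:
  assumes g: "g \<in> Aut" and "a \<noteq> 0"
  shows "mat g 0 a = 0"
proof -
  obtain h where h: "g (res (monomial a)) = res h"
    by (rule aut_lift[OF g])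
  obtain N where N: "res (monomial a ^ N) = res 0"
    using monomial_power_vanishes[OF assms(2)] by blast
  have power: "g (res (monomial a ^ n)) = res (h ^ n)" for n
    by (induction n) (simp_all add: aut_one[OF g] aut_mult[OF g] h)
  have "lookup (h ^ n) 0 = lookup h 0 ^ n" for n
    by (induction n) (simp_all add: lookup_mult_0)
  moreover have "res (h ^ N) = res 0"
    using power[of N] N aut_zero[OF g] by simp
  then have "coord 0 (res (h ^ N)) = coord 0 (res 0)"
    by simp
  then have "lookup (h ^ N) 0 = 0"
    by simp
  ultimately have "lookup h 0 = 0"
    by simp
  then show ?thesis
    by (simp add: mat_def h)
qed

text \<open>A variable is not a product of two nonconstant monomials, so a product of two elements
  without constant term has no linear term.\<close>

lemma mat_decomposable:
  assumes g: "g \<in> Aut" and ab: "a \<noteq> 0" "b \<noteq> 0"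
  shows "mat g (unit_exp i) (a + b) = 0"
proof -
  obtain h where h: "g (res (monomial a)) = res h"
    by (rule aut_lift[OF g])
  obtain k where k: "g (res (monomial b)) = res k"
    by (rule aut_lift[OF g])
  have 0: "lookup h 0 = 0" "lookup k 0 = 0"
    using mat_constant_term[OF g ab(1)] mat_constant_term[OF g ab(2)] by (simp_all add: mat_def h k)
  have "lookup (h * k) (unit_exp i) = 0"
  proof (rule ccontr)
    assume "lookup (h * k) (unit_exp i) \<noteq> 0"
    then obtain x y where xy: "unit_exp i = x + y" "x \<in> keys h" "y \<in> keys k"
      using keys_mult[of h k] by (auto simp: in_keys_iff)
    have "x \<noteq> 0" "y \<noteq> 0"
      using xy 0 by (auto simp: in_keys_iff)
    then obtain u v where uv: "lookup x u > 0" "lookup y v > 0"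
      by (metis gr0I lookup_zero poly_mapping_eqI)
    have "(\<Sum>j\<in>UNIV. lookup (unit_exp i) j) = (\<Sum>j\<in>UNIV. lookup x j) + (\<Sum>j\<in>UNIV. lookup y j)"
      unfolding xy(1) by (simp add: lookup_add sum.distrib)
    moreover have "(\<Sum>j\<in>UNIV. lookup (unit_exp i) j) = (1::nat)"
      by (simp add: lookup_single when_def)
    moreover have "lookup x u \<le> (\<Sum>j\<in>UNIV. lookup x j)" "lookup y v \<le> (\<Sum>j\<in>UNIV. lookup y j)"
      by (auto intro: member_le_sum)
    ultimately show False
      using uv by simp
  qed
  then show ?thesis
    by (simp add: mat_def monomial_add aut_mult[OF g] h k)
qed

lemma mat_one_monomial:
  assumes "g \<in> Aut" "p \<in> M" "p \<noteq> 0"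
  shows "mat g p 0 = 0"
  using assms by (simp add: mat_def aut_one lookup_one when_def)

text \<open>Only the monomials of degree one contribute, since an automorphism preserves the square of the maximal
  ideal.\<close>

lemma linear_part_sum:
  assumes g: "g \<in> Aut"
  shows "(\<Sum>m\<in>M. mat g (unit_exp i) m * c m) = (\<Sum>k\<in>UNIV. mat g (unit_exp i) (unit_exp k) * c (unit_exp k))"
proof -
  have inj: "inj (unit_exp :: 'n \<Rightarrow> _)"
    by (rule injI) (metis lookup_single_eq lookup_single_not_eq zero_neq_one)
  have "mat g (unit_exp i) m = 0" if "m \<in> M - range unit_exp" for m
  proof (cases m rule: exponent_cases)
    case zero
    have "unit_exp i \<noteq> (0 :: 'n \<Rightarrow>\<^sub>0 nat)"
      by (metis lookup_single_eq lookup_zero one_neq_zero)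
    with zero show ?thesis
      by (simp add: mat_one_monomial[OF g])
  next
    case (unit i)
    then show ?thesis
      using that by blast
  next
    case (decomposable a b)
    then show ?thesis
      by (simp add: mat_decomposable[OF g])
  qed
  then have "(\<Sum>m\<in>M. mat g (unit_exp i) m * c m) = (\<Sum>m\<in>range unit_exp. mat g (unit_exp i) m * c m)"
    by (intro sum.mono_neutral_right) auto
  also have "\<dots> = (\<Sum>k\<in>UNIV. mat g (unit_exp i) (unit_exp k) * c (unit_exp k))"
    by (simp add: sum.reindex[OF inj])
  finally show ?thesis .
qed

section \<open>Root subgroups and derivations\<close>

text \<open>\<open>shiftable l j\<close> says that replacing one factor \<open>x\<^sub>j\<close> by \<open>x\<^sub>l\<close> preserves \<open>I\<close>, i.e. that
  \<open>x\<^sub>l \<partial>/\<partial>x\<^sub>j\<close> maps \<open>I\<close> into itself.\<close>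

definition shiftable :: "'n \<Rightarrow> 'n \<Rightarrow> bool" where
  "shiftable l j \<longleftrightarrow> (\<forall>m. m + unit_exp j \<in> supp I \<longrightarrow> m + unit_exp l \<in> supp I)"

lemma shiftable_trans: "shiftable a b \<Longrightarrow> shiftable b c \<Longrightarrow> shiftable a c"
  by (simp add: shiftable_def)

lemma shiftable_refl: "shiftable a a"
  by (simp add: shiftable_def)

lemma derivation_mult: "derivation A D \<Longrightarrow> D (res (f * h)) = (D (res f) \<otimes>\<^bsub>A\<^esub> res h) \<oplus>\<^bsub>A\<^esub> (res f \<otimes>\<^bsub>A\<^esub> D (res h))"
  unfolding derivation_def by (metis mult_A res_in_carrier)

lemma derivation_lift:
  assumes "derivation A D"
  obtains h where "D (res f) = res h"
  using assms unfolding derivation_def by (metis PiE carrierE res_in_carrier)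

lemma derivation_scale: "derivation A D \<Longrightarrow> D (res (scalar c * f)) = c \<odot>\<^bsub>A\<^esub> D (res f)"
  unfolding derivation_def by (metis smult_A res_in_carrier)

lemma derivation_add: "derivation A D \<Longrightarrow> D (res (f + h)) = D (res f) \<oplus>\<^bsub>A\<^esub> D (res h)"
  unfolding derivation_def by (metis add_A res_in_carrier)

lemma derivation_zero: "derivation A D \<Longrightarrow> D (res 0) = res 0"
  using derivation_scale[of D 0 0] by (auto elim!: derivation_lift[of D 0])

lemma derivation_one:
  assumes "derivation A D"
  shows "D (res 1) = res 0"
proof -
  obtain h where h: "D (res 1) = res h"
    by (rule derivation_lift[OF assms])
  have "res h = res (h + h)"
    using derivation_mult[OF assms, of 1 1] by (simp only: h mult_A add_A mult_1_left mult_1_right)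
  then have "\<forall>m\<in>M. lookup h m = lookup h m + lookup h m"
    by (simp only: res_eq_iff lookup_add)
  then show ?thesis
    by (simp add: h res_eq_iff)
qed

lemma lookup_mult_monomial_add:
  fixes f :: "('n, 'k) mpoly"
  shows "lookup (monomial m * f) (m + p) = lookup f p"
proof (induction f rule: mpoly_induct)
  case (monomial q)
  then show ?case
    by (simp add: lookup_monomial flip: monomial_add)
next
  case (scale c f)
  have "monomial m * (scalar c * f) = scalar c * (monomial m * f)"
    by (rule mult.left_commute)
  with scale show ?case
    by (simp only: lookup_scalar_mult)
qed (simp add: lookup_add distrib_left)

lemma lookup_mult_monomial_eq_0:
  fixes f :: "('n, 'k) mpoly"
  assumes "\<And>q. p \<noteq> m + q"
  shows "lookup (monomial m * f) p = 0"
proof (rule ccontr)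
  assume "lookup (monomial m * f) p \<noteq> 0"
  then have "p \<in> keys (monomial m * f)"
    by (simp add: in_keys_iff)
  from subsetD[OF keys_mult this] show False
    using assms by auto
qed

text \<open>The component of degree \<open>e\<^sub>l - e\<^sub>j\<close> of a derivation is a multiple of \<open>x\<^sub>l \<partial>/\<partial>x\<^sub>j\<close>.\<close>

lemma derivation_component:
  assumes D: "derivation A D" and lj: "l \<noteq> j"
  shows "p \<in> M \<Longrightarrow> p + unit_exp j = m + unit_exp l \<Longrightarrow>
    coord p (D (res (monomial m))) = of_nat (lookup m j) * coord (unit_exp l) (D (gen j))"
proof (induction m arbitrary: p rule: exponent_induct)
  case zero
  then show ?case
    by (simp add: derivation_one[OF D])
next
  case (add m a)
  obtain h where h: "D (res (monomial m)) = res h"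
    by (rule derivation_lift[OF D])
  obtain k where k: "D (gen a) = res k"
    by (rule derivation_lift[OF D])
  have eq: "coord p (D (res (monomial (m + unit_exp a))))
      = lookup (monomial (unit_exp a) * h) p + lookup (monomial m * k) p"
    using add.prems(1) by (simp add: monomial_add derivation_mult[OF D] h k lookup_add mult.commute)
  have p: "lookup p i + (if i = j then 1 else 0) = lookup m i + (if i = a then 1 else 0) + (if i = l then 1 else 0)" for i
    using arg_cong[OF add.prems(2), of "\<lambda>f. lookup f i"] by (simp add: lookup_add lookup_single when_def eq_commute)
  have first: "lookup (monomial (unit_exp a) * h) p = of_nat (lookup m j) * coord (unit_exp l) (D (gen j))"
  proof (cases "lookup p a > 0")
    case True
    define q where "q = p - unit_exp a"
    have q: "p = unit_exp a + q"
      using True by (intro poly_mapping_eqI) (auto simp: q_def lookup_add lookup_minus lookup_single when_def)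
    have "unit_exp a + (q + unit_exp j) = unit_exp a + (m + unit_exp l)"
      using add.prems(2) unfolding q by (simp only: ac_simps)
    then have "q + unit_exp j = m + unit_exp l"
      by (simp only: add_left_cancel)
    moreover have "q \<in> M"
      using add.prems(1) in_M_addD unfolding q by blast
    ultimately show ?thesis
      using add.IH[of q] by (simp add: q lookup_mult_monomial_add h)
  next
    \<comment> \<open>If \<open>x_a\<close> does not divide \<open>x^p\<close>, the relation between
      \<open>p\<close> and \<open>m\<close> forces \<open>a = j\<close> and \<open>x_j\<close> not
      to divide \<open>x^m\<close>, so both sides vanish.\<close>
    case False
    then have "lookup m j = 0"
      using p[of a] p[of j] lj by (auto split: if_splits)
    moreover have "lookup (monomial (unit_exp a) * h) p = 0"
      using False by (intro lookup_mult_monomial_eq_0) (auto simp: lookup_add)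
    ultimately show ?thesis
      by simp
  qed
  show ?case
  proof (cases "a = j")
    case True
    have "p + unit_exp j = (m + unit_exp l) + unit_exp j"
      using add.prems(2) unfolding True by (simp only: ac_simps)
    then have "p = m + unit_exp l"
      by (simp only: add_right_cancel)
    then show ?thesis
      using eq first True k by (simp add: lookup_mult_monomial_add lookup_add distrib_right)
  next
    case False
    \<comment> \<open>For \<open>a \<noteq> j\<close>, \<open>p\<close> has one factor
      \<open>x_j\<close> less than \<open>m\<close>, so \<open>x^m\<close> does not divide
      \<open>x^p\<close>.\<close>
    have "lookup (monomial m * k) p = 0"
      using p[of j] lj False by (intro lookup_mult_monomial_eq_0) (auto simp: lookup_add)
    then show ?thesis
      using eq first False by (simp add: lookup_add lookup_single when_def)
  qed
qed

text \<open>If \<open>x^m x_j\<close> lies in \<open>I\<close>, its class is 0. Were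
  \<open>x^m x_l\<close> outside \<open>I\<close>, its coefficient in the derivative would be
  \<open>m_j + 1\<close> times a nonzero scalar, which is nonzero in characteristic zero.\<close>

lemma shiftable_if_derivation:
  assumes D: "derivation A D" and "l \<noteq> j" and c: "coord (unit_exp l) (D (gen j)) \<noteq> 0"
  shows "shiftable l j"
  unfolding shiftable_def
proof (intro allI impI)
  fix m assume m: "m + unit_exp j \<in> supp I"
  show "m + unit_exp l \<in> supp I"
  proof (rule ccontr)
    assume "m + unit_exp l \<notin> supp I"
    then have M: "m + unit_exp l \<in> M"
      by (simp add: M_def)
    have "res (monomial (m + unit_exp j)) = res 0"
      using m by (intro res_monomial_notin_M) (simp add: M_def)
    then have "coord (m + unit_exp l) (D (res (monomial (m + unit_exp j)))) = 0"
      using M by (simp add: derivation_zero[OF D])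
    then show False
      using derivation_component[OF D assms(2) M, of "m + unit_exp j"] c
      by (simp add: ac_simps lookup_add flip: of_nat_Suc)
  qed
qed

lemma derivation_induced:
  assumes I: "\<And>m. m \<notin> M \<Longrightarrow> \<phi> m \<in> I"
    and Leibniz: "\<And>a b. \<phi> (a + b) = \<phi> a * monomial b + monomial a * \<phi> b"
  shows "derivation A (induced (lin_ext \<phi>))"
proof -
  have ind: "induced (lin_ext \<phi>) (res f) = res (lin_ext \<phi> f)" for f
    by (rule induced_lin_ext) (rule I)
  show ?thesis
    unfolding derivation_def
    by (intro conjI ballI allI funcsetI; elim carrierE)
      (simp_all add: ind lin_ext_add lin_ext_scale lin_ext_Leibniz[of \<phi>, OF Leibniz])
qed

text \<open>The derivation \<open>x_i d/dx_i\<close>. On the cotangent space it is the projection to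
  \<open>x_i\<close>.\<close>

definition euler :: "'n \<Rightarrow> ('n, 'k) mpoly set \<Rightarrow> ('n, 'k) mpoly set" where
  "euler i = induced (lin_ext (\<lambda>m. scalar (of_nat (lookup m i)) * monomial m))"

lemma derivation_euler: "derivation A (euler i)"
  unfolding euler_def
proof (rule derivation_induced)
  show "scalar (of_nat (lookup (a + b) i)) * monomial (a + b)
      = scalar (of_nat (lookup a i)) * monomial a * monomial b
        + monomial a * (scalar (of_nat (lookup b i)) * monomial b)" for a b :: "'n \<Rightarrow>\<^sub>0 nat"
    by (simp add: lookup_add monomial_add single_add algebra_simps del: single_of_nat)
qed (rule monomial_in_I)

lemma coord_euler:
  assumes "x \<in> carrier A" "p \<in> M"
  shows "coord p (euler i x) = of_nat (lookup p i) * coord p x"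
proof -
  obtain f where f: "x = res f"
    using assms(1) by (rule carrierE)
  have "lookup (lin_ext (\<lambda>m. scalar (of_nat (lookup m i)) * monomial m) f) p = of_nat (lookup p i) * lookup f p"
    by (induction f rule: mpoly_induct)
      (simp_all add: lookup_monomial lin_ext_add lin_ext_scale lookup_add distrib_left del: single_of_nat)
  moreover have "euler i (res f) = res (lin_ext (\<lambda>m. scalar (of_nat (lookup m i)) * monomial m) f)"
    unfolding euler_def by (rule induced_lin_ext) (rule monomial_in_I)
  ultimately show ?thesis
    using assms(2) by (simp add: f)
qed

lemma derivation_conj:
  assumes g: "g \<in> Aut" and D: "derivation A D"
  shows "derivation A (\<lambda>x. (inv\<^bsub>G\<^esub> g) (D (g x)))"
proof -
  have h: "inv\<^bsub>G\<^esub> g \<in> Aut"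
    using g by simp
  have "\<exists>b. g (res f) = res b" "\<exists>b. D (res f) = res b" "\<exists>b. (inv\<^bsub>G\<^esub> g) (res f) = res b" for f
    by (rule aut_lift[OF g], blast, rule derivation_lift[OF D], blast, rule aut_lift[OF h], blast)
  then obtain a b c where abc: "\<And>f. g (res f) = res (a f)" "\<And>f. D (res f) = res (b f)"
    "\<And>f. (inv\<^bsub>G\<^esub> g) (res f) = res (c f)"
    by metis
  have inv: "(inv\<^bsub>G\<^esub> g) (g (res f)) = res f" for f
    using inv_G_apply(1)[OF g] by simp
  have "(inv\<^bsub>G\<^esub> g) (D (g (res (f + k)))) = (inv\<^bsub>G\<^esub> g) (D (g (res f))) \<oplus>\<^bsub>A\<^esub> (inv\<^bsub>G\<^esub> g) (D (g (res k)))" for f k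
  proof -
    have 1: "g (res (f + k)) = res (a f + a k)"
      using aut_add[OF g, of f k] abc(1)[of f] abc(1)[of k] by simp
    have 2: "D (res (a f + a k)) = res (b (a f) + b (a k))"
      using derivation_add[OF D, of "a f" "a k"] abc(2)[of "a f"] abc(2)[of "a k"] by simp
    show ?thesis
      unfolding 1 2 abc(1)[of f] abc(1)[of k] abc(2)[of "a f"] abc(2)[of "a k"] aut_add[OF h] ..
  qed
  moreover have "(inv\<^bsub>G\<^esub> g) (D (g (res (scalar s * f)))) = s \<odot>\<^bsub>A\<^esub> (inv\<^bsub>G\<^esub> g) (D (g (res f)))" for s f
  proof -
    have 1: "g (res (scalar s * f)) = res (scalar s * a f)"
      using aut_scale[OF g, of s f] abc(1)[of f] by simp
    have 2: "D (res (scalar s * a f)) = res (scalar s * b (a f))"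
      using derivation_scale[OF D, of s "a f"] abc(2)[of "a f"] by simp
    show ?thesis
      unfolding 1 2 abc(1)[of f] abc(2)[of "a f"] aut_scale[OF h] ..
  qed
  moreover have "(inv\<^bsub>G\<^esub> g) (D (g (res (f * k))))
      = ((inv\<^bsub>G\<^esub> g) (D (g (res f))) \<otimes>\<^bsub>A\<^esub> res k) \<oplus>\<^bsub>A\<^esub> (res f \<otimes>\<^bsub>A\<^esub> (inv\<^bsub>G\<^esub> g) (D (g (res k))))" for f k
  proof -
    have 1: "g (res (f * k)) = res (a f * a k)"
      using aut_mult[OF g, of f k] abc(1)[of f] abc(1)[of k] by simp
    have 2: "D (res (a f * a k)) = res (b (a f) * a k + a f * b (a k))"
      using derivation_mult[OF D, of "a f" "a k"] abc(2)[of "a f"] abc(2)[of "a k"] by simp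
    have 3: "(inv\<^bsub>G\<^esub> g) (res (a f)) = res f" "(inv\<^bsub>G\<^esub> g) (res (a k)) = res k"
      using inv[of f] inv[of k] abc(1)[of f] abc(1)[of k] by simp_all
    show ?thesis
      unfolding 1 2 abc(1)[of f] abc(1)[of k] abc(2)[of "a f"] abc(2)[of "a k"]
        aut_add[OF h] aut_mult[OF h] 3 ..
  qed
  ultimately show ?thesis
    unfolding derivation_def
    by (intro conjI ballI allI funcsetI; elim carrierE) (simp_all add: abc)
qed

text \<open>Conjugating \<open>x\<^sub>i \<partial>/\<partial>x\<^sub>i\<close> by \<open>g\<close> gives a derivation, whose components outside the diagonal are constrained.\<close>

lemma shiftable_if_linear_parts:
  assumes g: "g \<in> Aut" and "l \<noteq> j"
    and ne: "mat (inv\<^bsub>G\<^esub> g) (unit_exp l) (unit_exp i) * mat g (unit_exp i) (unit_exp j) \<noteq> 0"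
  shows "shiftable l j"
proof (rule shiftable_if_derivation[OF derivation_conj[OF g derivation_euler[of i]] assms(2)])
  have h: "inv\<^bsub>G\<^esub> g \<in> Aut"
    using g by simp
  have car: "euler i (g (gen j)) \<in> carrier A"
    by (metis aut_lift[OF g] derivation_lift[OF derivation_euler] res_in_carrier)
  have "coord (unit_exp l) ((inv\<^bsub>G\<^esub> g) (euler i (g (gen j))))
      = (\<Sum>m\<in>M. coord m (euler i (g (gen j))) * mat (inv\<^bsub>G\<^esub> g) (unit_exp l) m)"
    by (rule coord_aut[OF h unit_exp_in_M car])
  also have "\<dots> = (\<Sum>m\<in>M. mat (inv\<^bsub>G\<^esub> g) (unit_exp l) m * (of_nat (lookup m i) * mat g m (unit_exp j)))"
    by (rule sum.cong) (simp_all add: coord_euler aut_carrier[OF g] mat_def)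
  \<comment> \<open>Only variables occur as intermediate monomials, and among them
    \<open>euler i\<close> keeps just \<open>x_i\<close>; a single product remains, so nothing can
    cancel.\<close>
  also have "\<dots> = (\<Sum>k\<in>UNIV. mat (inv\<^bsub>G\<^esub> g) (unit_exp l) (unit_exp k) *
      (of_nat (lookup (unit_exp k) i) * mat g (unit_exp k) (unit_exp j)))"
    by (rule linear_part_sum[OF h])
  also have "\<dots> = (\<Sum>k\<in>UNIV. if k = i then mat (inv\<^bsub>G\<^esub> g) (unit_exp l) (unit_exp i) * mat g (unit_exp i) (unit_exp j) else 0)"
    by (rule sum.cong) (auto simp: lookup_single when_def)
  finally show "coord (unit_exp l) ((inv\<^bsub>G\<^esub> g) (euler i (g (gen j)))) \<noteq> 0"
    using ne by simp
qed

section \<open>The identity component without opposite roots\<close>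

text \<open>Antisymmetry makes \<open>v\<close> strictly monotone. Scaling it by \<open>n\<close>
  leaves room for the injective numbering \<open>f\<close> with values below \<open>n\<close>, which
  separates variables with equal \<open>v\<close>.\<close>

lemma linear_extension:
  assumes "\<And>i j. i \<noteq> j \<Longrightarrow> shiftable i j \<Longrightarrow> \<not> shiftable j i"
  obtains w :: "'n \<Rightarrow> nat" where "inj w" "\<And>l j. l \<noteq> j \<Longrightarrow> shiftable l j \<Longrightarrow> w j < w l"
proof -
  obtain f :: "'n \<Rightarrow> nat" and n where f: "f ` UNIV = {i. i < n}" "inj f"
    using finite_imp_inj_to_nat_seg[OF finite_class.finite_UNIV] by blast
  then have fn: "f i < n" for i
    by blast
  define v where "v i = card {j. shiftable i j}" for i
  define w where "w i = v i * n + f i" for i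
  have "v j < v l" if "l \<noteq> j" "shiftable l j" for l j
  proof -
    have "{i. shiftable j i} \<subset> {i. shiftable l i}"
      using that assms shiftable_trans shiftable_refl by blast
    then show ?thesis
      unfolding v_def by (intro psubset_card_mono) auto
  qed
  then have mono: "w j < w l" if "l \<noteq> j" "shiftable l j" for l j
  proof -
    have "Suc (v j) * n \<le> v l * n"
      using \<open>\<And>l j. l \<noteq> j \<Longrightarrow> shiftable l j \<Longrightarrow> v j < v l\<close>[OF that] by (intro mult_right_mono) auto
    then show ?thesis
      using fn[of j] by (simp add: w_def)
  qed
  have "inj w"
  proof (rule injI)
    fix i j assume "w i = w j"
    then have "w i mod n = w j mod n"
      by simp
    then have "f i = f j"
      using fn by (simp add: w_def)
    then show "i = j"
      using f(2) by (simp add: inj_def)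
  qed
  with mono show ?thesis
    using that by blast
qed

lemma IC_eq_triangular:
  assumes "\<And>i j. i \<noteq> j \<Longrightarrow> shiftable i j \<Longrightarrow> \<not> shiftable j i"
  obtains w where "IC = triangular w"
proof -
  obtain v :: "'n \<Rightarrow> nat" where v: "inj v" "\<And>l j. l \<noteq> j \<Longrightarrow> shiftable l j \<Longrightarrow> v j < v l"
    using linear_extension[OF assms] by blast
  \<comment> \<open>\<open>C\<close> exceeds every \<open>v i\<close>, so the variables have weights
    in \<open>[C, 2C)\<close> while monomials of degree at least 2 weigh at least \<open>2C\<close>.
    The linear part alone then decides triangularity.\<close>
  define C where "C = Suc (\<Sum>i\<in>UNIV. v i)"
  have C: "v i < C" for i
    unfolding C_def by (rule le_imp_less_Suc) (simp add: member_le_sum)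
  define w where "w i = C + v i" for i
  have wt_ge: "C \<le> wt w m" if m: "m \<noteq> 0" for m
  proof -
    obtain i where i: "lookup m i > 0"
      using m by (metis gr0I lookup_zero poly_mapping_eqI)
    have "C \<le> w i * lookup m i"
      using mult_le_mono[of C "w i" 1 "lookup m i"] i by (simp add: w_def Suc_le_eq One_nat_def)
    also have "\<dots> \<le> wt w m"
      unfolding wt_def by (rule member_le_sum) auto
    finally show ?thesis .
  qed
  have triangularI: "g \<in> triangular w"
    if g: "g \<in> Aut" and lin: "\<And>l j. mat g (unit_exp l) (unit_exp j) \<noteq> 0 \<Longrightarrow> v j \<le> v l" for g
  proof -
    have "raises w 1 (mon_val (\<lambda>i. mat g (unit_exp i) (unit_exp i))) g"
    proof (rule raises_from_gens[OF g])
      fix j p assume p: "p \<in> M" "mat g p (unit_exp j) \<noteq> (if p = unit_exp j then mat g (unit_exp j) (unit_exp j) else 0)"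
      then have pj: "p \<noteq> unit_exp j" "mat g p (unit_exp j) \<noteq> 0"
        by (auto split: if_splits)
      show "w j < wt w p"
      proof (cases p rule: exponent_cases)
        case zero
        have "unit_exp j \<noteq> (0 :: 'n \<Rightarrow>\<^sub>0 nat)"
          by (metis lookup_single_eq lookup_zero one_neq_zero)
        then show ?thesis
          using pj mat_constant_term[OF g] zero by simp
      next
        case (unit l)
        then have "v j \<le> v l" "v j \<noteq> v l"
          using pj lin[of l j] v(1) by (auto simp: inj_eq)
        then show ?thesis
          by (simp add: unit w_def)
      next
        case (decomposable a b)
        then have "C + C \<le> wt w p"
          using wt_ge[of a] wt_ge[of b] by simp
        then show ?thesis
          using C[of j] by (simp add: w_def)
      qed
    qed
    with g show ?thesis
      by (auto simp: triangular_def)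
  qed
  \<comment> \<open>\<open>(j, i)\<close> records that column \<open>i\<close> of the linear part of
    \<open>g^-1\<close> has no nonzero entry before \<open>j\<close> in the total order. There are
    finitely many sets of such pairs.\<close>
  define \<sigma> where "\<sigma> g = {(j, i). \<forall>l. mat (inv\<^bsub>G\<^esub> g) (unit_exp l) (unit_exp i) \<noteq> 0 \<longrightarrow> v j \<le> v l}" for g
  have "IC \<subseteq> triangular w"
  proof (rule IC_subset_finite_index[OF subgroup_triangular closedin_triangular])
    show "finite (\<sigma> ` Aut)"
      by (rule finite_subset[of _ UNIV]) auto
    fix g h assume g: "g \<in> Aut" and h: "h \<in> Aut" and eq: "\<sigma> g = \<sigma> h"
    show "inv\<^bsub>G\<^esub> h \<otimes>\<^bsub>G\<^esub> g \<in> triangular w"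
    proof (rule triangularI)
      show "inv\<^bsub>G\<^esub> h \<otimes>\<^bsub>G\<^esub> g \<in> Aut"
        using g h by simp
      fix l j assume "mat (inv\<^bsub>G\<^esub> h \<otimes>\<^bsub>G\<^esub> g) (unit_exp l) (unit_exp j) \<noteq> 0"
      then have "(\<Sum>i\<in>UNIV. mat (inv\<^bsub>G\<^esub> h) (unit_exp l) (unit_exp i) * mat g (unit_exp i) (unit_exp j)) \<noteq> 0"
        using g h by (simp add: mat_mult linear_part_sum)
      then obtain i where i: "mat (inv\<^bsub>G\<^esub> h) (unit_exp l) (unit_exp i) \<noteq> 0" "mat g (unit_exp i) (unit_exp j) \<noteq> 0"
        by (metis (no_types, lifting) mult_not_zero sum.neutral)
      \<comment> \<open>Next to the nonzero entry \<open>(i, j)\<close> of \<open>g\<close>, every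
        nonzero entry \<open>(k, i)\<close> of \<open>g^-1\<close> with \<open>k \<noteq> j\<close>
        yields a root \<open>e_k - e_j\<close>, hence \<open>v j < v k\<close>.\<close>
      have "v j \<le> v k" if "mat (inv\<^bsub>G\<^esub> g) (unit_exp k) (unit_exp i) \<noteq> 0" for k
        using shiftable_if_linear_parts[OF g, of k j i] v(2)[of k j] i(2) that by (cases "k = j") auto
      then have "(j, i) \<in> \<sigma> g"
        by (simp add: \<sigma>_def)
      then have "(j, i) \<in> \<sigma> h"
        by (simp add: eq)
      then show "v j \<le> v l"
        using i(1) by (simp add: \<sigma>_def)
    qed
  qed
  with triangular_subset_IC show ?thesis
    using that by blast
qed

section \<open>Structure of the triangular group\<close>

lemma normal_unitriangular: "unitriangular w 1 \<lhd> (G\<lparr>carrier := triangular w\<rparr>)"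
  unfolding G.normal_in_subgroup_iff[OF subgroup_triangular]
proof (intro conjI ballI)
  show "subgroup (unitriangular w 1) G"
    by (rule subgroup_unitriangular) simp
  show "unitriangular w 1 \<subseteq> triangular w"
    by (rule unitriangular_subset_triangular)
  fix x u assume "x \<in> triangular w" "u \<in> unitriangular w 1"
  then obtain a where x: "x \<in> Aut" "raises w 1 a x" and u: "u \<in> Aut" "raises w 1 (\<lambda>_. 1) u"
    by (auto simp: triangular_def unitriangular_def)
  have r: "raises w 1 (\<lambda>m. a m * 1 * inverse (a m)) (x \<otimes>\<^bsub>G\<^esub> u \<otimes>\<^bsub>G\<^esub> inv\<^bsub>G\<^esub> x)"
    using x u by (intro raises_mult raises_inv(1)) simp_all
  have "a m \<noteq> 0" if "m \<in> M" for m
    using raises_inv(2)[OF x _ that] by simp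
  then have "raises w 1 (\<lambda>_. 1) (x \<otimes>\<^bsub>G\<^esub> u \<otimes>\<^bsub>G\<^esub> inv\<^bsub>G\<^esub> x)"
    using raisesD[OF r] by (intro raisesI) simp
  then show "x \<otimes>\<^bsub>G\<^esub> u \<otimes>\<^bsub>G\<^esub> inv\<^bsub>G\<^esub> x \<in> unitriangular w 1"
    using x u by (simp add: unitriangular_def)
qed

lemma unipotent_radical_triangular: "is_unipotent_radical A (triangular w) (unitriangular w 1)"
  unfolding is_unipotent_radical_def
proof (intro conjI allI impI)
  show "normal_unipotent A (triangular w) (unitriangular w 1)"
    unfolding normal_unipotent_def
    using normal_unitriangular closedin_unitriangular connectedin_unitriangular unipotent_unitriangular
    by blast
  fix N assume "normal_unipotent A (triangular w) N"
  then have "N \<subseteq> triangular w" "\<forall>g\<in>N. unipotent A g"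
    unfolding normal_unipotent_def G.normal_in_subgroup_iff[OF subgroup_triangular] by blast+
  then show "N \<subseteq> unitriangular w 1"
    using unipotent_triangular by blast
qed

lemma unipotent_radical_unique:
  "is_unipotent_radical A H R \<Longrightarrow> is_unipotent_radical A H R' \<Longrightarrow> R = R'"
  unfolding is_unipotent_radical_def by blast

lemma one_in_unitriangular: "\<one>\<^bsub>G\<^esub> \<in> unitriangular w 1"
  by (rule subgroup.one_closed[OF subgroup_unitriangular]) simp

text \<open>The torus is triangular for every weight, so its unipotent elements are unitriangular
  and hence trivial; \<open>undefined\<close> stands for an arbitrary weight.\<close>

lemma reductive_torus: "reductive A (torus I)"
proof -
  have one: "\<one>\<^bsub>G\<^esub> \<in> torus I"
    by (rule subgroup.one_closed[OF subgroup_torus])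
  have "closedin (zariski A) {\<one>\<^bsub>G\<^esub>}"
  proof -
    have "{\<one>\<^bsub>G\<^esub>} = torus I \<inter> unitriangular undefined 1"
      using torus_Int_unitriangular[of undefined] one one_in_unitriangular by blast
    then show ?thesis
      using closedin_Int[OF closedin_torus closedin_unitriangular] by metis
  qed
  moreover have "unipotent A \<one>\<^bsub>G\<^esub>"
    by (rule unipotent_unitriangular[OF one_in_unitriangular])
  moreover have "{\<one>\<^bsub>G\<^esub>} \<lhd> (G\<lparr>carrier := torus I\<rparr>)"
  proof -
    have "t \<otimes>\<^bsub>G\<^esub> \<one>\<^bsub>G\<^esub> \<otimes>\<^bsub>G\<^esub> inv\<^bsub>G\<^esub> t = \<one>\<^bsub>G\<^esub>" if "t \<in> torus I" for t
      using subgroup.subset[OF subgroup_torus] that by auto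
    then show ?thesis
      unfolding G.normal_in_subgroup_iff[OF subgroup_torus] using one G.triv_subgroup by auto
  qed
  ultimately have "normal_unipotent A (torus I) {\<one>\<^bsub>G\<^esub>}"
    by (simp add: normal_unipotent_def)
  moreover have "N \<subseteq> {\<one>\<^bsub>G\<^esub>}" if "normal_unipotent A (torus I) N" for N
  proof -
    have "N \<subseteq> torus I" "\<forall>g\<in>N. unipotent A g"
      using that unfolding normal_unipotent_def G.normal_in_subgroup_iff[OF subgroup_torus] by blast+
    then have "N \<subseteq> torus I \<inter> unitriangular undefined 1"
      using unipotent_triangular torus_subset_triangular by blast
    then show ?thesis
      using torus_Int_unitriangular by blast
  qed
  ultimately show ?thesis
    using subgroup_torus closedin_torus connectedin_torus
    by (simp add: reductive_def is_unipotent_radical_def)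
qed

lemma torus_unitriangular_product: "torus I <#>\<^bsub>G\<^esub> unitriangular w 1 = triangular w"
proof (intro equalityI subsetI)
  fix g assume "g \<in> torus I <#>\<^bsub>G\<^esub> unitriangular w 1"
  then show "g \<in> triangular w"
    using torus_subset_triangular[of w] unitriangular_subset_triangular[of w]
      subgroup.m_closed[OF subgroup_triangular, of _ w]
    by (auto simp: set_mult_def)
next
  fix g assume "g \<in> triangular w"
  then show "g \<in> torus I <#>\<^bsub>G\<^esub> unitriangular w 1"
    by (rule triangular_decompose) (auto simp: set_mult_def)
qed

lemma levi_triangular: "levi_decomposition A (triangular w) (torus I) (unitriangular w 1)"
  unfolding levi_decomposition_def
  using unipotent_radical_triangular reductive_torus torus_Int_unitriangular[of w]
    torus_unitriangular_product one_in_unitriangular subgroup.one_closed[OF subgroup_torus]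
  by blast

lemma derived_subsetI:
  assumes "subgroup H G"
    and "\<And>g h. g \<in> D \<Longrightarrow> h \<in> D \<Longrightarrow> g \<otimes>\<^bsub>G\<^esub> h \<otimes>\<^bsub>G\<^esub> inv\<^bsub>G\<^esub> g \<otimes>\<^bsub>G\<^esub> inv\<^bsub>G\<^esub> h \<in> H"
  shows "derived G D \<subseteq> H"
  unfolding derived_def by (rule G.generate_subgroup_incl) (use assms in auto)

text \<open>The derived series climbs the weight filtration, which becomes trivial once the gap
  exceeds all weights on \<open>M\<close>. Doubling a positive gap gives at least the increment by
  one that the induction records.\<close>

lemma solvable_triangular: "solvable (G\<lparr>carrier := triangular w\<rparr>)"
proof -
  have der: "(derived G ^^ Suc n) (triangular w) \<subseteq> unitriangular w (Suc n)" for n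
  proof (induction n)
    case 0
    have "derived G (triangular w) \<subseteq> unitriangular w 1"
      by (rule derived_subsetI[OF subgroup_unitriangular]) (auto intro: commutator_triangular)
    then show ?case
      by (simp add: One_nat_def)
  next
    case (Suc n)
    have "derived G ((derived G ^^ Suc n) (triangular w)) \<subseteq> unitriangular w (Suc n + Suc n)"
    proof (rule derived_subsetI)
      show "subgroup (unitriangular w (Suc n + Suc n)) G"
        by (rule subgroup_unitriangular) simp
    qed (use Suc in \<open>blast intro: commutator_unitriangular\<close>)
    also have "\<dots> \<subseteq> unitriangular w (Suc (Suc n))"
      by (rule unitriangular_mono) simp
    finally show ?case
      by simp
  qed
  define N where "N = Max (wt w ` M)"
  have "wt w m < Suc N" if "m \<in> M" for m
    using that by (simp add: N_def less_Suc_eq_le)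
  then have "(derived G ^^ Suc N) (triangular w) \<subseteq> {\<one>\<^bsub>G\<^esub>}"
    using der[of N] unitriangular_trivial[of w "Suc N"] by blast
  moreover have "\<one>\<^bsub>G\<^esub> \<in> (derived G ^^ Suc N) (triangular w)"
    by (rule subgroup.one_closed[OF G.exp_of_derived_is_subgroup[OF subgroup_triangular]])
  ultimately have "(derived G ^^ Suc N) (triangular w) = {\<one>\<^bsub>G\<^esub>}"
    by blast
  then show ?thesis
    unfolding G.solvable_subgroup_iff[OF subgroup_triangular] by blast
qed

section \<open>Opposite roots generate a copy of SL(2)\<close>

definition shear_mon :: "'n \<Rightarrow> 'n \<Rightarrow> 'k \<Rightarrow> ('n \<Rightarrow>\<^sub>0 nat) \<Rightarrow> ('n, 'k) mpoly" where
  "shear_mon i j s m = monomial (m - Poly_Mapping.single j (lookup m j)) *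
     (monomial (unit_exp j) + scalar s * monomial (unit_exp i)) ^ lookup m j"

text \<open>The substitution \<open>x\<^sub>j \<mapsto> x\<^sub>j + s x\<^sub>i\<close>.\<close>

definition shear :: "'n \<Rightarrow> 'n \<Rightarrow> 'k \<Rightarrow> ('n, 'k) mpoly set \<Rightarrow> ('n, 'k) mpoly set" where
  "shear i j s = induced (lin_ext (shear_mon i j s))"

lemma shear_mon_zero: "shear_mon i j s 0 = 1"
  by (simp add: shear_mon_def)

lemma shear_mon_add: "shear_mon i j s (a + b) = shear_mon i j s a * shear_mon i j s b"
proof -
  have "(a + b) - Poly_Mapping.single j (lookup (a + b) j)
      = (a - Poly_Mapping.single j (lookup a j)) + (b - Poly_Mapping.single j (lookup b j))"
    by (rule poly_mapping_eqI) (simp add: lookup_add lookup_minus lookup_single when_def)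
  then show ?thesis
    by (simp add: shear_mon_def lookup_add power_add monomial_add ac_simps)
qed

lemma shear_mon_eq_monomial:
  assumes "lookup m j = 0"
  shows "shear_mon i j s m = monomial m"
  using assms by (simp add: shear_mon_def)

lemma shear_mon_unit_exp:
  "shear_mon i j s (unit_exp j) = monomial (unit_exp j) + scalar s * monomial (unit_exp i)"
  by (simp add: shear_mon_def)

text \<open>Expanding one factor of the power at a time replaces \<open>x_j\<close> by
  \<open>x_j\<close> or \<open>x_i\<close>; shiftability keeps both exponents in the
  support.\<close>

lemma shear_power_in_I:
  assumes "shiftable i j"
  shows "q + Poly_Mapping.single j k \<in> supp I \<Longrightarrow>
    monomial q * (monomial (unit_exp j) + scalar s * monomial (unit_exp i)) ^ k \<in> I"
proof (induction k arbitrary: q)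
  case 0
  then show ?case
    by (simp add: supp_def)
next
  case (Suc k)
  let ?z = "monomial (unit_exp j) + scalar s * monomial (unit_exp i) :: ('n, 'k) mpoly"
  have eq: "q + Poly_Mapping.single j (Suc k) = (q + Poly_Mapping.single j k) + unit_exp j"
    by (rule poly_mapping_eqI) (simp add: lookup_add lookup_single when_def)
  have "(q + Poly_Mapping.single j k) + unit_exp i \<in> supp I"
    using assms Suc.prems unfolding shiftable_def eq by blast
  then have "monomial (q + unit_exp i) * ?z ^ k \<in> I"
    by (intro Suc.IH) (simp only: ac_simps)
  moreover have "monomial (q + unit_exp j) * ?z ^ k \<in> I"
    using Suc.prems unfolding eq by (intro Suc.IH) (simp only: ac_simps)
  moreover have "monomial q * ?z ^ Suc k
      = monomial (q + unit_exp j) * ?z ^ k + scalar s * (monomial (q + unit_exp i) * ?z ^ k)"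
    by (simp add: monomial_add algebra_simps)
  ultimately show ?case
    using mult_I[of _ "scalar s"] by (auto simp: mem_I_iff lookup_add)
qed

lemma shear_mon_in_I:
  assumes "shiftable i j" "m \<notin> M"
  shows "shear_mon i j s m \<in> I"
proof -
  have "(m - Poly_Mapping.single j (lookup m j)) + Poly_Mapping.single j (lookup m j) = m"
    by (rule poly_mapping_eqI) (simp add: lookup_add lookup_minus lookup_single when_def)
  then show ?thesis
    unfolding shear_mon_def using assms by (intro shear_power_in_I) (simp_all add: M_def)
qed

lemma lin_ext_shear_power:
  "lin_ext (shear_mon i j s) (f ^ k) = lin_ext (shear_mon i j s) f ^ k"
proof (induction k)
  case 0
  show ?case
    using lin_ext_monomial[of "shear_mon i j s" 0] by (simp add: shear_mon_zero)
next
  case (Suc k)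
  then show ?case
    by (simp add: lin_ext_mult[of "shear_mon i j s", OF shear_mon_add])
qed

lemma shear_inverse:
  assumes "i \<noteq> j"
  shows "lin_ext (shear_mon i j s) (shear_mon i j (- s) m) = monomial m"
proof -
  define q where "q = m - Poly_Mapping.single j (lookup m j)"
  have m: "m = q + Poly_Mapping.single j (lookup m j)" and q: "lookup q j = 0"
    unfolding q_def by (rule poly_mapping_eqI) (simp_all add: lookup_add lookup_minus lookup_single when_def)
  have "lin_ext (shear_mon i j s) (monomial (unit_exp j) + scalar (- s) * monomial (unit_exp i))
      = monomial (unit_exp j) + scalar s * monomial (unit_exp i) + scalar (- s) * monomial (unit_exp i)"
    using assms by (simp add: lin_ext_add lin_ext_scale shear_mon_unit_exp shear_mon_eq_monomial lookup_single when_def)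
  also have "\<dots> = monomial (unit_exp j)"
    by (rule poly_mapping_eqI) (simp add: lookup_add)
  finally have "lin_ext (shear_mon i j s) (shear_mon i j (- s) m) = monomial q * monomial (unit_exp j) ^ lookup m j"
    by (simp add: shear_mon_def[of i j "- s" m] q_def[symmetric] lin_ext_mult[of "shear_mon i j s", OF shear_mon_add]
        lin_ext_shear_power shear_mon_eq_monomial[OF q])
  moreover have "monomial (unit_exp j) ^ k = (monomial (Poly_Mapping.single j k) :: ('n, 'k) mpoly)" for k
  proof (induction k)
    case (Suc k)
    have "Poly_Mapping.single j (Suc k) = unit_exp j + Poly_Mapping.single j k"
      by (rule poly_mapping_eqI) (simp add: lookup_add lookup_single when_def)
    with Suc show ?case
      by (simp add: monomial_add)
  qed simp
  ultimately show ?thesis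
    using m by (simp flip: monomial_add)
qed

lemma shear_res:
  assumes "shiftable i j"
  shows "shear i j s (res (monomial m)) = res (shear_mon i j s m)"
  unfolding shear_def using induced_lin_ext[of "shear_mon i j s" "monomial m"] shear_mon_in_I[OF assms] by simp

lemma shear_in_Aut:
  assumes "shiftable i j" "i \<noteq> j"
  shows "shear i j s \<in> Aut"
  unfolding shear_def
proof (rule induced_in_alg_auts)
  show "shear_mon i j s (a + b) = shear_mon i j s a * shear_mon i j s b" for a b
    by (rule shear_mon_add)
  show "shear_mon i j s 0 = 1"
    by (rule shear_mon_zero)
  show "shear_mon i j s m \<in> I" "shear_mon i j (- s) m \<in> I" if "m \<notin> M" for m
    using shear_mon_in_I[OF assms(1) that] by simp_all
  show "lin_ext (shear_mon i j s) (shear_mon i j (- s) m) = monomial m" for m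
    by (rule shear_inverse[OF assms(2)])
  show "lin_ext (shear_mon i j (- s)) (shear_mon i j s m) = monomial m" for m
    using shear_inverse[OF assms(2), of "- s"] by simp
qed

lemma shear_in_IC:
  assumes "shiftable i j" "i \<noteq> j"
  shows "shear i j s \<in> IC"
proof -
  \<comment> \<open>Weight 1 on \<open>x_i\<close> and 0 elsewhere: the term added to
    \<open>x_j\<close> is heavier than \<open>x_j\<close>, so the shear is unitriangular.\<close>
  define w where "w l = (if l = i then 1 else 0 :: nat)" for l
  have "raises w 1 (mon_val (\<lambda>_. 1)) (shear i j s)"
  proof (rule raises_from_gens[OF shear_in_Aut[OF assms]])
    fix l p assume p: "p \<in> M" "mat (shear i j s) p (unit_exp l) \<noteq> (if p = unit_exp l then 1 else 0)"
    have "l = j"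
    proof (rule ccontr)
      assume "l \<noteq> j"
      then have "shear_mon i j s (unit_exp l) = monomial (unit_exp l)"
        by (intro shear_mon_eq_monomial) (simp add: lookup_single when_def)
      then show False
        using p by (simp add: mat_def shear_res[OF assms(1)] lookup_monomial)
    qed
    then have "p = unit_exp i"
      using p by (auto simp: mat_def shear_res[OF assms(1)] shear_mon_unit_exp lookup_add lookup_monomial split: if_splits)
    then show "w l < wt w p"
      using \<open>l = j\<close> assms(2) by (simp add: w_def)
  qed
  moreover have "mon_val (\<lambda>_. 1) = (\<lambda>_ :: 'n \<Rightarrow>\<^sub>0 nat. 1 :: 'k)"
    by (rule ext) simp
  ultimately have "shear i j s \<in> unitriangular w 1"
    using shear_in_Aut[OF assms] by (simp add: unitriangular_def)
  then show ?thesis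
    using unitriangular_subset_IC by blast
qed

text \<open>\<open>acts i j g a b c d\<close>: the matrix with rows \<open>(a, b)\<close> and \<open>(c, d)\<close> describes the images of \<open>x\<^sub>i\<close> and \<open>x\<^sub>j\<close>, so
  a product of automorphisms corresponds to the product of the matrices in reverse order.\<close>

definition acts :: "'n \<Rightarrow> 'n \<Rightarrow> (('n, 'k) mpoly set \<Rightarrow> ('n, 'k) mpoly set) \<Rightarrow> 'k \<Rightarrow> 'k \<Rightarrow> 'k \<Rightarrow> 'k \<Rightarrow> bool" where
  "acts i j g a b c d \<longleftrightarrow> g \<in> Aut \<and>
     g (gen i) = res (scalar a * monomial (unit_exp i) + scalar b * monomial (unit_exp j)) \<and>
     g (gen j) = res (scalar c * monomial (unit_exp i) + scalar d * monomial (unit_exp j)) \<and>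
     (\<forall>l. l \<noteq> i \<longrightarrow> l \<noteq> j \<longrightarrow> g (gen l) = gen l)"

lemma acts_unique:
  assumes "acts i j g a b c d" "acts i j h a b c d"
  shows "g = h"
  by (rule aut_eqI_gen) (use assms in \<open>simp_all only: acts_def\<close>, metis)

lemma acts_combination:
  assumes "acts i j g a b c d"
  shows "g (res (scalar p * monomial (unit_exp i) + scalar q * monomial (unit_exp j)))
    = res (scalar (p * a + q * c) * monomial (unit_exp i) + scalar (p * b + q * d) * monomial (unit_exp j))"
proof -
  have g: "g \<in> Aut"
    using assms by (simp add: acts_def)
  have "g (res (scalar p * monomial (unit_exp i) + scalar q * monomial (unit_exp j)))
    = (p \<odot>\<^bsub>A\<^esub> g (gen i)) \<oplus>\<^bsub>A\<^esub> (q \<odot>\<^bsub>A\<^esub> g (gen j))"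
    by (simp only: aut_add[OF g] aut_scale[OF g])
  also have "\<dots> = res (scalar p * (scalar a * monomial (unit_exp i) + scalar b * monomial (unit_exp j))
      + scalar q * (scalar c * monomial (unit_exp i) + scalar d * monomial (unit_exp j)))"
    using assms by (simp add: acts_def)
  also have "scalar p * (scalar a * monomial (unit_exp i) + scalar b * monomial (unit_exp j))
      + scalar q * (scalar c * monomial (unit_exp i) + scalar d * monomial (unit_exp j))
    = scalar (p * a + q * c) * monomial (unit_exp i) + scalar (p * b + q * d) * monomial (unit_exp j)"
    by (rule poly_mapping_eqI) (simp only: lookup_add distrib_left lookup_scalar_mult, simp add: algebra_simps)
  finally show ?thesis .
qed

lemma acts_mult:
  assumes g: "acts i j g a b c d" and h: "acts i j h a' b' c' d'"
  shows "acts i j (g \<otimes>\<^bsub>G\<^esub> h) (a' * a + b' * c) (a' * b + b' * d) (c' * a + d' * c) (c' * b + d' * d)"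
proof -
  have gh: "g \<in> Aut" "h \<in> Aut"
    using g h by (simp_all add: acts_def)
  have "(g \<otimes>\<^bsub>G\<^esub> h) (gen l) = g (h (gen l))" for l
    using gh by (simp add: mult_G_apply)
  then show ?thesis
    using h g gh acts_combination[OF g] unfolding acts_def by simp
qed

lemma acts_shear:
  assumes "shiftable i j" "i \<noteq> j"
  shows "acts i j (shear i j s) 1 0 s 1" "acts j i (shear i j s) 1 s 0 1"
proof -
  have *: "shear i j s (gen l) = gen l" if "l \<noteq> j" for l
    using that by (simp add: shear_res[OF assms(1)] shear_mon_eq_monomial lookup_single when_def)
  have "shear i j s (gen j) = res (scalar s * monomial (unit_exp i) + monomial (unit_exp j))"
    by (simp add: shear_res[OF assms(1)] shear_mon_unit_exp add.commute)
  with * show "acts i j (shear i j s) 1 0 s 1" "acts j i (shear i j s) 1 s 0 1"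
    using assms shear_in_Aut[OF assms] by (simp_all add: acts_def add.commute)
qed

lemma acts_one: "i \<noteq> j \<Longrightarrow> acts i j \<one>\<^bsub>G\<^esub> 1 0 0 1"
  by (simp add: acts_def one_G_apply)

lemma acts_torus:
  assumes "i \<noteq> j" "t \<noteq> 0"
  shows "acts i j (torus_aut (\<lambda>l. if l = i then t else if l = j then inverse t else 1)) t 0 0 (inverse t)"
  using assms by (simp add: acts_def torus_aut_in_Aut)

section \<open>Relations of SL(2) for a pair of opposite roots\<close>

context
  fixes i j
  assumes ij: "i \<noteq> j" "shiftable i j" "shiftable j i"
begin

abbreviation "shear_ij \<equiv> shear i j"
abbreviation "shear_ji \<equiv> shear j i"
abbreviation "diag_aut t \<equiv> torus_aut (\<lambda>l. if l = i then t else if l = j then inverse t else 1)"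

lemma acts_up: "acts i j (shear_ij s) 1 0 s 1"
  using acts_shear(1)[of i j] ij by simp

lemma acts_down: "acts i j (shear_ji s) 1 s 0 1"
  using acts_shear(2)[of j i] ij by simp

lemma Aut_generators: "shear_ij s \<in> Aut" "shear_ji s \<in> Aut" "t \<noteq> 0 \<Longrightarrow> diag_aut t \<in> Aut"
  using ij by (simp_all add: shear_in_Aut torus_aut_in_Aut)

lemma inv_generators:
  "inv\<^bsub>G\<^esub> (shear_ij s) = shear_ij (- s)" "inv\<^bsub>G\<^esub> (shear_ji s) = shear_ji (- s)" "t \<noteq> 0 \<Longrightarrow> inv\<^bsub>G\<^esub> (diag_aut t) = diag_aut (inverse t)"
proof -
  have "acts i j (shear_ij (- s) \<otimes>\<^bsub>G\<^esub> shear_ij s) 1 0 0 1"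
    using acts_mult[OF acts_up acts_up, of "- s" s] by simp
  then show "inv\<^bsub>G\<^esub> (shear_ij s) = shear_ij (- s)"
    using acts_unique[OF _ acts_one[OF ij(1)]] Aut_generators by (intro G.inv_equality) simp_all
  have "acts i j (shear_ji (- s) \<otimes>\<^bsub>G\<^esub> shear_ji s) 1 0 0 1"
    using acts_mult[OF acts_down acts_down, of "- s" s] by simp
  then show "inv\<^bsub>G\<^esub> (shear_ji s) = shear_ji (- s)"
    using acts_unique[OF _ acts_one[OF ij(1)]] Aut_generators by (intro G.inv_equality) simp_all
  assume t: "t \<noteq> 0"
  have "acts i j (diag_aut (inverse t) \<otimes>\<^bsub>G\<^esub> diag_aut t) 1 0 0 1"
    using acts_mult[OF acts_torus acts_torus, of i j "inverse t" t] ij t by simp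
  then show "inv\<^bsub>G\<^esub> (diag_aut t) = diag_aut (inverse t)"
    using acts_unique[OF _ acts_one[OF ij(1)]] Aut_generators t
    by (intro G.inv_equality) simp_all
qed

lemma acts_diag: "t \<noteq> 0 \<Longrightarrow> acts i j (diag_aut t) t 0 0 (inverse t)"
  using acts_torus[OF ij(1)] .

text \<open>Conjugation by the diagonal element multiplies the parameter by 4, and the inverse shear
  subtracts \<open>s\<close>.\<close>

lemma commutator_diag_up:
  "diag_aut 2 \<otimes>\<^bsub>G\<^esub> shear_ij s \<otimes>\<^bsub>G\<^esub> inv\<^bsub>G\<^esub> (diag_aut 2) \<otimes>\<^bsub>G\<^esub> inv\<^bsub>G\<^esub> (shear_ij s) = shear_ij (3 * s)"
proof -
  have "acts i j (diag_aut 2 \<otimes>\<^bsub>G\<^esub> shear_ij s \<otimes>\<^bsub>G\<^esub> diag_aut (inverse 2) \<otimes>\<^bsub>G\<^esub> shear_ij (- s)) 1 0 (3 * s) 1"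
    using acts_mult[OF acts_mult[OF acts_mult[OF acts_diag[of 2] acts_up[of s]] acts_diag[of "inverse 2"]] acts_up[of "- s"]]
    by (simp add: field_simps)
  then show ?thesis
    using acts_unique[OF _ acts_up] by (simp add: inv_generators)
qed

text \<open>Here the conjugation divides the parameter by 4, and
  \<open>1/4 - 1 = -3/4\<close>.\<close>

lemma commutator_diag_down:
  "diag_aut 2 \<otimes>\<^bsub>G\<^esub> shear_ji s \<otimes>\<^bsub>G\<^esub> inv\<^bsub>G\<^esub> (diag_aut 2) \<otimes>\<^bsub>G\<^esub> inv\<^bsub>G\<^esub> (shear_ji s) = shear_ji (- 3 / 4 * s)"
proof -
  have "acts i j (diag_aut 2 \<otimes>\<^bsub>G\<^esub> shear_ji s \<otimes>\<^bsub>G\<^esub> diag_aut (inverse 2) \<otimes>\<^bsub>G\<^esub> shear_ji (- s)) 1 (- 3 / 4 * s) 0 1"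
    using acts_mult[OF acts_mult[OF acts_mult[OF acts_diag[of 2] acts_down[of s]] acts_diag[of "inverse 2"]] acts_down[of "- s"]]
    by (simp add: field_simps)
  then show ?thesis
    using acts_unique[OF _ acts_down] by (simp add: inv_generators)
qed

text \<open>The first two factors have the matrix with rows \<open>(2, 1)\<close> and
  \<open>(1, 1)\<close>; the other two are the row operations that diagonalize it. So every subgroup
  containing both root subgroups contains \<open>diag_aut 2\<close>.\<close>

lemma diag_product: "diag_aut 2 = shear_ij 1 \<otimes>\<^bsub>G\<^esub> shear_ji 1 \<otimes>\<^bsub>G\<^esub> shear_ij (- 1 / 2) \<otimes>\<^bsub>G\<^esub> shear_ji (- 2)"
proof -
  have "acts i j (shear_ij 1 \<otimes>\<^bsub>G\<^esub> shear_ji 1 \<otimes>\<^bsub>G\<^esub> shear_ij (- 1 / 2) \<otimes>\<^bsub>G\<^esub> shear_ji (- 2)) 2 0 0 (inverse 2)"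
    using acts_mult[OF acts_mult[OF acts_mult[OF acts_up[of 1] acts_down[of 1]] acts_up[of "- 1 / 2"]] acts_down[of "- 2"]]
    by (simp add: field_simps)
  then show ?thesis
    using acts_unique[OF acts_diag[of 2]] by simp
qed

text \<open>A subgroup with both root subgroups contains \<open>diag_aut 2\<close>, and the
  commutators with it return every shear, since the factors 3 and -3/4 are invertible. Thus no term
  of the derived series is trivial.\<close>

lemma not_solvable: "\<not> solvable (G\<lparr>carrier := IC\<rparr>)"
proof
  assume "solvable (G\<lparr>carrier := IC\<rparr>)"
  then obtain n where n: "(derived G ^^ n) IC = {\<one>\<^bsub>G\<^esub>}"
    unfolding G.solvable_subgroup_iff[OF subgroup_IC] by blast
  have "shear_ij s \<in> (derived G ^^ n) IC \<and> shear_ji s \<in> (derived G ^^ n) IC" for s n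
  proof (induction n arbitrary: s)
    case 0
    then show ?case
      using ij by (simp add: shear_in_IC)
  next
    case (Suc n)
    define D where "D = (derived G ^^ n) IC"
    interpret D: subgroup D G
      unfolding D_def by (rule G.exp_of_derived_is_subgroup[OF subgroup_IC])
    have D: "shear_ij s \<in> D" "shear_ji s \<in> D" for s
      using Suc.IH by (simp_all add: D_def)
    then have "diag_aut 2 \<in> D"
      unfolding diag_product by blast
    have comm: "g \<otimes>\<^bsub>G\<^esub> h \<otimes>\<^bsub>G\<^esub> inv\<^bsub>G\<^esub> g \<otimes>\<^bsub>G\<^esub> inv\<^bsub>G\<^esub> h \<in> derived G D" if "g \<in> D" "h \<in> D" for g h
      unfolding derived_def using that by (intro generate.incl) blast
    have "shear_ij (3 * (s / 3)) \<in> derived G D"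
      unfolding commutator_diag_up[symmetric] by (rule comm[OF \<open>diag_aut 2 \<in> D\<close> D(1)])
    moreover have "shear_ji (- 3 / 4 * (- 4 / 3 * s)) \<in> derived G D"
      unfolding commutator_diag_down[symmetric] by (rule comm[OF \<open>diag_aut 2 \<in> D\<close> D(2)])
    ultimately show ?case
      by (simp add: D_def)
  qed
  then have "shear_ij 1 = \<one>\<^bsub>G\<^esub>"
    using n by blast
  then have "shear_ij 1 (gen j) = gen j"
    by (simp add: one_G_apply)
  then have "coord (unit_exp i) (shear_ij 1 (gen j)) = coord (unit_exp i) (gen j)"
    by simp
  moreover have "unit_exp i \<noteq> unit_exp j"
    using ij(1) by (metis lookup_single_eq lookup_single_not_eq zero_neq_one)
  ultimately show False
    using ij(1) by (simp add: shear_res[OF ij(2)] shear_mon_unit_exp lookup_add lookup_monomial)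
qed

text \<open>The commutators with the torus force the unipotent normal complement \<open>R\<close> of the torus to contain both
  root subgroups, but \<open>shear_ij 1\<close> and \<open>shear_ji (1/2)\<close> have a product with eigenvalue 2.\<close>

lemma torus_not_reductive_part: "\<not> is_reductive_part I (torus I)"
proof
  assume "is_reductive_part I (torus I)"
  then obtain R where R: "normal_unipotent A IC R" and TR: "torus I <#>\<^bsub>G\<^esub> R = IC"
    unfolding is_reductive_part_def levi_decomposition_def is_unipotent_radical_def by blast
  have R': "subgroup R G" "R \<subseteq> IC" "\<And>x r. x \<in> IC \<Longrightarrow> r \<in> R \<Longrightarrow> x \<otimes>\<^bsub>G\<^esub> r \<otimes>\<^bsub>G\<^esub> inv\<^bsub>G\<^esub> x \<in> R"
    using R unfolding normal_unipotent_def G.normal_in_subgroup_iff[OF subgroup_IC] by blast+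
  interpret R: subgroup R G
    by (rule R'(1))
  have d: "diag_aut 2 \<in> torus I"
    unfolding torus_eq by (intro CollectI exI[of _ "\<lambda>l. if l = i then 2 else if l = j then inverse 2 else 1"]) simp
  \<comment> \<open>Modulo \<open>R\<close> the group is an image of the commutative torus.
    Explicitly, for \<open>g = t r\<close> the commutator of \<open>h\<close> and \<open>g\<close>
    is the conjugate by \<open>t\<close> of the commutator of \<open>h\<close> and
    \<open>r\<close>.\<close>
  have comm: "diag_aut 2 \<otimes>\<^bsub>G\<^esub> g \<otimes>\<^bsub>G\<^esub> inv\<^bsub>G\<^esub> (diag_aut 2) \<otimes>\<^bsub>G\<^esub> inv\<^bsub>G\<^esub> g \<in> R" if g: "g \<in> IC" for g
  proof -
    define h where "h = diag_aut 2"
    obtain t r where tr: "t \<in> torus I" "r \<in> R" "g = t \<otimes>\<^bsub>G\<^esub> r"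
      using g unfolding TR[symmetric] set_mult_def by blast
    have Aut: "t \<in> Aut" "r \<in> Aut" "h \<in> Aut"
      using tr(1,2) R.subset subgroup.subset[OF subgroup_torus] d by (auto simp: h_def)
    have ht: "h \<otimes>\<^bsub>G\<^esub> t = t \<otimes>\<^bsub>G\<^esub> h"
      using torus_commute[OF d tr(1)] by (simp add: h_def)
    have "h \<otimes>\<^bsub>G\<^esub> r \<otimes>\<^bsub>G\<^esub> inv\<^bsub>G\<^esub> h \<in> R"
      using R'(3)[OF _ tr(2)] d torus_subset_IC by (auto simp: h_def)
    then have "(h \<otimes>\<^bsub>G\<^esub> r \<otimes>\<^bsub>G\<^esub> inv\<^bsub>G\<^esub> h) \<otimes>\<^bsub>G\<^esub> inv\<^bsub>G\<^esub> r \<in> R"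
      using tr(2) by blast
    then have "t \<otimes>\<^bsub>G\<^esub> ((h \<otimes>\<^bsub>G\<^esub> r \<otimes>\<^bsub>G\<^esub> inv\<^bsub>G\<^esub> h) \<otimes>\<^bsub>G\<^esub> inv\<^bsub>G\<^esub> r) \<otimes>\<^bsub>G\<^esub> inv\<^bsub>G\<^esub> t \<in> R"
      using R'(3) tr(1) torus_subset_IC by blast
    moreover have "h \<otimes>\<^bsub>G\<^esub> g \<otimes>\<^bsub>G\<^esub> inv\<^bsub>G\<^esub> h \<otimes>\<^bsub>G\<^esub> inv\<^bsub>G\<^esub> g
        = (h \<otimes>\<^bsub>G\<^esub> t) \<otimes>\<^bsub>G\<^esub> (r \<otimes>\<^bsub>G\<^esub> inv\<^bsub>G\<^esub> h \<otimes>\<^bsub>G\<^esub> inv\<^bsub>G\<^esub> r \<otimes>\<^bsub>G\<^esub> inv\<^bsub>G\<^esub> t)"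
      using Aut by (simp add: tr(3) G.inv_mult_group G.m_assoc)
    moreover have "\<dots> = t \<otimes>\<^bsub>G\<^esub> ((h \<otimes>\<^bsub>G\<^esub> r \<otimes>\<^bsub>G\<^esub> inv\<^bsub>G\<^esub> h) \<otimes>\<^bsub>G\<^esub> inv\<^bsub>G\<^esub> r) \<otimes>\<^bsub>G\<^esub> inv\<^bsub>G\<^esub> t"
      unfolding ht using Aut by (simp add: G.m_assoc)
    ultimately show ?thesis
      by (simp add: h_def)
  qed
  have "shear_ij (3 * (1 / 3)) \<in> R"
    unfolding commutator_diag_up[symmetric] using ij by (intro comm shear_in_IC)
  moreover have "shear_ji (- 3 / 4 * (- 2 / 3)) \<in> R"
    unfolding commutator_diag_down[symmetric] using ij by (intro comm shear_in_IC) auto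
  ultimately have "shear_ij 1 \<otimes>\<^bsub>G\<^esub> shear_ji (1 / 2) \<in> R"
    using R.m_closed[of "shear_ij 1" "shear_ji (1 / 2)"] by simp
  then obtain N where N: "\<And>x. x \<in> carrier A \<Longrightarrow>
      ((\<lambda>y. (shear_ij 1 \<otimes>\<^bsub>G\<^esub> shear_ji (1 / 2)) y \<ominus>\<^bsub>A\<^esub> y) ^^ N) x = \<zero>\<^bsub>A\<^esub>"
    using R unfolding normal_unipotent_def unipotent_def by blast
  \<comment> \<open>On the span of \<open>x_i\<close> and \<open>x_j\<close> the product has trace
    5/2 and determinant 1, hence the eigenvalues 2 and 1/2. \<open>f\<close> is an eigenvector for
    2, so it is fixed by the product minus the identity, which therefore is not nilpotent.\<close>
  define f :: "('n, 'k) mpoly" where "f = scalar 2 * monomial (unit_exp i) + scalar 1 * monomial (unit_exp j)"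
  have "acts i j (shear_ij 1 \<otimes>\<^bsub>G\<^esub> shear_ji (1 / 2)) (3 / 2) (1 / 2) 1 1"
    using acts_mult[OF acts_up[of 1] acts_down[of "1 / 2"]] by simp
  from acts_combination[OF this, of 2 1]
  have "(shear_ij 1 \<otimes>\<^bsub>G\<^esub> shear_ji (1 / 2)) (res f) = res (scalar 4 * monomial (unit_exp i) + scalar 2 * monomial (unit_exp j))"
    by (simp add: f_def)
  also have "scalar 4 * monomial (unit_exp i) + scalar 2 * monomial (unit_exp j) = f + f"
    by (rule poly_mapping_eqI) (simp only: f_def lookup_add lookup_scalar_mult, simp)
  finally have "((\<lambda>y. (shear_ij 1 \<otimes>\<^bsub>G\<^esub> shear_ji (1 / 2)) y \<ominus>\<^bsub>A\<^esub> y) ^^ n) (res f) = res f" for n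
    by (induction n) simp_all
  then have "res f = res 0"
    using N[of "res f"] by (simp add: zero_A)
  then have "coord (unit_exp i) (res f) = coord (unit_exp i) (res 0)"
    by simp
  then have "lookup f (unit_exp i) = 0"
    by simp
  moreover have "unit_exp i \<noteq> unit_exp j"
    using ij(1) by (metis lookup_single_eq lookup_single_not_eq zero_neq_one)
  then have "lookup f (unit_exp i) = 2"
    by (simp only: f_def lookup_add lookup_scalar_mult lookup_monomial) simp
  ultimately show False
    by simp
qed

end

section \<open>The roots of degree \<open>e\<^sub>i - e\<^sub>j\<close>\<close>

text \<open>The value of \<open>x_i d/dx_j\<close> on \<open>x^m\<close>. Where the truncated
  subtraction would distort the exponent, \<open>x_j\<close> does not divide \<open>x^m\<close> and
  the coefficient is 0.\<close>

definition root_mon :: "'n \<Rightarrow> 'n \<Rightarrow> ('n \<Rightarrow>\<^sub>0 nat) \<Rightarrow> ('n, 'k) mpoly" where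
  "root_mon i j m = scalar (of_nat (lookup m j)) * monomial (m - unit_exp j + unit_exp i)"

definition root_derivation :: "'n \<Rightarrow> 'n \<Rightarrow> ('n, 'k) mpoly set \<Rightarrow> ('n, 'k) mpoly set" where
  "root_derivation i j = induced (lin_ext (root_mon i j))"

lemma exponent_minus_unit:
  assumes "lookup m j > 0"
  shows "m - unit_exp j + unit_exp j = (m :: 'n \<Rightarrow>\<^sub>0 nat)"
  by (rule poly_mapping_eqI) (use assms in \<open>auto simp: lookup_add lookup_minus lookup_single when_def\<close>)

lemma root_mon_Leibniz:
  "root_mon i j (a + b) = root_mon i j a * monomial b + monomial a * root_mon i j b"
proof -
  have *: "scalar (of_nat (lookup x j)) * monomial (x + y - unit_exp j + unit_exp i) = root_mon i j x * monomial y"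
    for x y :: "'n \<Rightarrow>\<^sub>0 nat"
  proof (cases "lookup x j > 0")
    case True
    then have "x + y - unit_exp j + unit_exp i = (x - unit_exp j + unit_exp i) + y"
      by (intro poly_mapping_eqI) (auto simp: lookup_add lookup_minus lookup_single when_def)
    then show ?thesis
      by (simp only: root_mon_def monomial_add mult.assoc)
  qed (simp add: root_mon_def)
  have "root_mon i j (a + b) = scalar (of_nat (lookup a j)) * monomial (a + b - unit_exp j + unit_exp i)
      + scalar (of_nat (lookup b j)) * monomial (b + a - unit_exp j + unit_exp i)"
    by (simp only: root_mon_def lookup_add of_nat_add single_add distrib_right add.commute[of a b])
      (rule add.commute)
  then show ?thesis
    unfolding * by (simp only: mult.commute[of "monomial a"])
qed

lemma root_mon_in_I:
  assumes "shiftable i j" "m \<notin> M"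
  shows "root_mon i j m \<in> I"
proof (cases "lookup m j > 0")
  case True
  have "(m - unit_exp j) + unit_exp j \<in> supp I"
    using assms(2) by (simp only: exponent_minus_unit[OF True]) (simp add: M_def)
  then have "m - unit_exp j + unit_exp i \<in> supp I"
    using assms(1) unfolding shiftable_def by blast
  then show ?thesis
    unfolding root_mon_def by (intro monomial_in_I) (simp add: M_def)
next
  case False
  then show ?thesis
    by (simp add: root_mon_def mem_I_iff)
qed

context
  fixes i j
  assumes ij: "i \<noteq> j" "shiftable i j"
begin

lemma root_derivation_res: "root_derivation i j (res f) = res (lin_ext (root_mon i j) f)"
  unfolding root_derivation_def by (rule induced_lin_ext) (rule root_mon_in_I[OF ij(2)])

lemma derivation_root_derivation: "derivation A (root_derivation i j)"
  unfolding root_derivation_def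
  by (rule derivation_induced) (rule root_mon_in_I[OF ij(2)], assumption, rule root_mon_Leibniz)

lemma root_derivation_nonzero: "root_derivation i j (gen j) \<noteq> \<zero>\<^bsub>A\<^esub>"
proof -
  have "unit_exp j - unit_exp j + unit_exp i = unit_exp i"
    by simp
  then have "root_derivation i j (gen j) = gen i"
    by (simp add: root_derivation_res root_mon_def)
  then show ?thesis
    using res_monomial_neq_0[OF unit_exp_in_M] by (simp add: zero_A)
qed

text \<open>Each application increases the exponent of \<open>x\<^sub>i\<close>, which is bounded on \<open>M\<close>.\<close>

lemma nilpotent_root_derivation: "nilpotent_on A (root_derivation i j)"
proof -
  define D where "D = root_derivation i j"
  define N where "N = Suc (Max ((\<lambda>m. lookup m i) ` M))"
  have N: "lookup m i < N" if "m \<in> M" for m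
    using that by (simp add: N_def less_Suc_eq_le)
  have closed: "(D ^^ n) x \<in> carrier A" if "x \<in> carrier A" for n x
    using that by (induction n) (auto simp: D_def root_derivation_res elim!: carrierE)
  have deg: "n \<le> lookup p i" if "x \<in> carrier A" "p \<in> M" "coord p ((D ^^ n) x) \<noteq> 0" for n p x
    using that
  proof (induction n arbitrary: p)
    case (Suc n)
    obtain f where f: "(D ^^ n) x = res f"
      using closed[OF Suc.prems(1)] by (rule carrierE)
    have "(D ^^ Suc n) x = res (lin_ext (root_mon i j) f)"
      unfolding funpow.simps o_apply f by (simp only: D_def root_derivation_res)
    then have "lookup (lin_ext (root_mon i j) f) p \<noteq> 0"
      using Suc.prems by simp
    then obtain m where m: "lookup f m * lookup (root_mon i j m) p \<noteq> 0"
      unfolding lin_ext_def lookup_sum lookup_scalar_mult by (meson sum.neutral)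
    then have "m \<in> M"
      using root_mon_in_I[OF ij(2), of m] Suc.prems(2) by (auto simp: mem_I_iff)
    then have "n \<le> lookup m i"
      using Suc.IH[OF Suc.prems(1), of m] m by (simp add: f)
    moreover have "p = m - unit_exp j + unit_exp i"
      using m by (auto simp: root_mon_def lookup_monomial simp del: single_of_nat split: if_splits)
    ultimately show ?case
      using ij(1) by (simp add: lookup_add lookup_minus lookup_single when_def)
  qed simp
  have "(D ^^ N) x = \<zero>\<^bsub>A\<^esub>" if x: "x \<in> carrier A" for x
  proof (rule coord_eqI)
    fix p assume p: "p \<in> M"
    show "coord p ((D ^^ N) x) = coord p \<zero>\<^bsub>A\<^esub>"
      using deg[OF x p, of N] N[OF p] p by (auto simp: zero_A)
  qed (use closed x in \<open>simp_all add: zero_A\<close>)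
  then show ?thesis
    unfolding nilpotent_on_def D_def by blast
qed

lemma homogeneous_root_derivation:
  "homogeneous I (Poly_Mapping.single i 1 - Poly_Mapping.single j 1) (root_derivation i j)"
  unfolding homogeneous_def
proof (intro allI subsetI)
  fix \<beta> y
  assume "y \<in> root_derivation i j ` graded_piece I \<beta>"
  then consider "y = root_derivation i j (res 0)"
    | c m where "y = root_derivation i j (res (scalar c * monomial m))" "Poly_Mapping.map int m = \<beta>"
    unfolding graded_piece_def by (auto simp: zero_A)
  then show "y \<in> graded_piece I (\<beta> + (Poly_Mapping.single i 1 - Poly_Mapping.single j 1))"
  proof cases
    case 1
    then show ?thesis
      by (simp add: graded_piece_def zero_A derivation_zero[OF derivation_root_derivation])
  next
    case (2 c m)
    have y: "y = res (scalar (c * of_nat (lookup m j)) * monomial (m - unit_exp j + unit_exp i))"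
      by (simp only: 2 root_derivation_res lin_ext_scale lin_ext_monomial root_mon_def scalar_mult mult.assoc)
    show ?thesis
    proof (cases "lookup m j > 0")
      case True
      then have "Poly_Mapping.map int (m - unit_exp j + unit_exp i)
          = \<beta> + (Poly_Mapping.single i 1 - Poly_Mapping.single j 1)"
        unfolding 2(2)[symmetric]
        by (intro poly_mapping_eqI)
          (auto simp: Poly_Mapping.map.rep_eq lookup_add lookup_minus lookup_single when_def of_nat_diff)
      then show ?thesis
        unfolding graded_piece_def y smult_A[symmetric] by blast
    next
      case False
      then show ?thesis
        by (simp add: y graded_piece_def zero_A)
    qed
  qed
qed

lemma liftable_root_derivation: "liftable I (root_derivation i j)"
  unfolding liftable_def
proof (intro exI conjI allI)
  show "derivation polynomial_algebra (lin_ext (root_mon i j))"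
    unfolding derivation_def
    by (simp add: lin_ext_add lin_ext_scale lin_ext_Leibniz[of "root_mon i j", OF root_mon_Leibniz])
  show "lin_ext (root_mon i j) ` I \<subseteq> I"
    using lin_ext_in_I[of "root_mon i j"] root_mon_in_I[OF ij(2)] by blast
qed (rule root_derivation_res)

lemma root_if_shiftable: "Poly_Mapping.single i 1 - Poly_Mapping.single j 1 \<in> roots I"
  unfolding roots_def
  using derivation_root_derivation root_derivation_nonzero nilpotent_root_derivation
    homogeneous_root_derivation liftable_root_derivation res_in_carrier by blast

end

lemma derivation_eq_zero:
  assumes D: "derivation A D" and gens: "\<And>l. D (gen l) = res 0" and x: "x \<in> carrier A"
  shows "D x = res 0"
proof -
  obtain f where f: "x = res f"
    using x by (rule carrierE)
  have mono: "D (res (monomial m)) = res 0" for m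
    by (induction m rule: exponent_induct)
      (simp_all add: derivation_one[OF D] monomial_add derivation_mult[OF D] gens)
  have "D (res f) = res 0"
    by (induction f rule: mpoly_induct)
      (simp_all add: mono derivation_scale[OF D] derivation_add[OF D])
  then show ?thesis
    by (simp add: f)
qed

text \<open>A nonzero derivation is nonzero on some variable \<open>x_l\<close>. By homogeneity the
  image has exponent \<open>e_l + e_i - e_j\<close>, which is nonnegative only for
  \<open>l = j\<close>; so \<open>x_j\<close> goes to a nonzero multiple of
  \<open>x_i\<close>.\<close>

lemma shiftable_if_root:
  assumes ij: "i \<noteq> j" and root: "Poly_Mapping.single i 1 - Poly_Mapping.single j 1 \<in> roots I"
  shows "shiftable i j"
proof -
  obtain D where D: "derivation A D" "\<exists>x\<in>carrier A. D x \<noteq> \<zero>\<^bsub>A\<^esub>"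
    "homogeneous I (Poly_Mapping.single i 1 - Poly_Mapping.single j 1) D"
    using root unfolding roots_def by blast
  obtain l where l: "D (gen l) \<noteq> res 0"
    using D(2) derivation_eq_zero[OF D(1)] unfolding zero_A by metis
  have "gen l = 1 \<odot>\<^bsub>A\<^esub> gen l"
    by simp
  then have "gen l \<in> graded_piece I (Poly_Mapping.map int (unit_exp l))"
    unfolding graded_piece_def by blast
  then have "D (gen l) \<in> graded_piece I (Poly_Mapping.map int (unit_exp l) + (Poly_Mapping.single i 1 - Poly_Mapping.single j 1))"
    using D(3) unfolding homogeneous_def by blast
  then obtain c m where cm: "D (gen l) = c \<odot>\<^bsub>A\<^esub> res (monomial m)"
    and m: "Poly_Mapping.map int m = Poly_Mapping.map int (unit_exp l) + (Poly_Mapping.single i 1 - Poly_Mapping.single j 1)"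
    using l unfolding graded_piece_def zero_A by blast
  have c: "D (gen l) = res (scalar c * monomial m)"
    using cm by (simp only: smult_A)
  have m': "int (lookup m k) = (if k = l then 1 else 0) + (if k = i then 1 else 0) - (if k = j then 1 else 0)" for k
    using arg_cong[OF m, of "\<lambda>v. lookup v k"]
    by (auto simp: Poly_Mapping.map.rep_eq lookup_add lookup_minus lookup_single when_def split: if_splits)
  have "l = j"
    using m'[of j] ij by (auto split: if_splits)
  have "lookup m k = lookup (unit_exp i) k" for k
    using m'[of k] unfolding \<open>l = j\<close> by (simp add: lookup_single when_def split: if_splits)
  then have "m = unit_exp i"
    by (rule poly_mapping_eqI)
  have "c \<noteq> 0"
  proof
    assume "c = 0"
    then have "D (gen l) = res 0"
      unfolding c by simp
    with l show False
      by (rule notE)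
  qed
  moreover have "coord (unit_exp i) (D (gen j)) = c"
    using c unfolding \<open>l = j\<close> \<open>m = unit_exp i\<close> by (simp add: lookup_monomial)
  ultimately have "coord (unit_exp i) (D (gen j)) \<noteq> 0"
    by (simp only: not_False_eq_True)
  then show ?thesis
    by (rule shiftable_if_derivation[OF D(1) ij])
qed

lemma root_iff_shiftable:
  "i \<noteq> j \<Longrightarrow> Poly_Mapping.single i 1 - Poly_Mapping.single j 1 \<in> roots I \<longleftrightarrow> shiftable i j"
  using root_if_shiftable shiftable_if_root by blast

end

section \<open>Solvability of the identity component\<close>

text \<open>The two clauses on reductive parts presuppose neither existence nor uniqueness of a Levi
  factor containing the torus: one tests the torus itself, the other every such factor.\<close>

theorem proposition4p22:
  fixes I :: "('n::finite, 'k::field_char_0) mpoly set"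
  assumes "monomial_ideal I" and "full I" and "cofinite_support I"
  shows "let no_opposite_roots = (\<not> (\<exists>i j. i \<noteq> j \<and>
               Poly_Mapping.single i 1 - Poly_Mapping.single j 1 \<in> roots I \<and>
               Poly_Mapping.single j 1 - Poly_Mapping.single i 1 \<in> roots I))
         in (solvable ((aut_group (factor_algebra I))\<lparr>carrier := identity_component (factor_algebra I)\<rparr>)
               \<longleftrightarrow> no_opposite_roots) \<and>
            (is_reductive_part I (torus I) \<longleftrightarrow> no_opposite_roots) \<and>
            (\<forall>L. is_reductive_part I L \<longrightarrow> (L = torus I \<longleftrightarrow> no_opposite_roots))"
proof -
  interpret full_cofinite_ideal I
    using assms by unfold_locales
  define opp where "opp \<longleftrightarrow> (\<exists>i j. i \<noteq> j \<and>
               Poly_Mapping.single i 1 - Poly_Mapping.single j 1 \<in> roots I \<and>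
               Poly_Mapping.single j 1 - Poly_Mapping.single i 1 \<in> roots I)"
  have opp: "opp \<longleftrightarrow> (\<exists>i j. i \<noteq> j \<and> shiftable i j \<and> shiftable j i)"
    unfolding opp_def using root_iff_shiftable by metis
  have nonsolvable: "\<not> solvable (G\<lparr>carrier := IC\<rparr>)" "\<not> is_reductive_part I (torus I)" if opp
    using that not_solvable torus_not_reductive_part unfolding opp by blast+
  have split: "solvable (G\<lparr>carrier := IC\<rparr>) \<and> is_reductive_part I (torus I) \<and>
      (\<forall>L. is_reductive_part I L \<longrightarrow> L = torus I)" if no_opp: "\<not> opp"
  proof -
    have "\<not> shiftable j i" if "i \<noteq> j" "shiftable i j" for i j
      using no_opp that unfolding opp by blast
    then obtain w where IC: "IC = triangular w"
      by (rule IC_eq_triangular)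
    have "is_reductive_part I (torus I)"
      unfolding is_reductive_part_def IC using levi_triangular by blast
    moreover have "L = torus I" if L: "is_reductive_part I L" for L
    proof -
      obtain R where TL: "torus I \<subseteq> L" and R: "levi_decomposition A (triangular w) L R"
        using L unfolding is_reductive_part_def IC by blast
      have "R = unitriangular w 1"
        using R unipotent_radical_unique[OF _ unipotent_radical_triangular]
        unfolding levi_decomposition_def by blast
      with R have L: "subgroup L G" "L \<inter> unitriangular w 1 = {\<one>\<^bsub>G\<^esub>}" "L <#>\<^bsub>G\<^esub> unitriangular w 1 = triangular w"
        unfolding levi_decomposition_def reductive_def by blast+
      interpret L: subgroup L G
        by (rule L(1))
      \<comment> \<open>With \<open>g = t u\<close>, the factor \<open>t\<close> already lies in
        \<open>L\<close>, hence so does \<open>u\<close>; but \<open>L\<close> meets the unipotent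
        radical trivially.\<close>
      have "g \<in> torus I" if g: "g \<in> L" for g
      proof -
        have "g \<in> Aut"
          using L.subset g by auto
        then have "g = g \<otimes>\<^bsub>G\<^esub> \<one>\<^bsub>G\<^esub>"
          by simp
        then have "g \<in> triangular w"
          unfolding L(3)[symmetric] set_mult_def using g one_in_unitriangular by blast
        then obtain t u where tu: "t \<in> torus I" "u \<in> unitriangular w 1" "g = t \<otimes>\<^bsub>G\<^esub> u"
          by (rule triangular_decompose)
        have Aut: "t \<in> Aut" "u \<in> Aut"
          using tu(2) subgroup.subset[OF subgroup_torus] tu(1) by (auto simp: unitriangular_def)
        have "inv\<^bsub>G\<^esub> t \<otimes>\<^bsub>G\<^esub> g \<in> L"
          using g tu(1) TL by blast
        moreover have "inv\<^bsub>G\<^esub> t \<otimes>\<^bsub>G\<^esub> g = u"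
          using Aut by (simp add: tu(3) flip: G.m_assoc)
        ultimately have "u = \<one>\<^bsub>G\<^esub>"
          using L(2) tu(2) by blast
        then show ?thesis
          using tu Aut by simp
      qed
      then show ?thesis
        using TL by blast
    qed
    ultimately show ?thesis
      using solvable_triangular unfolding IC by blast
  qed
  have "(solvable (G\<lparr>carrier := IC\<rparr>) \<longleftrightarrow> \<not> opp) \<and> (is_reductive_part I (torus I) \<longleftrightarrow> \<not> opp) \<and>
      (\<forall>L. is_reductive_part I L \<longrightarrow> (L = torus I \<longleftrightarrow> \<not> opp))"
    using nonsolvable split by blast
  then show ?thesis
    unfolding Let_def opp_def .
qed

end
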